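(* For every $w\in S_\mathbb{Z}$, $$\Delta(\overleftarrow{\mathfrak{S}}_w(x;a))=\sum_{w\doteq uv}F_u(x\|a)\otimes\overleftarrow{\mathfrak{S}}_v(x;a)\qquad\text{and}\qquad \overleftarrow{\mathfrak{S}}_w(x;a)=\sum_{\substack{w\doteq uv\\ v\in S_{\ne0}}}F_u(x\|a)\,\mathfrak{S}_v(x;a).$$
   Context: $S_\mathbb{Z}$: permutations of $\mathbb{Z}$ fixing all but finitely many integers, generated by $s_i$ exchanging $i,i+1$; $z\doteq xy$ means $z=xy$ and $\ell(z)=\ell(x)+\ell(y)$. $S_+$, $S_-$ are generated by $s_i$ with $i\ge1$, resp. $i\le-1$; $S_{\ne0}=S_-\times S_+$. $\mathbb{Q}[a]=\mathbb{Q}[a_i\mid i\in\mathbb{Z}]$, $\mathbb{Q}[x,a]=\mathbb{Q}[x_i,a_i\mid i\in\mathbb{Z}]$. $\Lambda(x\|a)$ is the $\mathbb{Q}[a]$-algebra generated by the algebraically independent $p_k(x\|a)=\sum_{i\le0}(x_i^k-a_i^k)$, a Hopf algebra over $\mathbb{Q}[a]$ with the $p_k(x\|a)$ primitive. $\overleftarrow{R}(x;a)=\Lambda(x\|a)\otimes_{\mathbb{Q}[a]}\mathbb{Q}[x,a]$, with coaction $\Delta:\overleftarrow{R}(x;a)\to\Lambda(x\|a)\otimes_{\mathbb{Q}[a]}\overleftarrow{R}(x;a)$ induced by the coproduct of the first factor. Double Schubert polynomials $\mathfrak{S}_v(x;a)$ for $v\in S_+$: for $v\in S_n$, $\mathfrak{S}_{w_0^{(n)}}(x;a)=\prod_{i+j\le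 n}(x_i-a_j)$ and $\mathfrak{S}_v(x;a)=A_i\mathfrak{S}_{vs_i}(x;a)$ if $vs_i>v$, $A_i$ the divided difference in $x_i,x_{i+1}$. Let $\omega$ be the automorphism $s_i\mapsto s_{-i}$ of $S_\mathbb{Z}$ and the ring automorphism $x_i\mapsto -x_{1-i}$, $a_i\mapsto-a_{1-i}$; for $v\in S_-$, $\mathfrak{S}_v(x;a)=\omega(\mathfrak{S}_{\omega(v)}(x;a))$, and for $v=v_+v_-$ with $v_\pm\in S_\pm$, $\mathfrak{S}_v(x;a)=\mathfrak{S}_{v_+}(x;a)\mathfrak{S}_{v_-}(x;a)$. With $\gamma$ the shift ($s_i\mapsto s_{i+1}$, $x_i\mapsto x_{i+1}$, $a_i\mapsto a_{i+1}$), the back stable double Schubert polynomial is $\overleftarrow{\mathfrak{S}}_w(x;a)=\lim_{p\to-\infty,q\to\infty}\gamma^{p-1}(\mathfrak{S}_{\gamma^{1-p}(w)}(x;a))$, which lies in $\overleftarrow{R}(x;a)$. Let $\eta_a:\overleftarrow{R}(x;a)\to\Lambda(x\|a)$ be the $\Lambda(x\|a)$-algebra map sending each polynomial generator $x_i\in\mathbb{Q}[x,a]$ to $a_i$ (it leaves $p_k(x\|a)$ unchanged). The double Stanley symmetric function is $F_w(x\|a)=\eta_a(\overleftarrow{\mathfrak{S}}_w(x;a))$. *)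

theory Defs
  imports
    Complex_Main
    "HOL-Library.Poly_Mapping"
    "HOL-Combinatorics.Perm"
begin

unbundle permutation_syntax

section \<open>The group of finitely supported permutations of the integers\<close>

text \<open>
  The type \<^typ>\<open>int perm\<close> of bijections moving only finitely many integers is the
  group \<open>S\<^sub>\<int>\<close>; its multiplication is composition.
\<close>

definition s :: "int \<Rightarrow> int perm"
  where "s i = \<langle>i \<leftrightarrow> (i + 1)\<rangle>"

definition len :: "int perm \<Rightarrow> nat"
  where "len w = (LEAST n. \<exists>is. length is = n \<and> w = prod_list (map s is))"

definition reduced_prod :: "int perm \<Rightarrow> int perm \<Rightarrow> int perm \<Rightarrow> bool"
  where "reduced_prod z u v \<longleftrightarrow> z = u * v \<and> len z = len u + len v"

text \<open>The \<^term>\<open>s i\<close> are involutions, so words in them suffice to describe the subgroup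
  they generate.\<close>

definition generated :: "int set \<Rightarrow> int perm set"
  where "generated I = {prod_list (map s is) | is. set is \<subseteq> I}"

definition S_plus :: "int perm set"
  where "S_plus = generated {1..}"

definition S_minus :: "int perm set"
  where "S_minus = generated {..-1}"

definition S_nonzero :: "int perm set"
  where "S_nonzero = {u * v | u v. u \<in> S_plus \<and> v \<in> S_minus}"

lift_definition shift_perm :: "int \<Rightarrow> int perm \<Rightarrow> int perm"
  is "\<lambda>k w i. w (i - k) + k"
proof
  fix k :: int and w :: "int \<Rightarrow> int"
  assume w: "bij w \<and> finite {i. w i \<noteq> i}"
  have "bij ((\<lambda>i. i + k) \<circ> w \<circ> (\<lambda>i. i - k))"
    by (intro bij_comp conjunct1[OF w] o_bij[where f = "\<lambda>i. i + k" and g = "\<lambda>i. i - k"]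
        o_bij[where f = "\<lambda>i. i - k" and g = "\<lambda>i. i + k"]) auto
  then show "bij (\<lambda>i. w (i - k) + k)"
    by (simp add: comp_def)
  have "{i. w (i - k) + k \<noteq> i} \<subseteq> (\<lambda>i. i + k) ` {i. w i \<noteq> i}"
  proof
    fix i assume "i \<in> {i. w (i - k) + k \<noteq> i}"
    then have "i - k \<in> {i. w i \<noteq> i}" by auto
    then have "(i - k) + k \<in> (\<lambda>i. i + k) ` {i. w i \<noteq> i}" by (rule imageI)
    then show "i \<in> (\<lambda>i. i + k) ` {i. w i \<noteq> i}" by simp
  qed
  then show "finite {i. w (i - k) + k \<noteq> i}"
    using w finite_subset by blast
qed

lift_definition omega_perm :: "int perm \<Rightarrow> int perm"
  is "\<lambda>w i. 1 - w (1 - i)"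
proof
  fix w :: "int \<Rightarrow> int"
  assume w: "bij w \<and> finite {i. w i \<noteq> i}"
  have "bij ((\<lambda>i. 1 - i) \<circ> w \<circ> (\<lambda>i. 1 - i))"
    by (intro bij_comp conjunct1[OF w]) (auto intro!: o_bij[where g = "\<lambda>i. 1 - i"])
  then show "bij (\<lambda>i. 1 - w (1 - i))"
    by (simp add: comp_def)
  have "{i. 1 - w (1 - i) \<noteq> i} \<subseteq> (\<lambda>i. 1 - i) ` {i. w i \<noteq> i}"
  proof
    fix i assume "i \<in> {i. 1 - w (1 - i) \<noteq> i}"
    then have "1 - i \<in> {i. w i \<noteq> i}" by auto
    then have "1 - (1 - i) \<in> (\<lambda>i. 1 - i) ` {i. w i \<noteq> i}" by (rule imageI)
    then show "i \<in> (\<lambda>i. 1 - i) ` {i. w i \<noteq> i}" by simp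
  qed
  then show "finite {i. 1 - w (1 - i) \<noteq> i}"
    using w finite_subset by blast
qed

text \<open>The automorphisms \<open>\<gamma>\<^sup>k\<close> and \<open>\<omega>\<close> are given above by conjugation; the next lemmas
  show that they have the prescribed values on generators.\<close>

lemma shift_perm_s: "shift_perm k (s i) = s (i + k)"
  unfolding s_def by transfer (auto simp: fun_eq_iff transpose_def)

lemma shift_perm_mult: "shift_perm k (u * v) = shift_perm k u * shift_perm k v"
  by transfer (auto simp: fun_eq_iff)

lemma omega_perm_s: "omega_perm (s i) = s (- i)"
  unfolding s_def by transfer (auto simp: fun_eq_iff transpose_def)

lemma omega_perm_mult: "omega_perm (u * v) = omega_perm u * omega_perm v"
  by transfer (auto simp: fun_eq_iff)

lift_definition w0 :: "nat \<Rightarrow> int perm"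
  is "\<lambda>n i. if 1 \<le> i \<and> i \<le> int n then int n + 1 - i else i"
proof
  fix n
  show "bij (\<lambda>i. if 1 \<le> i \<and> i \<le> int n then int n + 1 - i else i)" (is "bij ?f")
    by (rule o_bij[where g = ?f]) (auto simp: fun_eq_iff)
  have "{i. ?f i \<noteq> i} \<subseteq> {1..int n}" by auto
  then show "finite {i. ?f i \<noteq> i}"
    using finite_subset by blast
qed

section \<open>Polynomial rings\<close>

type_synonym 'v mpoly = "('v \<Rightarrow>\<^sub>0 nat) \<Rightarrow>\<^sub>0 rat"

definition Const :: "rat \<Rightarrow> 'v mpoly"
  where "Const c = Poly_Mapping.single 0 c"

definition Var :: "'v \<Rightarrow> 'v mpoly"
  where "Var v = Poly_Mapping.single (Poly_Mapping.single v 1) 1"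

text \<open>The ring homomorphism of polynomial rings over the rationals with the given values on
  the variables.\<close>

definition subst :: "('v \<Rightarrow> 'w mpoly) \<Rightarrow> 'v mpoly \<Rightarrow> 'w mpoly"
  where "subst \<sigma> f = (\<Sum>m\<in>Poly_Mapping.keys f. Const (Poly_Mapping.lookup f m) *
    (\<Prod>v\<in>Poly_Mapping.keys m. \<sigma> v ^ Poly_Mapping.lookup m v))"

datatype xa = X int | A int

text \<open>
  Since \<open>\<Lambda>(x\<parallel>a)\<close> is the polynomial ring over \<open>\<rat>[a]\<close> in the algebraically independent
  \<open>p\<^sub>1, p\<^sub>2, \<dots>\<close>, for every polynomial ring \<open>B\<close> over \<open>\<rat>[a]\<close> the tensor product of \<open>\<Lambda>(x\<parallel>a)\<close>
  with \<open>B\<close> over \<open>\<rat>[a]\<close> is the polynomial ring \<open>B[p\<^sub>1, p\<^sub>2, \<dots>]\<close>. The type \<open>'v lam\<close> adjoins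
  these variables to the variables \<open>'v\<close> of \<open>B\<close>. As the \<open>p\<^sub>k\<close> are indexed by positive integers,
  \<open>P k\<close> stands for \<open>p\<close> with index \<open>k + 1\<close>.
\<close>

datatype 'v lam = P nat | Base 'v

type_synonym poly_xa = "xa mpoly"            \<comment> \<open>\<open>\<rat>[x,a]\<close>\<close>
type_synonym Lam = "int lam mpoly"           \<comment> \<open>\<open>\<Lambda>(x\<parallel>a)\<close>, where \<open>Base i\<close> is \<open>a\<^sub>i\<close>\<close>
type_synonym R = "xa lam mpoly"              \<comment> \<open>\<open>\<Lambda>(x\<parallel>a) \<otimes> \<rat>[x,a]\<close> over \<open>\<rat>[a]\<close>\<close>
type_synonym Lam_R = "xa lam lam mpoly"      \<comment> \<open>\<open>\<Lambda>(x\<parallel>a) \<otimes> R\<close> over \<open>\<rat>[a]\<close>\<close>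

definition Lam_to_R :: "Lam \<Rightarrow> R"
  where "Lam_to_R = subst (\<lambda>v. case v of P k \<Rightarrow> Var (P k) | Base i \<Rightarrow> Var (Base (A i)))"

definition poly_to_R :: "poly_xa \<Rightarrow> R"
  where "poly_to_R = subst (\<lambda>v. Var (Base v))"

text \<open>In \<^typ>\<open>Lam_R\<close>, \<open>P k\<close> is \<open>p \<otimes> 1\<close> and \<open>Base (P k)\<close> is \<open>1 \<otimes> p\<close>.\<close>

definition tensor :: "Lam \<Rightarrow> R \<Rightarrow> Lam_R"
  where "tensor f g =
    subst (\<lambda>v. case v of P k \<Rightarrow> Var (P k) | Base i \<Rightarrow> Var (Base (Base (A i)))) f *
    subst (\<lambda>v. Var (Base v)) g"

definition coaction :: "R \<Rightarrow> Lam_R"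
  where "coaction = subst (\<lambda>v. case v of
    P k \<Rightarrow> Var (P k) + Var (Base (P k)) | Base z \<Rightarrow> Var (Base (Base z)))"

definition eta :: "R \<Rightarrow> Lam"
  where "eta = subst (\<lambda>v. case v of
    P k \<Rightarrow> Var (P k) | Base z \<Rightarrow> (case z of X i \<Rightarrow> Var (Base i) | A i \<Rightarrow> Var (Base i)))"

section \<open>Double Schubert polynomials\<close>

definition swap_x :: "int \<Rightarrow> poly_xa \<Rightarrow> poly_xa"
  where "swap_x i = subst (\<lambda>v. case v of X j \<Rightarrow> Var (X (s i \<langle>$\<rangle> j)) | A j \<Rightarrow> Var (A j))"

definition divdiff :: "int \<Rightarrow> poly_xa \<Rightarrow> poly_xa"
  where "divdiff i f = (THE g. (Var (X i) - Var (X (i + 1))) * g = f - swap_x i f)"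

inductive double_schubert :: "nat \<Rightarrow> int perm \<Rightarrow> poly_xa \<Rightarrow> bool" for n where
  longest: "double_schubert n (w0 n)
    (\<Prod>(i, j)\<in>{(i, j). 1 \<le> i \<and> 1 \<le> j \<and> i + j \<le> int n}. Var (X i) - Var (A j))"
| divided: "double_schubert n (v * s i) f \<Longrightarrow> 1 \<le> i \<Longrightarrow> i < int n \<Longrightarrow> len v < len (v * s i) \<Longrightarrow>
    double_schubert n v (divdiff i f)"

definition schubert_plus :: "int perm \<Rightarrow> poly_xa"
  where "schubert_plus v = (THE f. \<exists>n. double_schubert n v f)"

definition omega_poly :: "poly_xa \<Rightarrow> poly_xa"
  where "omega_poly = subst (\<lambda>v. case v of X i \<Rightarrow> - Var (X (1 - i)) | A i \<Rightarrow> - Var (A (1 - i)))"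

text \<open>For \<open>v \<in> S_nonzero\<close>; the factors of \<open>v\<close> are unique because \<open>S_plus\<close> and \<open>S_minus\<close>
  intersect trivially.\<close>

definition schubert :: "int perm \<Rightarrow> poly_xa"
  where "schubert v = (THE f. \<exists>vp\<in>S_plus. \<exists>vm\<in>S_minus. v = vp * vm \<and>
    f = schubert_plus vp * omega_poly (schubert_plus (omega_perm vm)))"

section \<open>Back stable double Schubert polynomials\<close>

definition shift_poly :: "int \<Rightarrow> poly_xa \<Rightarrow> poly_xa"
  where "shift_poly k = subst (\<lambda>v. case v of X i \<Rightarrow> Var (X (i + k)) | A i \<Rightarrow> Var (A (i + k)))"

text \<open>
  A formal power series is its family of coefficients. A family of polynomials has a limit
  as the index tends to minus infinity if each coefficient is eventually constant.
\<close>

definition has_limit :: "(int \<Rightarrow> 'v mpoly) \<Rightarrow> (('v \<Rightarrow>\<^sub>0 nat) \<Rightarrow> rat) \<Rightarrow> bool"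
  where "has_limit F L \<longleftrightarrow> (\<forall>m. \<forall>\<^sub>F p in at_bot. Poly_Mapping.lookup (F p) m = L m)"

text \<open>
  An element of \<^typ>\<open>R\<close> denotes the formal power series in which \<open>P k\<close> is replaced by the sum of
  \<open>x\<^sub>i^(k+1) - a\<^sub>i^(k+1)\<close> over all \<open>i \<le> 0\<close>. That series is the limit of the polynomials obtained
  by restricting these sums to \<open>p \<le> i \<le> 0\<close>.
\<close>

definition truncate :: "int \<Rightarrow> R \<Rightarrow> poly_xa"
  where "truncate p = subst (\<lambda>v. case v of
    P k \<Rightarrow> (\<Sum>i\<in>{p..0}. Var (X i) ^ (k + 1) - Var (A i) ^ (k + 1)) | Base z \<Rightarrow> Var z)"

definition denotes :: "R \<Rightarrow> ((xa \<Rightarrow>\<^sub>0 nat) \<Rightarrow> rat) \<Rightarrow> bool"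
  where "denotes f L \<longleftrightarrow> has_limit (\<lambda>p. truncate p f) L"

text \<open>
  If \<open>w\<close> moves only elements of the interval from \<open>p\<close> to \<open>q\<close>, then \<open>\<gamma>\<^sup>1\<^sup>-\<^sup>p(w)\<close> lies in \<open>S_plus\<close>.
  By stability of double Schubert polynomials the upper end \<open>q\<close> plays no role.
\<close>

definition back_stable :: "int perm \<Rightarrow> R"
  where "back_stable w = (THE f. \<exists>L. denotes f L \<and>
    has_limit (\<lambda>p. shift_poly (p - 1) (schubert_plus (shift_perm (1 - p) w))) L)"

definition double_stanley :: "int perm \<Rightarrow> Lam"
  where "double_stanley w = eta (back_stable w)"

end

theory Submission
  imports Defs "HOL-Computational_Algebra.Polynomial"
begin

text \<open>
  Both identities follow from a uniqueness principle: a family \<open>f\<^sub>w\<close> with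
  \<open>f\<^sub>w - s\<^sub>i f\<^sub>w = (x\<^sub>i - x\<^sub>i\<^sub>+\<^sub>1) f\<close>, where the last factor belongs to \<open>w s\<^sub>i\<close> if
  \<open>w s\<^sub>i < w\<close> and is \<open>0\<close> otherwise, is determined by its values at \<open>x = a\<close>, because a
  polynomial fixed by the \<open>s\<^sub>i\<close> with \<open>i \<noteq> 0\<close> does not involve any \<open>x\<^sub>j\<close>, and one fixed by
  \<open>s\<^sub>0\<close> as well does not involve the power sums. Such families multiply along length-additive
  factorizations, so they are treated as elements of the completed nilCoxeter ring, whose
  associativity replaces all manipulations of factorizations.

  The double Schubert polynomials are the coefficients of \<open>\<Phi>(a)\<^sup>-\<^sup>1 \<Phi>(x)\<close> for the product \<open>\<Phi>\<close> of
  Fomin and Kirillov. If the lower end of the variables decreases, this expression only changes in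
  its middle factor, a product of commuting elements \<open>h(a\<^sub>i)\<^sup>-\<^sup>1 h(x\<^sub>i)\<close>, which is an exponential in
  the differences of power sums. This exhibits the back stable limit as a polynomial in the
  \<open>p\<^sub>k(x\<parallel>a)\<close>.
\<close>

section \<open>Length and factorizations\<close>

text \<open>\<open>back_stable w\<close> is a definite description: the element of \<open>R\<close>
  whose power series is the prescribed limit. Existence needs one formula that serves all small
  lower ends p at once; uniqueness is the algebraic independence of the p_k. From then on power
  series disappear: an identity in \<open>R\<close> is checked after \<open>truncate p\<close> for
  all small p. The two expansions differ in the swaps at hand. The coaction is compatible with every
  swap, so the value at x = a with the power sums of the second tensor factor set to 0 decides. For
  \<open>S_nonzero\<close> the recursion is available for i \<noteq> 0 only; these swaps do not
  touch the power sums, and comparison under \<open>eta\<close> accounts for them. Polynomial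
  identities are tested at rational points, where cancelling x_i - x_(i+1) and passing to limits
  become statements about roots of one-variable polynomials.\<close>

lemma apply_s: "s i \<langle>$\<rangle> j = (if j = i then i + 1 else if j = i + 1 then i else j)"
  by (auto simp: s_def)

lemma s_mult_s [simp]: "s i * s i = 1"
  by (simp add: s_def)

lemma mult_s_s [simp]: "w * s i * s i = w"
  by (simp add: mult.assoc)

lemma apply_mult: "(u * v) \<langle>$\<rangle> i = u \<langle>$\<rangle> (v \<langle>$\<rangle> i)"
  by (simp add: apply_times)

lemma apply_bounded_outside:
  assumes "affected w \<subseteq> {a..b}" "i \<notin> {a..b}"
  shows "w \<langle>$\<rangle> i = i"
  using assms in_affected[of i w] by blast

lemma obtain_bounds:
  obtains N :: int where "0 \<le> N" "affected w \<subseteq> {- N..N}"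
proof
  let ?N = "Max (insert 0 (abs ` affected w))"
  have fin: "finite (insert 0 (abs ` affected w))" by simp
  show "0 \<le> ?N" by (rule Max_ge[OF fin]) simp
  show "affected w \<subseteq> {- ?N..?N}"
  proof
    fix i assume "i \<in> affected w"
    then have "\<bar>i\<bar> \<le> ?N" by (intro Max_ge) auto
    then show "i \<in> {- ?N..?N}" unfolding atLeastAtMost_iff by linarith
  qed
qed

section \<open>Inversions and the length function\<close>

definition inversions :: "int perm \<Rightarrow> (int \<times> int) set"
  where "inversions w = {(i, j). i < j \<and> w \<langle>$\<rangle> j < w \<langle>$\<rangle> i}"

lemma inversions_subset:
  assumes "affected w \<subseteq> {a..b}"
  shows "inversions w \<subseteq> {(i, j). a \<le> i \<and> i < j \<and> j \<le> b}"
proof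
  fix z assume "z \<in> inversions w"
  then obtain i j where z: "z = (i, j)" and ij: "i < j" "w \<langle>$\<rangle> j < w \<langle>$\<rangle> i"
    by (auto simp: inversions_def)
  have out: "a \<le> w \<langle>$\<rangle> k \<and> w \<langle>$\<rangle> k \<le> b" if "a \<le> k" "k \<le> b" for k
  proof (cases "k \<in> affected w")
    case True
    then have "w \<langle>$\<rangle> k \<in> affected w" by simp
    then have "w \<langle>$\<rangle> k \<in> {a..b}" using assms by (rule subsetD[rotated])
    then show ?thesis by simp
  next
    case False
    then show ?thesis using that by (simp add: in_affected)
  qed
  have same: "w \<langle>$\<rangle> k = k" if "\<not> (a \<le> k \<and> k \<le> b)" for k
    using that by (intro apply_bounded_outside[OF assms]) simp
  have "a \<le> i \<and> j \<le> b"
    using ij out[of i] out[of j] same[of i] same[of j] by linarith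
  then show "z \<in> {(i, j). a \<le> i \<and> i < j \<and> j \<le> b}" using z ij by simp
qed

lemma finite_inversions: "finite (inversions w)"
proof -
  obtain N where "affected w \<subseteq> {- N..N}" by (rule obtain_bounds)
  from inversions_subset[OF this] have "inversions w \<subseteq> {- N..N} \<times> {- N..N}"
    by (rule order_trans) auto
  then show ?thesis by (rule finite_subset) simp
qed

text \<open>Right multiplication by s_i moves the positions of the old inversions by s_i and creates
  the pair (i, i+1). That pair is new, since it would have to come from (i+1, i).\<close>

lemma card_inversions_mult_s:
  assumes "w \<langle>$\<rangle> i < w \<langle>$\<rangle> (i + 1)"
  shows "card (inversions (w * s i)) = Suc (card (inversions w))"
proof -
  let ?f = "\<lambda>(a, b). (s i \<langle>$\<rangle> a, s i \<langle>$\<rangle> b)"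
  have inj: "inj ?f" 
    by (rule inj_on_inverseI[where g = ?f]) (simp add: apply_s split: prod.split)
  have "inversions (w * s i) = insert (i, i + 1) (?f ` inversions w)"
  proof (rule set_eqI, clarify)
    fix a b
    have ss: "s i \<langle>$\<rangle> (s i \<langle>$\<rangle> c) = c" for c
      by (simp add: apply_s)
    have "(a, b) \<in> ?f ` inversions w \<longleftrightarrow> (s i \<langle>$\<rangle> a, s i \<langle>$\<rangle> b) \<in> inversions w"
      by (force simp: ss)
    then show "(a, b) \<in> inversions (w * s i) \<longleftrightarrow> (a, b) \<in> insert (i, i + 1) (?f ` inversions w)"
      using assms by (auto simp: inversions_def apply_mult apply_s)
  qed
  moreover have "(i, i + 1) \<notin> ?f ` inversions w"
    by (auto simp: inversions_def apply_s split: if_splits)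
  moreover have "card (?f ` inversions w) = card (inversions w)"
    by (rule card_image[OF inj_on_subset[OF inj subset_UNIV]])
  ultimately show ?thesis
    using finite_inversions by simp
qed

lemma card_inversions_mult_s':
  assumes "w \<langle>$\<rangle> (i + 1) < w \<langle>$\<rangle> i"
  shows "card (inversions w) = Suc (card (inversions (w * s i)))"
  using card_inversions_mult_s[of "w * s i" i] assms by (simp add: apply_mult apply_s)

text \<open>Such a w is strictly increasing. Comparison with a fixed point far to the left gives
  w(i) \<ge> i, and with one far to the right w(i) \<le> i.\<close>

lemma perm_eq_1_if_no_descent:
  assumes "\<And>i. \<not> w \<langle>$\<rangle> (i + 1) < w \<langle>$\<rangle> (i :: int)"
  shows "w = 1"
proof (rule perm_eqI)
  fix i
  obtain N where N: "0 \<le> N" "affected w \<subseteq> {- N..N}" by (rule obtain_bounds)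
  have less: "w \<langle>$\<rangle> j < w \<langle>$\<rangle> (j + 1)" for j
    using assms[of j] apply_inj[of w j "j + 1"] by linarith
  have up: "w \<langle>$\<rangle> (j + int n) \<ge> w \<langle>$\<rangle> j + int n" for j n
  proof (induction n)
    case (Suc n)
    then show ?case using less[of "j + int n"] by (simp add: algebra_simps)
  qed simp
  define j where "j = min i (- N - 1)"
  have "w \<langle>$\<rangle> j = j"
    using N by (intro apply_bounded_outside) (auto simp: j_def)
  then have 1: "w \<langle>$\<rangle> i \<ge> i" using up[of j "nat (i - j)"] by (simp add: j_def)
  define k where "k = max i (N + 1)"
  have "w \<langle>$\<rangle> k = k"
    using N by (intro apply_bounded_outside) (auto simp: k_def)
  then have 2: "w \<langle>$\<rangle> i \<le> i" using up[of i "nat (k - i)"] by (simp add: k_def)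
  from 1 2 show "w \<langle>$\<rangle> i = 1 \<langle>$\<rangle> i" by simp
qed

lemma obtain_descent:
  fixes w :: "int perm"
  assumes "w \<noteq> 1"
  obtains i where "w \<langle>$\<rangle> (i + 1) < w \<langle>$\<rangle> i"
  using perm_eq_1_if_no_descent assms by blast

lemma inversions_1: "inversions 1 = {}"
  by (auto simp: inversions_def)

lemma word_snoc: "w * s i = prod_list (map s js) \<Longrightarrow> w = prod_list (map s (js @ [i]))"
  using mult_s_s[of w i] by simp

lemma reduced_word_exists: "\<exists>is. length is = card (inversions w) \<and> w = prod_list (map s is)"
proof (induction "card (inversions w)" arbitrary: w)
  case 0
  have "w = 1"
  proof (rule ccontr)
    assume "w \<noteq> 1"
    then obtain i where "w \<langle>$\<rangle> (i + 1) < w \<langle>$\<rangle> i" by (rule obtain_descent)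
    then show False using card_inversions_mult_s' 0 by simp
  qed
  then show ?case using 0 by (intro exI[of _ "[]"]) simp
next
  case (Suc n)
  have "w \<noteq> 1" using Suc.hyps(2) inversions_1 by force
  then obtain i where i: "w \<langle>$\<rangle> (i + 1) < w \<langle>$\<rangle> i" by (rule obtain_descent)
  then have "card (inversions (w * s i)) = n"
    using card_inversions_mult_s' Suc.hyps(2) by simp
  then obtain js where "length js = n" "w * s i = prod_list (map s js)"
    using Suc.hyps(1)[of "w * s i"] by blast
  from word_snoc[OF this(2)] show ?case using \<open>length js = n\<close> Suc.hyps(2) by (intro exI[of _ "js @ [i]"]) simp
qed

lemma card_inversions_mult_s_le: "card (inversions (w * s i)) \<le> Suc (card (inversions w))"
proof (cases "w \<langle>$\<rangle> i < w \<langle>$\<rangle> (i + 1)")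
  case False
  then have "w \<langle>$\<rangle> (i + 1) < w \<langle>$\<rangle> i"
    using apply_inj[of w i "i + 1"] by linarith
  then show ?thesis using card_inversions_mult_s' by simp
qed (simp add: card_inversions_mult_s)

lemma card_inversions_word: "card (inversions (prod_list (map s is))) \<le> length is"
proof (induction "is" rule: rev_induct)
  case (snoc i js)
  then show ?case
    using card_inversions_mult_s_le[of "prod_list (map s js)" i] by simp
qed (simp add: inversions_1)

text \<open>Sorting along descents gives a word of this length, and each letter of any word adds at
  most one inversion.\<close>

lemma len_eq_card_inversions: "len w = card (inversions w)"
  unfolding len_def
proof (rule Least_equality)
  show "\<exists>is. length is = card (inversions w) \<and> w = prod_list (map s is)"
    by (rule reduced_word_exists)
qed (use card_inversions_word in blast)

lemma len_mult_le: "len (u * v) \<le> len u + len v"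
proof -
  obtain ks js where "length ks = len u" "u = prod_list (map s ks)"
    "length js = len v" "v = prod_list (map s js)"
    using reduced_word_exists len_eq_card_inversions by metis
  then show ?thesis
    using card_inversions_word[of "ks @ js"] by (simp add: len_eq_card_inversions)
qed

lemma len_1 [simp]: "len 1 = 0"
  by (simp add: len_eq_card_inversions inversions_1)

lemma not_descent_iff: "\<not> w \<langle>$\<rangle> (i + 1) < w \<langle>$\<rangle> i \<longleftrightarrow> w \<langle>$\<rangle> i < w \<langle>$\<rangle> (i + 1 :: int)"
  using apply_inj[of w i "i + 1"] by linarith

lemma len_ascent: "w \<langle>$\<rangle> i < w \<langle>$\<rangle> (i + 1) \<Longrightarrow> len (w * s i) = Suc (len w)"
  by (simp add: len_eq_card_inversions card_inversions_mult_s)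

lemma len_descent: "w \<langle>$\<rangle> (i + 1) < w \<langle>$\<rangle> i \<Longrightarrow> len w = Suc (len (w * s i))"
  by (simp add: len_eq_card_inversions card_inversions_mult_s')

lemma descent_iff_len: "w \<langle>$\<rangle> (i + 1) < w \<langle>$\<rangle> i \<longleftrightarrow> len (w * s i) < len w"
  using len_ascent[of w i] len_descent[of w i] not_descent_iff[of w i] by linarith

lemma len_eq_0_iff [simp]: "len w = 0 \<longleftrightarrow> w = 1"
  using obtain_descent len_descent by (metis len_1 nat.distinct(1))

lemma len_s [simp]: "len (s i) = 1"
  using len_ascent[of 1 i] by simp

lemma len_mult_s_less: "len (w * s i) < len w \<Longrightarrow> len w = Suc (len (w * s i))"
  using descent_iff_len len_descent by blast

lemma len_mult_s_not_less: "\<not> len (w * s i) < len w \<Longrightarrow> len (w * s i) = Suc (len w)"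
  using descent_iff_len len_ascent not_descent_iff by blast

section \<open>The subgroup generated by s_m, ..., s_M, whose last generator moves M + 1\<close>

definition supported :: "int \<Rightarrow> int \<Rightarrow> int perm \<Rightarrow> bool"
  where "supported m M w \<longleftrightarrow> affected w \<subseteq> {m..M + 1}"

lemma supportedD: "supported m M w \<Longrightarrow> i < m \<or> M + 1 < i \<Longrightarrow> w \<langle>$\<rangle> i = i"
  unfolding supported_def by (intro apply_bounded_outside) auto

lemma supported_1 [simp]: "supported m M 1"
  by (simp add: supported_def)

lemma supported_mult: "supported m M u \<Longrightarrow> supported m M v \<Longrightarrow> supported m M (u * v)"
  unfolding supported_def using affected_times[of u v] by (meson Un_least order_trans)

lemma supported_s_iff [simp]: "supported m M (s i) \<longleftrightarrow> m \<le> i \<and> i \<le> M"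
  by (auto simp: supported_def s_def affected_swap)

lemma supported_mono: "supported m M w \<Longrightarrow> m' \<le> m \<Longrightarrow> M \<le> M' \<Longrightarrow> supported m' M' w"
  unfolding supported_def by (elim order_trans) auto

lemma supported_word: "set is \<subseteq> {m..M} \<Longrightarrow> supported m M (prod_list (map s is))"
  by (induction "is") (auto intro!: supported_mult)

lemma supported_exists: "\<exists>m\<le>q. \<exists>M\<ge>r. supported m M w"
proof -
  obtain N where "0 \<le> N" "affected w \<subseteq> {- N..N}" by (rule obtain_bounds)
  then have "supported (min q (- N)) (max r N) w"
    unfolding supported_def by (elim order_trans) auto
  then show ?thesis using min.cobounded1 max.cobounded1 by blast
qed

lemma supported_descent:
  assumes "supported m M w" "w \<langle>$\<rangle> (i + 1) < w \<langle>$\<rangle> i"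
  shows "m \<le> i" "i \<le> M"
proof -
  have "(i, i + 1) \<in> inversions w" using assms by (simp add: inversions_def)
  then have "m \<le> i \<and> i + 1 \<le> M + 1"
    using inversions_subset[of w m "M + 1"] assms(1) unfolding supported_def by blast
  then show "m \<le> i" "i \<le> M" by auto
qed

section \<open>Length-additive factorizations\<close>

definition factorizations :: "int perm \<Rightarrow> (int perm \<times> int perm) set"
  where "factorizations w = {(u, v). reduced_prod w u v}"

lemma mem_factorizations: "(u, v) \<in> factorizations w \<longleftrightarrow> w = u * v \<and> len w = len u + len v"
  by (simp add: factorizations_def reduced_prod_def)

text \<open>A descent of the right factor is a descent of the product: otherwise subadditivity for w
  s_i = u (v s_i) would contradict the additivity of the lengths.\<close>

lemma reduced_prod_last:
  assumes "(u, v) \<in> factorizations w" "len (v * s i) < len v"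
  shows "len (w * s i) < len w" "(u, v * s i) \<in> factorizations (w * s i)"
proof -
  have 1: "w * s i = u * (v * s i)" "len w = len u + len v" 
    using assms by (auto simp: mem_factorizations mult.assoc)
  have "len (w * s i) \<le> len u + len (v * s i)" using 1 len_mult_le by metis
  moreover have "len v = Suc (len (v * s i))" using assms(2) by (rule len_mult_s_less)
  moreover have "len w \<le> Suc (len (w * s i))" using len_mult_s_less[of w i] by linarith
  ultimately show "len (w * s i) < len w" "(u, v * s i) \<in> factorizations (w * s i)"
    using 1 by (auto simp: mem_factorizations)
qed

lemma factorizations_cases:
  assumes "(u, v) \<in> factorizations w"
  obtains "v = 1" "u = w"
  | i where "w \<langle>$\<rangle> (i + 1) < w \<langle>$\<rangle> i" "len (v * s i) < len v" "(u, v * s i) \<in> factorizations (w * s i)"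
proof (cases "v = 1")
  case True
  then show ?thesis using that(1) assms by (simp add: mem_factorizations)
next
  case False
  then obtain i where "v \<langle>$\<rangle> (i + 1) < v \<langle>$\<rangle> i" by (rule obtain_descent)
  then have "len (v * s i) < len v" by (simp add: descent_iff_len)
  then show ?thesis using that(2)[of i] reduced_prod_last[OF assms, of i] descent_iff_len[of w i] by simp
qed

text \<open>The letters of v are stripped one at a time; each is a descent of a product lying in the
  subgroup, so its index is between m and M. This equivalence makes \<open>restrict_supp\<close>
  multiplicative.\<close>

lemma supported_factorization:
  assumes "(u, v) \<in> factorizations w"
  shows "supported m M w \<longleftrightarrow> supported m M u \<and> supported m M v"
proof
  show "supported m M u \<and> supported m M v \<Longrightarrow> supported m M w"
    using assms supported_mult[of m M u v] by (simp add: mem_factorizations)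
  show "supported m M w \<Longrightarrow> supported m M u \<and> supported m M v"
    using assms
  proof (induction "len v" arbitrary: v w)
    case 0
    then show ?case by (auto simp: mem_factorizations)
  next
    case (Suc n)
    from Suc.prems(2) show ?case
    proof (cases rule: factorizations_cases)
      case 1
      then show ?thesis using Suc.hyps(2) by simp
    next
      case (2 i)
      have i: "supported m M (s i)" using supported_descent[OF Suc.prems(1) 2(1)] by simp
      have "supported m M u \<and> supported m M (v * s i)"
        using Suc.hyps(1)[OF _ supported_mult[OF Suc.prems(1) i] 2(3)] Suc.hyps(2)
          len_mult_s_less[OF 2(2)] by simp
      then show ?thesis using supported_mult[OF _ i, of "v * s i"] by simp
    qed
  qed
qed

text \<open>This finiteness allows arbitrary infinite families to be multiplied. Apart from (w, 1),
  a factorization of w arises from one of w s_i by appending s_i, for one of the finitely many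
  descents i of w.\<close>

lemma finite_factorizations [simp]: "finite (factorizations w)"
proof (induction "len w" arbitrary: w rule: less_induct)
  case less
  obtain m M where mM: "supported m M w" using supported_exists by blast
  let ?D = "{i \<in> {m..M}. w \<langle>$\<rangle> (i + 1) < w \<langle>$\<rangle> i}"
  have *: "factorizations w \<subseteq> insert (w, 1) (\<Union>i\<in>?D. (\<lambda>(u, v). (u, v * s i)) ` factorizations (w * s i))"
  proof (clarify)
    fix u v assume uv: "(u, v) \<in> factorizations w"
      "(u, v) \<notin> (\<Union>i\<in>?D. (\<lambda>(u, v). (u, v * s i)) ` factorizations (w * s i))"
    from uv(1) show "u = w \<and> v = 1"
    proof (cases rule: factorizations_cases)
      case (2 i)
      then have "i \<in> ?D" using supported_descent[OF mM] by auto
      moreover have "(u, v) \<in> (\<lambda>(u, v). (u, v * s i)) ` factorizations (w * s i)"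
        using 2(3) by (intro image_eqI[of _ _ "(u, v * s i)"]) auto
      ultimately show ?thesis using uv(2) by blast
    qed simp
  qed
  have "finite (factorizations (w * s i))" if "i \<in> ?D" for i
    using that less(1)[of "w * s i"] len_descent[of w i] by simp
  moreover have "finite ?D" by (rule finite_subset[of _ "{m..M}"]) auto
  ultimately have "finite (insert (w, 1) (\<Union>i\<in>?D. (\<lambda>(u, v). (u, v * s i)) ` factorizations (w * s i)))"
    by (intro finite.insertI finite_UN_I finite_imageI)
  with * show ?case by (rule finite_subset)
qed

lemma supported_word_exists:
  assumes "supported m M w"
  obtains "is" where "set is \<subseteq> {m..M}" "w = prod_list (map s is)"
  using assms
proof (induction "len w" arbitrary: w thesis rule: less_induct)
  case less
  show ?case
  proof (cases "w = 1")
    case True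
    then show ?thesis using less.prems(1)[of "[]"] by simp
  next
    case False
    then obtain i where i: "w \<langle>$\<rangle> (i + 1) < w \<langle>$\<rangle> i" by (rule obtain_descent)
    have iM: "m \<le> i" "i \<le> M" using supported_descent[OF less.prems(2) i] by auto
    have "len (w * s i) < len w" using i by (simp add: descent_iff_len)
    moreover have "supported m M (w * s i)" using less.prems(2) iM by (intro supported_mult) auto
    ultimately obtain js where "set js \<subseteq> {m..M}" "w * s i = prod_list (map s js)"
      using less.hyps by blast
    then show ?thesis using less.prems(1)[OF _ word_snoc] iM by simp
  qed
qed

section \<open>The subgroups S_plus and S_minus, the automorphisms omega and shift, the longest
  element\<close>

lemma S_plus_iff: "w \<in> S_plus \<longleftrightarrow> (\<exists>M\<ge>0. supported 1 M w)"
proof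
  assume "w \<in> S_plus"
  then obtain js where js: "set js \<subseteq> {1..}" "w = prod_list (map s js)"
    by (auto simp: S_plus_def generated_def)
  let ?M = "Max (insert 0 (set js))"
  have "set js \<subseteq> {1..?M}" using js(1) by (auto intro: Max_ge)
  then have "supported 1 ?M w" using js(2) supported_word by blast
  moreover have "?M \<ge> 0" by (intro Max_ge) auto
  ultimately show "\<exists>M\<ge>0. supported 1 M w" by blast
next
  assume "\<exists>M\<ge>0. supported 1 M w"
  then obtain M js where "set js \<subseteq> {1..M}" "w = prod_list (map s js)"
    by (metis supported_word_exists)
  then show "w \<in> S_plus" by (fastforce simp: S_plus_def generated_def)
qed

lemma omega_omega [simp]: "omega_perm (omega_perm w) = w"
  by (rule perm_eqI) (simp add: omega_perm.rep_eq)

lemma omega_perm_1 [simp]: "omega_perm 1 = 1"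
  by (rule perm_eqI) (simp add: omega_perm.rep_eq)

lemma omega_perm_word: "omega_perm (prod_list (map s is)) = prod_list (map s (map uminus is))"
  by (induction "is") (simp_all add: omega_perm_mult omega_perm_s)

lemma omega_perm_apply: "omega_perm w \<langle>$\<rangle> i = 1 - w \<langle>$\<rangle> (1 - i)"
  by (simp add: omega_perm.rep_eq)

lemma S_minus_iff: "w \<in> S_minus \<longleftrightarrow> omega_perm w \<in> S_plus"
proof
  assume "w \<in> S_minus"
  then obtain js where "set js \<subseteq> {..-1}" "w = prod_list (map s js)"
    by (auto simp: S_minus_def generated_def)
  then show "omega_perm w \<in> S_plus"
    unfolding S_plus_def generated_def
    by (auto simp: omega_perm_word subset_iff intro!: exI[of _ "map uminus js"])
next
  assume "omega_perm w \<in> S_plus"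
  then obtain js where "set js \<subseteq> {1..}" "omega_perm w = prod_list (map s js)"
    by (auto simp: S_plus_def generated_def)
  then have "set (map uminus js) \<subseteq> {..-1}" "w = prod_list (map s (map uminus js))"
    using omega_perm_word[of js] omega_omega[of w] by auto
  then show "w \<in> S_minus" unfolding S_minus_def generated_def by blast
qed

lemma len_omega: "len (omega_perm w) = len w"
proof -
  have *: "len (omega_perm w) \<le> len w" for w
  proof -
    obtain js where "length js = len w" "w = prod_list (map s js)"
      using reduced_word_exists len_eq_card_inversions by metis
    then show ?thesis using card_inversions_word[of "map uminus js"]
      by (simp add: omega_perm_word len_eq_card_inversions)
  qed
  show ?thesis using *[of w] *[of "omega_perm w"] by simp
qed

lemma shift_perm_apply: "shift_perm k w \<langle>$\<rangle> i = w \<langle>$\<rangle> (i - k) + k"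
  by (simp add: shift_perm.rep_eq)

lemma shift_perm_shift: "shift_perm k (shift_perm l w) = shift_perm (k + l) w"
  by (rule perm_eqI) (simp add: shift_perm_apply algebra_simps)

lemma shift_perm_0 [simp]: "shift_perm 0 w = w"
  by (rule perm_eqI) (simp add: shift_perm_apply)

lemma shift_perm_1 [simp]: "shift_perm k 1 = 1"
  by (rule perm_eqI) (simp add: shift_perm_apply)

lemma shift_perm_word: "shift_perm k (prod_list (map s is)) = prod_list (map s (map (\<lambda>i. i + k) is))"
  by (induction "is") (simp_all add: shift_perm_mult shift_perm_s)

lemma len_shift: "len (shift_perm k w) = len w"
proof -
  have *: "len (shift_perm k w) \<le> len w" for k w
  proof -
    obtain js where "length js = len w" "w = prod_list (map s js)"
      using reduced_word_exists len_eq_card_inversions by metis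
    then show ?thesis using card_inversions_word[of "map (\<lambda>i. i + k) js"]
      by (simp add: shift_perm_word len_eq_card_inversions)
  qed
  show ?thesis using *[of k w] *[of "- k" "shift_perm k w"] by (simp add: shift_perm_shift)
qed

lemma supported_shift: "supported (m + k) (M + k) (shift_perm k w) \<longleftrightarrow> supported m M w"
proof
  assume *: "supported m M w"
  show "supported (m + k) (M + k) (shift_perm k w)"
    unfolding supported_def
  proof
    fix i assume "i \<in> affected (shift_perm k w)"
    then have "i - k \<in> affected w" by (simp add: in_affected shift_perm_apply)
    then have "i - k \<in> {m..M + 1}" using * unfolding supported_def by (rule subsetD[rotated])
    then show "i \<in> {m + k..M + k + 1}" by simp
  qed
next
  assume *: "supported (m + k) (M + k) (shift_perm k w)"
  show "supported m M w"
    unfolding supported_def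
  proof
    fix i assume "i \<in> affected w"
    then have "i + k \<in> affected (shift_perm k w)" by (simp add: in_affected shift_perm_apply)
    then show "i \<in> {m..M + 1}" using * unfolding supported_def by force
  qed
qed

text \<open>The values at 1, ..., n decrease strictly within 1..n, and counting from both ends
  leaves only n + 1 - i at i. Hence every other element has an ascent, by which
  \<open>double_schubert_exists\<close> climbs to w0.\<close>

lemma descents_w0:
  assumes "supported 1 (int n - 1) w" "\<And>i. 1 \<le> i \<Longrightarrow> i < int n \<Longrightarrow> w \<langle>$\<rangle> (i + 1) < w \<langle>$\<rangle> i"
  shows "w = w0 n"
proof (rule perm_eqI)
  fix i
  have out: "w \<langle>$\<rangle> i = i" if "i < 1 \<or> int n < i" for i
    using supportedD[OF assms(1)] that by simp
  have rng: "1 \<le> w \<langle>$\<rangle> i \<and> w \<langle>$\<rangle> i \<le> int n" if "1 \<le> i \<and> i \<le> int n" for i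
    using that out[of "w \<langle>$\<rangle> i"] apply_inj[of w "w \<langle>$\<rangle> i" i] by linarith
  have down: "w \<langle>$\<rangle> (j + int k) + int k \<le> w \<langle>$\<rangle> j" if "1 \<le> j" "j + int k \<le> int n" for j k
    using that(2)
  proof (induction k)
    case (Suc k)
    then show ?case using assms(2)[of "j + int k"] that(1) by (simp add: algebra_simps)
  qed simp
  show "w \<langle>$\<rangle> i = w0 n \<langle>$\<rangle> i"
  proof (cases "1 \<le> i \<and> i \<le> int n")
    case True
    have "w \<langle>$\<rangle> i + (i - 1) \<le> w \<langle>$\<rangle> 1" using down[of 1 "nat (i - 1)"] True by simp
    moreover have "w \<langle>$\<rangle> (int n) + (int n - i) \<le> w \<langle>$\<rangle> i" using down[of i "nat (int n - i)"] True by simp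
    ultimately have "w \<langle>$\<rangle> i = int n + 1 - i"
      using rng[of 1] rng[of "int n"] True by linarith
    then show ?thesis using True by (simp add: w0.rep_eq)
  next
    case False
    then show ?thesis using out by (auto simp: w0.rep_eq)
  qed
qed

lemma supported_w0: "supported 1 (int n - 1) (w0 n)"
  by (auto simp: supported_def in_affected w0.rep_eq split: if_splits)

lemma inversions_w0: "inversions (w0 n) = {(i, j). 1 \<le> i \<and> i < j \<and> j \<le> int n}"
  by (auto simp: inversions_def w0.rep_eq split: if_splits)

text \<open>The inversions of w0 are all pairs i < j up to n; replacing j by j - i gives the index
  set of the product in \<open>longest\<close>.\<close>

lemma len_w0: "len (w0 n) = card {(i, j). 1 \<le> i \<and> 1 \<le> j \<and> i + j \<le> int n}"
  unfolding len_eq_card_inversions inversions_w0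
  by (rule bij_betw_same_card[of "\<lambda>(i, j). (i, j - i)"],
      rule bij_betw_byWitness[where f' = "\<lambda>(i, j). (i, i + j)"]) auto

lemma len_le_w0: "supported 1 (int n - 1) w \<Longrightarrow> len w \<le> len (w0 n)"
  unfolding len_eq_card_inversions
  by (intro card_mono finite_inversions) (use inversions_subset[of w 1 "int n"] in
      \<open>auto simp: supported_def inversions_w0\<close>)

section \<open>The nilCoxeter ring\<close>

definition rhom :: "('a::ring_1 \<Rightarrow> 'b::ring_1) \<Rightarrow> bool"
  where "rhom f \<longleftrightarrow> f 1 = 1 \<and> (\<forall>x y. f (x + y) = f x + f y) \<and> (\<forall>x y. f (x * y) = f x * f y)"

lemma rhomI:
  assumes "f 1 = 1" "\<And>x y. f (x + y) = f x + f y" "\<And>x y. f (x * y) = f x * f y"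
  shows "rhom f"
  using assms by (simp add: rhom_def)

context
  fixes f :: "'a::ring_1 \<Rightarrow> 'b::ring_1"
  assumes f: "rhom f"
begin

lemma rhom_1: "f 1 = 1"
  using f by (simp add: rhom_def)

lemma rhom_add: "f (x + y) = f x + f y"
  using f by (simp add: rhom_def)

lemma rhom_mult: "f (x * y) = f x * f y"
  using f by (simp add: rhom_def)

lemma rhom_0: "f 0 = 0"
  using rhom_add[of 0 0] by simp

lemma rhom_uminus: "f (- x) = - f x"
  using rhom_add[of x "- x"] by (simp add: rhom_0 eq_neg_iff_add_eq_0 add.commute)

lemma rhom_diff: "f (x - y) = f x - f y"
  using rhom_add[of x "- y"] by (simp add: rhom_uminus)

lemma rhom_sum: "f (\<Sum>i\<in>J. g i) = (\<Sum>i\<in>J. f (g i))"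
  by (induction J rule: infinite_finite_induct) (simp_all add: rhom_0 rhom_add)

lemma rhom_power: "f (x ^ n) = f x ^ n"
  by (induction n) (simp_all add: rhom_1 rhom_mult)

lemma rhom_of_nat: "f (of_nat n) = of_nat n"
  by (induction n) (simp_all add: rhom_0 rhom_1 rhom_add)

lemma rhom_prod_list: "f (prod_list xs) = prod_list (map f xs)"
  by (induction xs) (simp_all add: rhom_1 rhom_mult)

end

lemma rhom_prod:
  fixes f :: "'a::comm_ring_1 \<Rightarrow> 'b::comm_ring_1"
  assumes "rhom f"
  shows "f (\<Prod>i\<in>J. g i) = (\<Prod>i\<in>J. f (g i))"
  by (induction J rule: infinite_finite_induct) (simp_all add: rhom_1[OF assms] rhom_mult[OF assms])

lemma rhom_comp: "rhom f \<Longrightarrow> rhom g \<Longrightarrow> rhom (\<lambda>x. f (g x))"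
  by (simp add: rhom_def)

text \<open>This lemma and the next rebracket a length-additive triple, with subadditivity fixing
  the length of the inner product. They yield associativity of the nilCoxeter ring.\<close>

lemma factorizations_assoc1:
  assumes "(t, c) \<in> factorizations w" "(a, b) \<in> factorizations t"
  shows "(a, b * c) \<in> factorizations w" "(b, c) \<in> factorizations (b * c)"
  using assms len_mult_le[of a "b * c"] len_mult_le[of b c]
  by (auto simp: mem_factorizations mult.assoc)

lemma factorizations_assoc2:
  assumes "(a, t) \<in> factorizations w" "(b, c) \<in> factorizations t"
  shows "(a * b, c) \<in> factorizations w" "(a, b) \<in> factorizations (a * b)"
  using assms len_mult_le[of "a * b" c] len_mult_le[of a b]
  by (auto simp: mem_factorizations mult.assoc)

lemma one_left_factorization [simp]: "(1, v) \<in> factorizations w \<longleftrightarrow> v = w"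
  by (auto simp: mem_factorizations)

lemma one_right_factorization [simp]: "(u, 1) \<in> factorizations w \<longleftrightarrow> u = w"
  by (auto simp: mem_factorizations)

lemma factorizations_1 [simp]: "factorizations 1 = {(1, 1)}"
  by (auto simp: mem_factorizations)

text \<open>All functions are allowed, so elements are formal infinite sums over S_Z; the product at
  w is still a finite sum.\<close>

typedef 'a nilcox = "UNIV :: (int perm \<Rightarrow> 'a) set"
  morphisms coef of_coef by simp

lemma coef_of_coef [simp]: "coef (of_coef f) = f"
  by (simp add: of_coef_inverse)

lemma nilcox_eqI: "(\<And>w. coef F w = coef G w) \<Longrightarrow> F = G"
  using coef_inject[of F G] by (simp add: fun_eq_iff)

instantiation nilcox :: (comm_ring_1) ring_1
begin

definition "0 = of_coef (\<lambda>_. 0)"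
definition "1 = of_coef (\<lambda>w. if w = 1 then 1 else 0)"
definition "F + G = of_coef (\<lambda>w. coef F w + coef G w)"
definition "F - G = of_coef (\<lambda>w. coef F w - coef G w)"
definition "- F = of_coef (\<lambda>w. - coef F w)"
definition "F * G = of_coef (\<lambda>w. \<Sum>(u, v)\<in>factorizations w. coef F u * coef G v)"

instance
proof
  fix F G H :: "'a nilcox"
  show "F * G * H = F * (G * H)"
  proof (rule nilcox_eqI)
    fix w
    let ?f = "factorizations"
    have "coef (F * G * H) w = (\<Sum>p\<in>?f w. \<Sum>q\<in>?f (fst p). coef F (fst q) * coef G (snd q) * coef H (snd p))"
      by (simp add: times_nilcox_def sum_distrib_right split_def)
    also have "\<dots> = (\<Sum>(p, q)\<in>(SIGMA p : ?f w. ?f (fst p)). coef F (fst q) * coef G (snd q) * coef H (snd p))"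
      by (rule sum.Sigma) simp_all
    also have "\<dots> = (\<Sum>(p, q)\<in>(SIGMA p : ?f w. ?f (snd p)). coef F (fst p) * (coef G (fst q) * coef H (snd q)))"
      by (rule sum.reindex_bij_witness[where i = "\<lambda>((a, t), (b, c)). ((a * b, c), (a, b))"
            and j = "\<lambda>((t, c), (a, b)). ((a, b * c), (b, c))"])
        (auto dest: factorizations_assoc1 factorizations_assoc2, auto simp: mem_factorizations mult.assoc)
    also have "\<dots> = (\<Sum>p\<in>?f w. \<Sum>q\<in>?f (snd p). coef F (fst p) * (coef G (fst q) * coef H (snd q)))"
      by (rule sum.Sigma[symmetric]) simp_all
    also have "\<dots> = coef (F * (G * H)) w"
      by (simp add: times_nilcox_def sum_distrib_left split_def)
    finally show "coef (F * G * H) w = coef (F * (G * H)) w" .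
  qed
  show "1 * F = F"
  proof (rule nilcox_eqI)
    fix w
    have "coef (1 * F) w = (\<Sum>p\<in>factorizations w. if p = (1, w) then coef F w else 0)"
      unfolding times_nilcox_def one_nilcox_def coef_of_coef
      by (rule sum.cong) (auto split: if_splits)
    then show "coef (1 * F) w = coef F w" by (simp add: sum.delta)
  qed
  show "F * 1 = F"
  proof (rule nilcox_eqI)
    fix w
    have "coef (F * 1) w = (\<Sum>p\<in>factorizations w. if p = (w, 1) then coef F w else 0)"
      unfolding times_nilcox_def one_nilcox_def coef_of_coef
      by (rule sum.cong) (auto split: if_splits)
    then show "coef (F * 1) w = coef F w" by (simp add: sum.delta)
  qed
  show "(F + G) * H = F * H + G * H"
    by (simp add: times_nilcox_def plus_nilcox_def split_def algebra_simps sum.distrib)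
  show "F * (G + H) = F * G + F * H"
    by (simp add: times_nilcox_def plus_nilcox_def split_def algebra_simps sum.distrib)
  show "(0 :: 'a nilcox) \<noteq> 1"
  proof
    assume "(0 :: 'a nilcox) = 1"
    then have "coef (0 :: 'a nilcox) 1 = coef 1 1" by simp
    then show False by (simp add: zero_nilcox_def one_nilcox_def)
  qed
qed (simp_all add: zero_nilcox_def plus_nilcox_def minus_nilcox_def uminus_nilcox_def coef_inverse
    algebra_simps)

end

lemma coef_0 [simp]: "coef 0 w = 0"
  and coef_1: "coef 1 w = (if w = 1 then 1 else 0)"
  and coef_add [simp]: "coef (F + G) w = coef F w + coef G w"
  and coef_diff [simp]: "coef (F - G) w = coef F w - coef G w"
  and coef_uminus [simp]: "coef (- F) w = - coef F w"
  and coef_mult: "coef (F * G) w = (\<Sum>(u, v)\<in>factorizations w. coef F u * coef G v)"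
  by (simp_all add: zero_nilcox_def one_nilcox_def plus_nilcox_def minus_nilcox_def
      uminus_nilcox_def times_nilcox_def)

lemma coef_1_1 [simp]: "coef 1 1 = 1"
  by (simp add: coef_1)

definition scal :: "'a::comm_ring_1 \<Rightarrow> 'a nilcox"
  where "scal c = of_coef (\<lambda>w. if w = 1 then c else 0)"

definition base :: "int perm \<Rightarrow> 'a::comm_ring_1 nilcox"
  where "base v = of_coef (\<lambda>w. if w = v then 1 else 0)"

definition gen :: "int \<Rightarrow> 'a::comm_ring_1 nilcox"
  where "gen i = base (s i)"

lemma coef_scal_mult [simp]: "coef (scal c * F) w = c * coef F w"
proof -
  have "coef (scal c * F) w = (\<Sum>p\<in>factorizations w. if p = (1, w) then c * coef F w else 0)"
    unfolding coef_mult scal_def coef_of_coef by (rule sum.cong) (auto split: if_splits)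
  then show ?thesis by (simp add: sum.delta)
qed

lemma coef_mult_scal: "coef (F * scal c) w = coef F w * c"
proof -
  have "coef (F * scal c) w = (\<Sum>p\<in>factorizations w. if p = (w, 1) then coef F w * c else 0)"
    unfolding coef_mult scal_def coef_of_coef by (rule sum.cong) (auto split: if_splits)
  then show ?thesis by (simp add: sum.delta)
qed

lemma scal_commute: "F * scal c = scal c * F"
  by (rule nilcox_eqI) (simp add: coef_mult_scal mult.commute)

lemma rhom_scal: "rhom scal"
proof (rule rhomI)
  fix x y :: 'a
  show "scal (x + y) = scal x + scal y"
    by (rule nilcox_eqI) (simp add: scal_def)
  show "scal (x * y) = scal x * scal y"
    by (rule nilcox_eqI) (simp, simp add: scal_def)
qed (simp add: scal_def one_nilcox_def)

lemma base_mult: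
  "base u * base v = (if len (u * v) = len u + len v then base (u * v) else (0 :: 'a::comm_ring_1 nilcox))"
proof (rule nilcox_eqI)
  fix w
  have "coef (base u * base v :: 'a nilcox) w = (\<Sum>p\<in>factorizations w. if p = (u, v) then 1 else 0)"
    unfolding coef_mult base_def coef_of_coef by (rule sum.cong) (auto split: if_splits)
  also have "\<dots> = (if (u, v) \<in> factorizations w then 1 else 0)"
    by (simp add: sum.delta)
  finally show "coef (base u * base v :: 'a nilcox) w =
      coef (if len (u * v) = len u + len v then base (u * v) else 0) w"
    by (auto simp: base_def mem_factorizations)
qed

lemma base_mult3:
  "base a * base b * base c = (if len (a * b * c) = len a + len b + len c then base (a * b * c)
    else (0 :: 'a::comm_ring_1 nilcox))"
  using len_mult_le[of "a * b" c] len_mult_le[of a b] by (auto simp: base_mult)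

lemma gen_sq [simp]: "gen i * gen i = (0 :: 'a::comm_ring_1 nilcox)"
  by (simp add: gen_def base_mult)

lemma s_commute: "i + 1 < j \<or> j + 1 < i \<Longrightarrow> s i * s j = s j * s i"
  by (rule perm_eqI) (auto simp: apply_mult apply_s)

lemma s_braid: "s i * s (i + 1) * s i = s (i + 1) * s i * s (i + 1)"
  by (rule perm_eqI) (auto simp: apply_mult apply_s)

lemma gen_commute: "i + 1 < j \<or> j + 1 < i \<Longrightarrow> gen i * gen j = (gen j * gen i :: 'a::comm_ring_1 nilcox)"
  unfolding gen_def base_mult by (simp add: s_commute[of i j])

lemma gen_braid: "gen i * gen (i + 1) * gen i = (gen (i + 1) * gen i * gen (i + 1) :: 'a::comm_ring_1 nilcox)"
  unfolding gen_def base_mult3 by (simp add: s_braid)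

text \<open>This has the shape of the divided difference recursion: a descent leads to w s_i, an
  ascent to 0. One ring equation with \<open>gen i\<close> on the right therefore states the
  recursion for all w.\<close>

lemma coef_mult_gen: "coef (F * gen i) w = (if len (w * s i) < len w then coef F (w * s i) else 0)"
proof -
  have "coef F u * (if v = s i then 1 else 0) = (if (u, v) = (w * s i, s i) then coef F (w * s i) else 0)"
    if "(u, v) \<in> factorizations w" for u v
    using that by (cases "v = s i") (simp_all add: mem_factorizations)
  then have "coef (F * gen i) w = (\<Sum>p\<in>factorizations w. if p = (w * s i, s i) then coef F (w * s i) else 0)"
    unfolding coef_mult gen_def base_def coef_of_coef by (intro sum.cong refl) (simp only: split_paired_all prod.case)
  also have "\<dots> = (if (w * s i, s i) \<in> factorizations w then coef F (w * s i) else 0)"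
    by (simp add: sum.delta)
  also have "(w * s i, s i) \<in> factorizations w \<longleftrightarrow> len (w * s i) < len w"
    using len_mult_s_less[of w i] by (auto simp: mem_factorizations)
  finally show ?thesis .
qed

section \<open>The products of Fomin and Kirillov\<close>

definition lin :: "'a::comm_ring_1 \<Rightarrow> int \<Rightarrow> 'a nilcox"
  where "lin t j = 1 + scal t * gen j"

lemma lin_0 [simp]: "lin 0 j = 1"
  by (simp add: lin_def rhom_0[OF rhom_scal])

lemma scal_left_commute: "G * (scal c * F) = scal c * (G * F)"
  by (simp only: scal_commute flip: mult.assoc)

lemma gen_scal: "gen i * (scal c * F) = scal c * (gen i * F)"
  by (rule scal_left_commute)

lemma lin_mult: "lin t i * lin u j = 1 + scal t * gen i + scal u * gen j + scal (t * u) * (gen i * gen j)"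
  by (simp add: lin_def algebra_simps gen_scal rhom_mult[OF rhom_scal])

text \<open>As \<open>gen j\<close> squares to zero, \<open>lin t j\<close> is the exponential of t
  times \<open>gen j\<close>.\<close>

lemma lin_mult_same: "lin t j * lin u j = lin (t + u) j"
  by (simp add: lin_mult) (simp add: lin_def rhom_add[OF rhom_scal] algebra_simps)

lemma lin_commute:
  assumes "i + 1 < j \<or> j + 1 < i \<or> i = j"
  shows "lin t i * lin u j = (lin u j * lin t i :: 'a::comm_ring_1 nilcox)"
proof -
  have "gen i * gen j = (gen j * gen i :: 'a nilcox)"
    using assms gen_commute by blast
  then show ?thesis by (simp only: lin_mult) (simp add: algebra_simps)
qed

text \<open>The terms of degree at most two agree once the squares vanish. The cubic terms both have
  coefficient a b (a + b) and are matched by the braid relation.\<close>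

lemma yang_baxter:
  "lin b (i + 1) * lin (a + b) i * lin a (i + 1) = lin a i * lin (a + b) (i + 1) * (lin b i :: 'a::comm_ring_1 nilcox)"
proof -
  let ?u = "gen i :: 'a nilcox" and ?v = "gen (i + 1) :: 'a nilcox"
  have *: "?u * (?v * ?u) = ?v * (?u * ?v)" using gen_braid[of i] by (simp add: mult.assoc)
  have **: "?u * (?u * F) = 0" "?v * (?v * F) = 0" for F by (simp_all flip: mult.assoc)
  show ?thesis
    by (rule nilcox_eqI) (simp add: lin_def gen_scal * ** mult.assoc ring_distribs)
qed

definition hfun :: "int \<Rightarrow> int \<Rightarrow> 'a::comm_ring_1 \<Rightarrow> 'a nilcox"
  where "hfun M i t = prod_list (map (lin t) (rev [i..M]))"

definition hinv :: "int \<Rightarrow> int \<Rightarrow> 'a::comm_ring_1 \<Rightarrow> 'a nilcox"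
  where "hinv M i t = prod_list (map (lin (- t)) [i..M])"

lemma hfun_empty [simp]: "M < i \<Longrightarrow> hfun M i t = 1"
  by (simp add: hfun_def)

lemma hfun_rec: "i \<le> M \<Longrightarrow> hfun M i t = hfun M (i + 1) t * lin t i"
  by (simp add: hfun_def upto_rec1)

lemma hinv_empty [simp]: "M < i \<Longrightarrow> hinv M i t = 1"
  by (simp add: hinv_def)

lemma hinv_rec: "i \<le> M \<Longrightarrow> hinv M i t = lin (- t) i * hinv M (i + 1) t"
  by (simp add: hinv_def upto_rec1)

lemma inverse_mult:
  fixes a b a' b' :: "'a::monoid_mult"
  assumes "a * a' = 1" "b * b' = 1"
  shows "a * b * (b' * a') = 1"
  by (metis assms mult.assoc mult.right_neutral)

lemma downward_induct [consumes 0, case_names above step]: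
  fixes M :: int
  assumes "\<And>i. M < i \<Longrightarrow> Q i" "\<And>i. i \<le> M \<Longrightarrow> Q (i + 1) \<Longrightarrow> Q i"
  shows "Q i"
proof (induction "nat (M + 1 - i)" arbitrary: i)
  case 0
  then show ?case using assms(1) by simp
next
  case (Suc n)
  then show ?case using assms(2)[of i] by simp
qed

lemma hfun_hinv: "hfun M i t * hinv M i t = 1" "hinv M i t * hfun M i t = 1"
proof -
  have "hfun M i t * hinv M i t = 1 \<and> hinv M i t * hfun M i t = 1"
  proof (induction i rule: downward_induct[of M])
    case (step i)
    have "lin t i * lin (- t) i = 1" "lin (- t) i * lin t i = 1"
      by (simp_all add: lin_mult_same)
    then show ?case using step by (simp add: hfun_rec hinv_rec inverse_mult)
  qed simp
  then show "hfun M i t * hinv M i t = 1" "hinv M i t * hfun M i t = 1" by auto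
qed

lemma lin_hfun_commute: "k + 1 < i \<Longrightarrow> lin u k * hfun M i t = hfun M i t * lin u k"
proof (induction i rule: downward_induct[of M])
  case (step i)
  then show ?case using lin_commute[of k i u t] by (simp add: hfun_rec flip: mult.assoc) (simp add: mult.assoc)
qed simp

lemma mult_lin_cancel: "F * lin t i = G * lin t i \<Longrightarrow> F = G"
  by (drule arg_cong[where f = "\<lambda>H. H * lin (- t) i"]) (simp add: mult.assoc lin_mult_same)

text \<open>Commutation of the two rows at k, with the last factor \<open>lin x k\<close> cancelled
  on the right. Commutation is a hypothesis because the induction that proves it uses this exchange
  at i + 1.\<close>

lemma hfun_exchange_aux:
  assumes "hfun M k x * hfun M k y = hfun M k y * hfun M k x" "k \<le> M"
  shows "hfun M k y * hfun M (k + 1) x = hfun M k x * hfun M (k + 1) y * lin (y - x) k"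
proof (rule mult_lin_cancel[of _ x k])
  show "hfun M k y * hfun M (k + 1) x * lin x k = hfun M k x * hfun M (k + 1) y * lin (y - x) k * lin x k"
    using assms by (simp add: mult.assoc lin_mult_same flip: hfun_rec)
qed

text \<open>Fomin and Kirillov: the Yang-Baxter equation lets the two outermost factors of the product
  pass each other.\<close>

lemma hfun_commute: "hfun M i x * hfun M i y = hfun M i y * hfun M i x"
proof (induction i rule: downward_induct[of M])
  case (step i)
  let ?h = "hfun M (i + 1)" and ?g = "hfun M (i + 1 + 1)"
  show ?case
  proof (cases "i = M")
    case True
    then show ?thesis by (simp add: hfun_rec lin_commute)
  next
    case False
    then have le: "i + 1 \<le> M" using step by simp
    \<comment> \<open>The induction hypothesis permits the exchange at i + 1. It supplies the third
      linear factor required by the Yang-Baxter equation.\<close>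
    have ex: "?h y * ?g x * lin (x - y) (i + 1) = ?h x * ?g y"
      using hfun_exchange_aux[OF step(2)[symmetric] le] by simp
    have "hfun M i x * hfun M i y = ?h x * lin x i * (?g y * lin y (i + 1)) * lin y i"
      using step(1) le by (simp add: hfun_rec mult.assoc)
    also have "\<dots> = ?h x * ?g y * (lin x i * lin y (i + 1) * lin y i)"
      using arg_cong[OF lin_hfun_commute[of i "i + 1 + 1" x M y], of "\<lambda>F. ?h x * F * (lin y (i + 1) * lin y i)"]
      by (simp add: mult.assoc)
    also have "\<dots> = ?h y * ?g x * (lin (x - y) (i + 1) * lin x i * lin y (i + 1)) * lin y i"
      unfolding ex[symmetric] by (simp add: mult.assoc)
    also have "lin (x - y) (i + 1) * lin x i * lin y (i + 1) = lin y i * lin x (i + 1) * lin (x - y) i"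
      using yang_baxter[of "x - y" i y] by simp
    also have "?h y * ?g x * (lin y i * lin x (i + 1) * lin (x - y) i) * lin y i
        = ?h y * (?g x * lin y i) * lin x (i + 1) * lin x i"
      by (simp add: mult.assoc lin_mult_same)
    also have "?g x * lin y i = lin y i * ?g x"
      using lin_hfun_commute[of i "i + 1 + 1" y M x] by simp
    also have "?h y * (lin y i * ?g x) * lin x (i + 1) * lin x i = hfun M i y * hfun M i x"
      using step(1) le by (simp add: hfun_rec mult.assoc)
    finally show ?thesis .
  qed
qed simp

lemma hfun_exchange:
  "k \<le> M \<Longrightarrow> hfun M k y * hfun M (k + 1) x = hfun M k x * hfun M (k + 1) y * lin (y - x) k"
  by (rule hfun_exchange_aux[OF hfun_commute])

definition Phi :: "int \<Rightarrow> int \<Rightarrow> (int \<Rightarrow> 'a::comm_ring_1) \<Rightarrow> 'a nilcox"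
  where "Phi p M x = prod_list (map (\<lambda>i. hfun M i (x i)) [p..M])"

definition Phi_inv :: "int \<Rightarrow> int \<Rightarrow> (int \<Rightarrow> 'a::comm_ring_1) \<Rightarrow> 'a nilcox"
  where "Phi_inv p M a = prod_list (map (\<lambda>i. hinv M i (a i)) (rev [p..M]))"

lemma Phi_empty [simp]: "M < p \<Longrightarrow> Phi p M x = 1"
  by (simp add: Phi_def)

lemma Phi_rec: "p \<le> M \<Longrightarrow> Phi p M x = hfun M p (x p) * Phi (p + 1) M x"
  by (simp add: Phi_def upto_rec1)

lemma Phi_inv_rec: "p \<le> M \<Longrightarrow> Phi_inv p M a = Phi_inv (p + 1) M a * hinv M p (a p)"
  by (simp add: Phi_inv_def upto_rec1)

lemma Phi_inv_empty [simp]: "M < p \<Longrightarrow> Phi_inv p M x = 1"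
  by (simp add: Phi_inv_def)

lemma Phi_Phi_inv: "Phi p M x * Phi_inv p M x = 1" "Phi_inv p M x * Phi p M x = 1"
proof -
  have "Phi p M x * Phi_inv p M x = 1 \<and> Phi_inv p M x * Phi p M x = 1"
    by (induction p rule: downward_induct[of M]) (simp_all add: Phi_rec Phi_inv_rec inverse_mult hfun_hinv)
  then show "Phi p M x * Phi_inv p M x = 1" "Phi_inv p M x * Phi p M x = 1" by auto
qed

lemma Phi_cong: "(\<And>i. p \<le> i \<Longrightarrow> i \<le> M \<Longrightarrow> x i = y i) \<Longrightarrow> Phi p M x = Phi p M y"
  unfolding Phi_def by (intro arg_cong[where f = prod_list] map_cong) auto

lemma Phi_split:
  "p \<le> k \<Longrightarrow> Phi p M x = prod_list (map (\<lambda>i. hfun M i (x i)) [p..k - 1]) * Phi k M x"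
proof (induction k rule: int_ge_induct)
  case (step k)
  have "[p..k] = [p..k - 1] @ [k]" using step(1) by (rule upto_rec2)
  then show ?case using step by (cases "k \<le> M") (simp_all add: Phi_rec mult.assoc)
qed simp

lemma lin_Phi_commute: "k + 1 < i \<Longrightarrow> lin u k * Phi i M x = Phi i M x * lin u k"
proof (induction i rule: downward_induct[of M])
  case (step i)
  then show ?case using lin_hfun_commute[of k i u M "x i"]
    by (simp add: Phi_rec flip: mult.assoc) (simp add: mult.assoc)
qed simp

text \<open>Only the rows k and k + 1 change. Their exchange leaves one linear factor in generator
  k, which passes all later rows because those use generators from k + 2 on.\<close>

lemma Phi_swap:
  assumes "p \<le> k" "k \<le> M"
  shows "Phi p M (\<lambda>i. x (s k \<langle>$\<rangle> i)) = Phi p M x * lin (x (k + 1) - x k) k"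
proof -
  let ?P = "\<lambda>x. prod_list (map (\<lambda>i. hfun M i (x i)) [p..k - 1])"
  have split: "Phi p M x = ?P x * (hfun M k (x k) * hfun M (k + 1) (x (k + 1))) * Phi (k + 1 + 1) M x" for x :: "int \<Rightarrow> 'a"
    using assms by (subst Phi_split[of p k]) (cases "k + 1 \<le> M"; simp add: Phi_rec mult.assoc)+
  let ?y = "\<lambda>i. x (s k \<langle>$\<rangle> i)"
  have "Phi p M ?y = ?P x * (hfun M k (x (k + 1)) * hfun M (k + 1) (x k)) * Phi (k + 1 + 1) M x"
  proof -
    have "?P ?y = ?P x"
      by (intro arg_cong[where f = prod_list] map_cong) (auto simp: apply_s)
    moreover have "Phi (k + 1 + 1) M ?y = Phi (k + 1 + 1) M x"
      by (intro Phi_cong) (auto simp: apply_s)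
    ultimately show ?thesis by (subst split) (simp add: apply_s)
  qed
  also have "\<dots> = ?P x * (hfun M k (x k) * hfun M (k + 1) (x (k + 1))) *
      (lin (x (k + 1) - x k) k * Phi (k + 1 + 1) M x)"
    unfolding hfun_exchange[OF assms(2), where x = "x k" and y = "x (k + 1)"] by (simp add: mult.assoc)
  also have "\<dots> = Phi p M x * lin (x (k + 1) - x k) k"
    using lin_Phi_commute[of k "k + 1 + 1" "x (k + 1) - x k" M x]
    by (subst split) (simp add: mult.assoc)
  finally show ?thesis .
qed

definition Sch :: "int \<Rightarrow> int \<Rightarrow> (int \<Rightarrow> 'a::comm_ring_1) \<Rightarrow> (int \<Rightarrow> 'a) \<Rightarrow> 'a nilcox"
  where "Sch p M x a = Phi_inv p M a * Phi p M x"

lemma Sch_same [simp]: "Sch p M a a = 1"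
  by (simp add: Sch_def Phi_Phi_inv)

text \<open>A swap changes \<open>Phi\<close> only by a factor on its far right, so the inverse of
  Phi(a) on the left is untouched.\<close>

lemma Sch_swap:
  assumes "p \<le> k" "k \<le> M"
  shows "Sch p M x a - Sch p M (\<lambda>i. x (s k \<langle>$\<rangle> i)) a = scal (x k - x (k + 1)) * (Sch p M x a * gen k)"
proof -
  have "scal (x (k + 1) - x k) = - scal (x k - x (k + 1))"
    by (simp flip: rhom_uminus[OF rhom_scal])
  then show ?thesis
    unfolding Sch_def Phi_swap[OF assms] lin_def
    by (simp add: algebra_simps scal_left_commute)
qed


section \<open>Coefficient maps, projections, shifts and the grading of the nilCoxeter ring\<close>

definition nilmap :: "('a::comm_ring_1 \<Rightarrow> 'b::comm_ring_1) \<Rightarrow> 'a nilcox \<Rightarrow> 'b nilcox"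
  where "nilmap f F = of_coef (\<lambda>w. f (coef F w))"

lemma coef_nilmap [simp]: "coef (nilmap f F) w = f (coef F w)"
  by (simp add: nilmap_def)

lemma rhom_nilmap: "rhom f \<Longrightarrow> rhom (nilmap f)"
  by (intro rhomI nilcox_eqI)
    (simp_all add: coef_1 coef_mult rhom_1 rhom_0 rhom_add rhom_mult rhom_sum split_def)

lemma nilmap_scal: "rhom f \<Longrightarrow> nilmap f (scal c) = scal (f c)"
  by (rule nilcox_eqI) (simp add: scal_def rhom_0)

lemma nilmap_gen: "rhom f \<Longrightarrow> nilmap f (gen i) = gen i"
  by (rule nilcox_eqI) (simp add: gen_def base_def rhom_0 rhom_1)

text \<open>This projection is a ring homomorphism that kills the generators outside m..M, so it
  acts on a product of linear factors by deleting factors.\<close>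

definition restrict_supp :: "int \<Rightarrow> int \<Rightarrow> 'a::comm_ring_1 nilcox \<Rightarrow> 'a nilcox"
  where "restrict_supp m M F = of_coef (\<lambda>w. if supported m M w then coef F w else 0)"

lemma coef_restrict_supp: "coef (restrict_supp m M F) w = (if supported m M w then coef F w else 0)"
  by (simp add: restrict_supp_def)

lemma rhom_restrict_supp: "rhom (restrict_supp m M)"
proof (rule rhomI; rule nilcox_eqI)
  fix F G :: "'a nilcox" and w
  show "coef (restrict_supp m M (F * G)) w = coef (restrict_supp m M F * restrict_supp m M G) w"
  proof (cases "supported m M w")
    case True
    then show ?thesis
      using supported_factorization by (auto simp: coef_restrict_supp coef_mult intro!: sum.cong)
  next
    case False
    then have "(\<Sum>(u, v)\<in>factorizations w. coef (restrict_supp m M F) u * coef (restrict_supp m M G) v) = 0"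
      by (intro sum.neutral) (auto simp: coef_restrict_supp supported_factorization)
    then show ?thesis using False by (simp add: coef_restrict_supp coef_mult)
  qed
qed (simp_all add: coef_restrict_supp coef_1)

lemma restrict_supp_scal: "restrict_supp m M (scal c) = scal c"
  by (rule nilcox_eqI) (simp add: scal_def coef_restrict_supp)

lemma restrict_supp_gen: "restrict_supp m M (gen i) = (if m \<le> i \<and> i \<le> M then gen i else 0)"
  by (rule nilcox_eqI) (auto simp: gen_def base_def coef_restrict_supp)

text \<open>Coefficients are read at the shifted permutation, so generators move the opposite way,
  from i to i - k.\<close>

definition shift_nil :: "int \<Rightarrow> 'a::comm_ring_1 nilcox \<Rightarrow> 'a nilcox"
  where "shift_nil k F = of_coef (\<lambda>w. coef F (shift_perm k w))"

lemma coef_shift_nil [simp]: "coef (shift_nil k F) w = coef F (shift_perm k w)"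
  by (simp add: shift_nil_def)

lemma shift_perm_cancel [simp]: "shift_perm k (shift_perm (- k) w) = w" "shift_perm (- k) (shift_perm k w) = w"
  by (simp_all add: shift_perm_shift)

lemma shift_perm_eq_iff: "shift_perm k w = v \<longleftrightarrow> w = shift_perm (- k) v"
  by auto

lemma rhom_shift_nil: "rhom (shift_nil k)"
proof (rule rhomI; rule nilcox_eqI)
  fix F G :: "'a nilcox" and w
  show "coef (shift_nil k (F * G)) w = coef (shift_nil k F * shift_nil k G) w"
    unfolding coef_mult coef_shift_nil
  proof (rule sum.reindex_bij_witness[where i = "\<lambda>(u, v). (shift_perm k u, shift_perm k v)"
        and j = "\<lambda>(u, v). (shift_perm (- k) u, shift_perm (- k) v)"], goal_cases)
    case (2 p)
    obtain u v where p: "p = (u, v)" by (cases p)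
    have uv: "shift_perm k w = u * v" "len w = len u + len v"
      using 2 by (simp_all add: p mem_factorizations len_shift)
    from uv(1) have "w = shift_perm (- k) u * shift_perm (- k) v"
      by (simp add: shift_perm_eq_iff flip: shift_perm_mult)
    with uv(2) show ?case by (simp add: p mem_factorizations len_shift)
  qed (auto simp: mem_factorizations len_shift simp flip: shift_perm_mult)
qed (simp_all add: coef_1 shift_perm_eq_iff)

lemma shift_nil_scal: "shift_nil k (scal c) = scal c"
  by (rule nilcox_eqI) (simp add: scal_def shift_perm_eq_iff)

lemma shift_nil_gen: "shift_nil k (gen i) = gen (i - k)"
  by (rule nilcox_eqI) (simp add: gen_def base_def shift_perm_eq_iff shift_perm_s)

definition scale_nil :: "'a::comm_ring_1 \<Rightarrow> 'a nilcox \<Rightarrow> 'a nilcox"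
  where "scale_nil t F = of_coef (\<lambda>w. t ^ len w * coef F w)"

lemma coef_scale_nil [simp]: "coef (scale_nil t F) w = t ^ len w * coef F w"
  by (simp add: scale_nil_def)

lemma rhom_scale_nil: "rhom (scale_nil t)"
proof (rule rhomI; rule nilcox_eqI)
  fix F G :: "'a nilcox" and w
  show "coef (scale_nil t (F * G)) w = coef (scale_nil t F * scale_nil t G) w"
    unfolding coef_mult coef_scale_nil sum_distrib_left
    by (rule sum.cong) (auto simp: mem_factorizations power_add)
qed (auto simp: coef_1 algebra_simps)

lemma scale_nil_scal: "scale_nil t (scal c) = scal c"
  by (rule nilcox_eqI) (simp add: scal_def)

lemma scale_nil_gen: "scale_nil t (gen i) = scal t * gen i"
  by (rule nilcox_eqI) (simp add: gen_def base_def)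

text \<open>The derivation belonging to the grading by length; the product rule is additivity of
  lengths in factorizations.\<close>

definition euler :: "'a::comm_ring_1 nilcox \<Rightarrow> 'a nilcox"
  where "euler F = of_coef (\<lambda>w. of_nat (len w) * coef F w)"

lemma coef_euler [simp]: "coef (euler F) w = of_nat (len w) * coef F w"
  by (simp add: euler_def)

lemma euler_mult: "euler (F * G) = euler F * G + F * euler G"
proof (rule nilcox_eqI)
  fix w
  have "coef (euler (F * G)) w =
      (\<Sum>p\<in>factorizations w. of_nat (len (fst p) + len (snd p)) * (coef F (fst p) * coef G (snd p)))"
    unfolding coef_euler coef_mult sum_distrib_left by (rule sum.cong) (auto simp: mem_factorizations)
  then show "coef (euler (F * G)) w = coef (euler F * G + F * euler G) w"
    by (simp add: coef_mult split_def algebra_simps sum.distrib)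
qed

lemma euler_1 [simp]: "euler 1 = 0"
  by (rule nilcox_eqI) (simp add: coef_1)

context
  fixes f :: "'a::comm_ring_1 \<Rightarrow> 'b::comm_ring_1"
  assumes f: "rhom f"
begin

lemma nilmap_lin: "nilmap f (lin t i) = lin (f t) i"
  by (simp add: lin_def rhom_1[OF rhom_nilmap[OF f]] rhom_add[OF rhom_nilmap[OF f]]
      rhom_mult[OF rhom_nilmap[OF f]] nilmap_scal[OF f] nilmap_gen[OF f])

lemma nilmap_hfun: "nilmap f (hfun M i t) = hfun M i (f t)"
  by (simp add: hfun_def rhom_prod_list[OF rhom_nilmap[OF f]] comp_def nilmap_lin)

lemma nilmap_hinv: "nilmap f (hinv M i t) = hinv M i (f t)"
  by (simp add: hinv_def rhom_prod_list[OF rhom_nilmap[OF f]] comp_def nilmap_lin rhom_uminus[OF f])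

lemma nilmap_Phi: "nilmap f (Phi p M x) = Phi p M (\<lambda>i. f (x i))"
  by (simp add: Phi_def rhom_prod_list[OF rhom_nilmap[OF f]] comp_def nilmap_hfun)

lemma nilmap_Phi_inv: "nilmap f (Phi_inv p M x) = Phi_inv p M (\<lambda>i. f (x i))"
  by (simp add: Phi_inv_def rhom_prod_list[OF rhom_nilmap[OF f]] comp_def nilmap_hinv)

lemma nilmap_Sch: "nilmap f (Sch p M x a) = Sch p M (\<lambda>i. f (x i)) (\<lambda>i. f (a i))"
  by (simp add: Sch_def rhom_mult[OF rhom_nilmap[OF f]] nilmap_Phi nilmap_Phi_inv)

lemma rhom_coef_Sch: "f (coef (Sch p M x a) w) = coef (Sch p M (\<lambda>i. f (x i)) (\<lambda>i. f (a i))) w"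
  by (simp flip: nilmap_Sch)

end

lemma restrict_supp_lin:
  "restrict_supp m M (lin t i) = (if m \<le> i \<and> i \<le> M then lin t i else 1)"
  by (simp add: lin_def rhom_1[OF rhom_restrict_supp] rhom_add[OF rhom_restrict_supp]
      rhom_mult[OF rhom_restrict_supp] restrict_supp_scal restrict_supp_gen)

text \<open>All rows starting below m become rows starting at m. In this way rows with different
  starts turn into commuting ones.\<close>

lemma restrict_supp_hfun:
  assumes "M \<le> M'"
  shows "restrict_supp m M (hfun M' i t) = hfun M (max m i) t"
    and "restrict_supp m M (hinv M' i t) = hinv M (max m i) t"
proof -
  have "restrict_supp m M (hfun M' i t) = hfun M (max m i) t \<and>
      restrict_supp m M (hinv M' i t) = hinv M (max m i) t"
  proof (induction i rule: downward_induct[of M'])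
    case (above i)
    then show ?case using assms by (simp add: rhom_1[OF rhom_restrict_supp])
  next
    case (step i)
    have "max m (i + 1) = (if m \<le> i then i + 1 else max m i)" by auto
    then show ?case using step
      by (auto simp: hfun_rec hinv_rec rhom_mult[OF rhom_restrict_supp] restrict_supp_lin)
  qed
  then show "restrict_supp m M (hfun M' i t) = hfun M (max m i) t"
    "restrict_supp m M (hinv M' i t) = hinv M (max m i) t" by auto
qed

lemma restrict_supp_Phi_upper:
  assumes "M \<le> M'"
  shows "restrict_supp p M (Phi p M' x) = Phi p M x" "restrict_supp p M (Phi_inv p M' x) = Phi_inv p M x"
proof -
  have "p \<le> q \<Longrightarrow> restrict_supp p M (Phi q M' x) = Phi q M x \<and>
    restrict_supp p M (Phi_inv q M' x) = Phi_inv q M x" for q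
  proof (induction q rule: downward_induct[of M'])
    case (above i)
    then show ?case using assms by (simp add: rhom_1[OF rhom_restrict_supp])
  next
    case (step i)
    then show ?case
      by (cases "i \<le> M") (simp_all add: Phi_rec Phi_inv_rec rhom_mult[OF rhom_restrict_supp] restrict_supp_hfun assms)
  qed
  then show "restrict_supp p M (Phi p M' x) = Phi p M x"
    "restrict_supp p M (Phi_inv p M' x) = Phi_inv p M x" by auto
qed

text \<open>Stability of double Schubert polynomials: killing the generators beyond M empties all
  rows beyond M.\<close>

lemma coef_Sch_upper:
  assumes "M \<le> M'" "supported p M w"
  shows "coef (Sch p M' x a) w = coef (Sch p M x a) w"
proof -
  have "restrict_supp p M (Sch p M' x a) = Sch p M x a"
    by (simp add: Sch_def rhom_mult[OF rhom_restrict_supp] restrict_supp_Phi_upper[OF assms(1)])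
  then show ?thesis using assms(2) coef_restrict_supp by metis
qed

lemma shift_nil_lin: "shift_nil k (lin t i) = lin t (i - k)"
  by (simp add: lin_def rhom_1[OF rhom_shift_nil] rhom_add[OF rhom_shift_nil]
      rhom_mult[OF rhom_shift_nil] shift_nil_scal shift_nil_gen)

lemma upto_shift: "map (\<lambda>i. i - k) [p..M] = [p - k..M - k :: int]"
proof (induction p rule: downward_induct[of M])
  case (step p)
  then show ?case by (simp add: upto_rec1[of p] upto_rec1[of "p - k"] algebra_simps)
qed simp

lemma shift_nil_hfun: "shift_nil k (hfun M i t) = hfun (M - k) (i - k) t"
  unfolding hfun_def upto_shift[symmetric] rhom_prod_list[OF rhom_shift_nil]
  by (simp add: rev_map comp_def shift_nil_lin)

lemma shift_nil_hinv: "shift_nil k (hinv M i t) = hinv (M - k) (i - k) t"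
  unfolding hinv_def upto_shift[symmetric] rhom_prod_list[OF rhom_shift_nil]
  by (simp add: rev_map comp_def shift_nil_lin)

lemma shift_nil_Sch: "shift_nil k (Sch p M x a) = Sch (p - k) (M - k) (\<lambda>i. x (i + k)) (\<lambda>i. a (i + k))"
  unfolding Sch_def Phi_def Phi_inv_def upto_shift[symmetric] rhom_mult[OF rhom_shift_nil]
    rhom_prod_list[OF rhom_shift_nil]
  by (simp add: rev_map comp_def shift_nil_hfun shift_nil_hinv)

text \<open>The value t starts at position M + 1, which \<open>Phi p M\<close> does not see, and
  travels down to position p; each adjacent swap leaves one linear factor.\<close>

lemma Phi_chain:
  assumes "p \<le> M + 1"
  shows "Phi p M (\<lambda>i. if i = p then t else a (i - 1)) = Phi p M a * prod_list (map (\<lambda>j. lin (t - a j) j) (rev [p..M]))"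
proof -
  let ?z = "\<lambda>k i. if i < k then a i else if i = k then t else a (i - 1)"
  have "p \<le> k \<Longrightarrow> k \<le> M + 1 \<Longrightarrow>
    Phi p M (?z k) = Phi p M a * prod_list (map (\<lambda>j. lin (t - a j) j) (rev [k..M]))" for k
  proof (induction k rule: downward_induct[of M])
    case (above k)
    then show ?case by (auto intro: Phi_cong)
  next
    case (step k)
    have "Phi p M (?z k) = Phi p M (\<lambda>i. ?z (k + 1) (s k \<langle>$\<rangle> i))"
      by (intro Phi_cong) (auto simp: apply_s)
    also have "\<dots> = Phi p M (?z (k + 1)) * lin (t - a k) k"
      using Phi_swap[of p k M "?z (k + 1)"] step by simp
    finally show ?case using step by (simp add: upto_rec1[of k M] mult.assoc)
  qed
  from this[of p] assms have "Phi p M (?z p) = Phi p M a * prod_list (map (\<lambda>j. lin (t - a j) j) (rev [p..M]))"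
    by simp
  moreover have "Phi p M (\<lambda>i. if i = p then t else a (i - 1)) = Phi p M (?z p)"
    by (intro Phi_cong) auto
  ultimately show ?thesis by simp
qed

text \<open>The pairs \<open>(i, j)\<close> of the double product expansion of \<^const>\<open>Sch\<close>, in the order of its factors.\<close>

definition staircase :: "int \<Rightarrow> int \<Rightarrow> (int \<times> int) list"
  where "staircase p M = concat (map (\<lambda>i. map (Pair i) (rev [i..M])) [p..M])"

lemma staircase_rec: "p \<le> M \<Longrightarrow> staircase p M = map (Pair p) (rev [p..M]) @ staircase (p + 1) M"
  by (simp add: staircase_def upto_rec1)

lemma staircase_empty [simp]: "M < p \<Longrightarrow> staircase p M = []"
  by (simp add: staircase_def)

lemma set_staircase: "set (staircase p M) = {(i, j). p \<le> i \<and> i \<le> j \<and> j \<le> M}"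
  by (auto simp: staircase_def image_iff)

lemma distinct_staircase: "distinct (staircase p M)"
  by (induction p rule: downward_induct[of M])
    (auto simp: staircase_rec set_staircase distinct_map inj_on_def)

text \<open>\<open>Phi_chain\<close> with t = x_p converts the first row into linear factors, at the
  price of moving the parameters a by one place in the rest. The offset j - i + p accumulates these
  moves.\<close>

lemma Sch_staircase:
  "Sch p M x a = prod_list (map (\<lambda>(i, j). lin (x i - a (j - i + p)) j) (staircase p M))"
proof (induction p arbitrary: a rule: downward_induct[of M])
  case (above p)
  then show ?case by (simp add: Sch_def)
next
  case (step p)
  let ?a = "\<lambda>i. a (i - 1)" and ?G = "prod_list (map (\<lambda>j. lin (x p - a j) j) (rev [p..M]))"
  have "Phi p M (\<lambda>i. if i = p then x p else a (i - 1)) = hfun M p (x p) * Phi (p + 1) M ?a"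
    using step(1) by (simp add: Phi_rec) (intro arg_cong2[where f = "(*)"] Phi_cong refl, simp)
  then have G: "hfun M p (x p) * Phi (p + 1) M ?a = Phi p M a * ?G"
    using Phi_chain[of p M "x p" a] step(1) by simp
  have "hfun M p (x p) = hfun M p (x p) * Phi (p + 1) M ?a * Phi_inv (p + 1) M ?a"
    by (simp add: mult.assoc Phi_Phi_inv)
  also have "\<dots> = Phi p M a * ?G * Phi_inv (p + 1) M ?a" by (simp only: G)
  finally have "Sch p M x a = Phi_inv p M a * Phi p M a * (?G * (Phi_inv (p + 1) M ?a * Phi (p + 1) M x))"
    using step(1) by (simp add: Sch_def Phi_rec mult.assoc)
  also have "\<dots> = ?G * Sch (p + 1) M x ?a" by (simp add: Phi_Phi_inv Sch_def)
  also have "Sch (p + 1) M x ?a = prod_list (map (\<lambda>(i, j). lin (x i - a (j - i + p)) j) (staircase (p + 1) M))"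
  proof -
    have "j - i + (p + 1) - 1 = j - i + p" for i j by simp
    then show ?thesis unfolding step(2) by (simp only:)
  qed
  finally show ?case
    using step(1) by (simp add: staircase_rec comp_def)
qed

text \<open>Only the top degree of the product can reach w, and the part of top degree is the
  product of all the generators. Lower degrees are excluded by the bound on the number of
  factors.\<close>

lemma coef_prod_lin:
  assumes "length xs \<le> len w"
  shows "coef (prod_list (map (\<lambda>z. lin (c z) (g z)) xs)) w =
    (if length xs = len w \<and> w = prod_list (map (\<lambda>z. s (g z)) xs) then prod_list (map c xs) else 0)"
  using assms
proof (induction xs arbitrary: w rule: rev_induct)
  case Nil
  then show ?case by (auto simp: coef_1)
next
  case (snoc z xs)
  let ?F = "prod_list (map (\<lambda>z. lin (c z) (g z)) xs)" and ?v = "prod_list (map (\<lambda>z. s (g z)) xs)"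
  have eq: "w * s (g z) = ?v \<longleftrightarrow> w = ?v * s (g z)"
    using mult_s_s[of w "g z"] mult_s_s[of ?v "g z"] by metis
  have "coef ?F w = 0" using snoc by simp
  then have "coef (?F * lin (c z) (g z)) w = c z * coef (?F * gen (g z)) w"
    by (simp add: lin_def distrib_left scal_left_commute)
  also have "\<dots> = (if length (xs @ [z]) = len w \<and> w = ?v * s (g z) then prod_list (map c xs) * c z else 0)"
  proof (cases "len (w * s (g z)) < len w")
    case True
    then show ?thesis
      using len_mult_s_less[OF True] snoc.IH[of "w * s (g z)"] snoc.prems eq
      by (simp add: coef_mult_gen mult.commute)
  next
    case False
    have "\<not> (length (xs @ [z]) = len w \<and> w = ?v * s (g z))"
    proof
      assume *: "length (xs @ [z]) = len w \<and> w = ?v * s (g z)"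
      then have "Suc (length xs) = len w" "w * s (g z) = ?v" by simp_all
      moreover have "len ?v \<le> length xs"
        using card_inversions_word[of "map g xs"] by (simp add: len_eq_card_inversions comp_def)
      ultimately show False using len_mult_s_not_less[OF False] by simp
    qed
    then show ?thesis using False by (simp only: coef_mult_gen if_False mult_zero_right)
  qed
  finally show ?case by (simp add: mult.assoc)
qed

text \<open>One row of the staircase is a cycle; the nested cycles compose to the reversal of the
  whole interval.\<close>

lemma apply_cycle_word:
  "p \<le> M + 1 \<Longrightarrow> prod_list (map s (rev [p..M])) \<langle>$\<rangle> k =
    (if k = p then M + 1 else if p < k \<and> k \<le> M + 1 then k - 1 else k)"
proof (induction p arbitrary: k rule: downward_induct[of M])
  case (step p)
  then show ?case by (auto simp: upto_rec1[of p] apply_mult apply_s)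
qed auto

lemma apply_staircase_word:
  "p \<le> M + 1 \<Longrightarrow> prod_list (map (\<lambda>z. s (snd z)) (staircase p M)) \<langle>$\<rangle> k =
    (if p \<le> k \<and> k \<le> M + 1 then p + M + 1 - k else k)"
proof (induction p arbitrary: k rule: downward_induct[of M])
  case (step p)
  then show ?case by (auto simp: staircase_rec apply_mult comp_def apply_cycle_word)
qed auto

lemma staircase_word: "prod_list (map (\<lambda>z. s (snd z)) (staircase 1 (int n - 1))) = w0 n"
proof (cases "n = 0")
  case True
  then show ?thesis by (intro perm_eqI) (simp add: w0.rep_eq)
next
  case False
  then show ?thesis by (intro perm_eqI) (subst apply_staircase_word; auto simp: w0.rep_eq)
qed

lemma staircase_bij:
  "bij_betw (\<lambda>(i, j). (i, j - i + 1)) (set (staircase 1 (int n - 1))) {(i, j). 1 \<le> i \<and> 1 \<le> j \<and> i + j \<le> int n}"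
  by (rule bij_betw_byWitness[where f' = "\<lambda>(i, j). (i, i + j - 1)"]) (auto simp: set_staircase)

text \<open>The staircase has exactly as many factors as w0 has letters, so only the product of all
  linear terms contributes.\<close>

lemma coef_Sch_w0:
  "coef (Sch 1 (int n - 1) x a) (w0 n) = (\<Prod>(i, j)\<in>{(i, j). 1 \<le> i \<and> 1 \<le> j \<and> i + j \<le> int n}. x i - a j)"
proof -
  let ?L = "staircase 1 (int n - 1)"
  have "length ?L = len (w0 n)"
    using bij_betw_same_card[OF staircase_bij] distinct_card[OF distinct_staircase] by (metis len_w0)
  then have "coef (Sch 1 (int n - 1) x a) (w0 n) = prod_list (map (\<lambda>z. x (fst z) - a (snd z - fst z + 1)) ?L)"
    unfolding Sch_staircase split_def by (subst coef_prod_lin) (simp_all add: staircase_word)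
  also have "\<dots> = (\<Prod>z\<in>set ?L. x (fst z) - a (snd z - fst z + 1))"
    by (rule prod.distinct_set_conv_list[OF distinct_staircase, symmetric])
  also have "\<dots> = (\<Prod>(i, j)\<in>{(i, j). 1 \<le> i \<and> 1 \<le> j \<and> i + j \<le> int n}. x i - a j)"
    by (subst prod.reindex_bij_betw[OF staircase_bij, symmetric]) (simp add: split_def)
  finally show ?thesis .
qed

section \<open>Evaluation of polynomials\<close>

definition mon :: "('v \<Rightarrow> 'c::comm_ring_1) \<Rightarrow> ('v \<Rightarrow>\<^sub>0 nat) \<Rightarrow> 'c"
  where "mon \<rho> m = (\<Prod>v\<in>Poly_Mapping.keys m. \<rho> v ^ Poly_Mapping.lookup m v)"

text \<open>The coefficient map is a parameter because it takes three values: \<open>Const\<close>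
  for substitutions, the identity for rational points, and constant polynomials for restriction to a
  curve.\<close>

definition meval :: "(rat \<Rightarrow> 'c::comm_ring_1) \<Rightarrow> ('v \<Rightarrow> 'c) \<Rightarrow> 'v mpoly \<Rightarrow> 'c"
  where "meval \<kappa> \<rho> f = (\<Sum>m\<in>Poly_Mapping.keys f. \<kappa> (Poly_Mapping.lookup f m) * mon \<rho> m)"

definition vars :: "'v mpoly \<Rightarrow> 'v set"
  where "vars f = (\<Union>m\<in>Poly_Mapping.keys f. Poly_Mapping.keys m)"

lemma finite_vars [simp]: "finite (vars f)"
  by (simp add: vars_def)

lemma subst_eq_meval: "subst \<sigma> = meval Const \<sigma>"
  by (rule ext) (simp add: subst_def meval_def mon_def)

lemma mon_superset:
  assumes "finite S" "Poly_Mapping.keys m \<subseteq> S"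
  shows "mon \<rho> m = (\<Prod>v\<in>S. \<rho> v ^ Poly_Mapping.lookup m v)"
  unfolding mon_def using assms
  by (intro prod.mono_neutral_left) (auto simp: in_keys_iff)

lemma mon_0 [simp]: "mon \<rho> 0 = 1"
  by (simp add: mon_def)

lemma mon_add: "mon \<rho> (m + n) = mon \<rho> m * mon \<rho> n"
proof -
  let ?S = "Poly_Mapping.keys m \<union> Poly_Mapping.keys n"
  have "mon \<rho> (m + n) = (\<Prod>v\<in>?S. \<rho> v ^ Poly_Mapping.lookup (m + n) v)"
    by (rule mon_superset) (simp_all add: Poly_Mapping.keys_add)
  then show ?thesis
    by (simp add: mon_superset[of ?S m] mon_superset[of ?S n] lookup_add power_add prod.distrib)
qed

lemma mon_single: "mon \<rho> (Poly_Mapping.single v n) = \<rho> v ^ n"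
  by (cases "n = 0") (simp_all add: mon_def)

lemma meval_superset:
  assumes "\<kappa> 0 = 0" "finite S" "Poly_Mapping.keys f \<subseteq> S"
  shows "meval \<kappa> \<rho> f = (\<Sum>m\<in>S. \<kappa> (Poly_Mapping.lookup f m) * mon \<rho> m)"
  unfolding meval_def using assms
  by (intro sum.mono_neutral_left) (auto simp: in_keys_iff)

lemma sum_monomials: "f = (\<Sum>m\<in>Poly_Mapping.keys f. Poly_Mapping.single m (Poly_Mapping.lookup f m))"
  by (rule poly_mapping_eqI)
    (simp add: lookup_sum lookup_single when_def sum.delta' in_keys_iff)

lemma rhom_Const: "rhom Const"
  by (rule rhomI) (simp_all add: Const_def single_add mult_single)

context
  fixes \<kappa> :: "rat \<Rightarrow> 'c::comm_ring_1"
  assumes \<kappa>: "rhom \<kappa>"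
begin

lemma meval_add: "meval \<kappa> \<rho> (f + g) = meval \<kappa> \<rho> f + meval \<kappa> \<rho> g"
proof -
  let ?S = "Poly_Mapping.keys f \<union> Poly_Mapping.keys g"
  have "meval \<kappa> \<rho> (f + g) = (\<Sum>m\<in>?S. \<kappa> (Poly_Mapping.lookup (f + g) m) * mon \<rho> m)"
    by (rule meval_superset) (simp_all add: rhom_0[OF \<kappa>] Poly_Mapping.keys_add)
  then show ?thesis
    by (simp add: meval_superset[of \<kappa> ?S f] meval_superset[of \<kappa> ?S g] rhom_0[OF \<kappa>] lookup_add
        rhom_add[OF \<kappa>] distrib_right sum.distrib)
qed

lemma meval_0: "meval \<kappa> \<rho> 0 = 0"
  by (simp add: meval_def)

lemma meval_sum: "meval \<kappa> \<rho> (\<Sum>i\<in>I. f i) = (\<Sum>i\<in>I. meval \<kappa> \<rho> (f i))"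
  by (induction I rule: infinite_finite_induct) (simp_all add: meval_0 meval_add)

lemma meval_single: "meval \<kappa> \<rho> (Poly_Mapping.single m c) = \<kappa> c * mon \<rho> m"
  by (cases "c = 0") (simp_all add: meval_def rhom_0[OF \<kappa>])

lemma meval_mult: "meval \<kappa> \<rho> (f * g) = meval \<kappa> \<rho> f * meval \<kappa> \<rho> g"
proof -
  let ?l = "Poly_Mapping.lookup" and ?s = "Poly_Mapping.single" and ?k = "Poly_Mapping.keys"
  have "f * g = (\<Sum>m\<in>?k f. \<Sum>n\<in>?k g. ?s (m + n) (?l f m * ?l g n))"
    by (subst (1) sum_monomials[of f], subst (1) sum_monomials[of g])
      (simp add: sum_product mult_single)
  then have "meval \<kappa> \<rho> (f * g) = (\<Sum>m\<in>?k f. \<Sum>n\<in>?k g. \<kappa> (?l f m) * mon \<rho> m * (\<kappa> (?l g n) * mon \<rho> n))"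
    by (simp add: meval_sum meval_single rhom_mult[OF \<kappa>] mon_add mult_ac)
  then show ?thesis by (simp add: meval_def sum_product)
qed

lemma meval_Const: "meval \<kappa> \<rho> (Const c) = \<kappa> c"
  by (simp add: Const_def meval_single)

lemma meval_Var: "meval \<kappa> \<rho> (Var v) = \<rho> v"
  by (simp add: Var_def meval_single mon_single rhom_1[OF \<kappa>])

lemma rhom_meval: "rhom (meval \<kappa> \<rho>)"
proof (rule rhomI)
  show "meval \<kappa> \<rho> 1 = 1"
    using meval_Const[of \<rho> 1] by (simp add: Const_def rhom_1[OF \<kappa>])
qed (simp_all add: meval_add meval_mult)

lemma rhom_meval_comp:
  assumes "rhom g"
  shows "g (meval \<kappa> \<rho> f) = meval (\<lambda>c. g (\<kappa> c)) (\<lambda>v. g (\<rho> v)) f"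
  unfolding meval_def mon_def
  by (simp add: rhom_sum[OF assms] rhom_mult[OF assms] rhom_prod[OF assms] rhom_power[OF assms])

end

lemma meval_cong:
  assumes "\<And>v. v \<in> vars f \<Longrightarrow> \<rho> v = \<rho>' v"
  shows "meval \<kappa> \<rho> f = meval \<kappa> \<rho>' f"
proof -
  have "\<rho> v = \<rho>' v" if "m \<in> Poly_Mapping.keys f" "v \<in> Poly_Mapping.keys m" for m v
    using assms that by (auto simp: vars_def)
  then show ?thesis
    unfolding meval_def mon_def by (intro sum.cong arg_cong2[where f = "(*)"] prod.cong refl) simp
qed

lemmas rhom_subst = rhom_meval[OF rhom_Const, folded subst_eq_meval]
lemmas subst_Var = meval_Var[OF rhom_Const, folded subst_eq_meval]
lemmas subst_Const = meval_Const[OF rhom_Const, folded subst_eq_meval]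

definition eval :: "('v \<Rightarrow> rat) \<Rightarrow> 'v mpoly \<Rightarrow> rat"
  where "eval = meval (\<lambda>c. c)"

lemma rhom_id: "rhom (\<lambda>c. c)"
  by (simp add: rhom_def)

lemmas rhom_eval = rhom_meval[OF rhom_id, folded eval_def]
lemmas eval_Var [simp] = meval_Var[OF rhom_id, folded eval_def]
lemmas eval_Const [simp] = meval_Const[OF rhom_id, folded eval_def]
lemmas eval_simps [simp] = rhom_0[OF rhom_eval] rhom_1[OF rhom_eval] rhom_add[OF rhom_eval]
  rhom_mult[OF rhom_eval] rhom_diff[OF rhom_eval] rhom_uminus[OF rhom_eval] rhom_power[OF rhom_eval]
  rhom_sum[OF rhom_eval]

lemma eval_subst [simp]: "eval \<rho> (subst \<sigma> f) = eval (\<lambda>v. eval \<rho> (\<sigma> v)) f"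
  unfolding subst_eq_meval by (simp add: rhom_meval_comp[OF rhom_Const rhom_eval] eval_def[symmetric])

lemma eval_cong: "(\<And>v. v \<in> vars f \<Longrightarrow> \<rho> v = \<rho>' v) \<Longrightarrow> eval \<rho> f = eval \<rho>' f"
  unfolding eval_def by (rule meval_cong)

section \<open>Polynomials are determined by their values\<close>

lemma injective_weights:
  assumes "finite V"
  shows "\<exists>wt :: 'v \<Rightarrow> nat. \<forall>m n :: 'v \<Rightarrow> nat. (\<forall>v\<in>V. m v < b \<and> n v < b) \<longrightarrow>
    (\<Sum>v\<in>V. m v * wt v) = (\<Sum>v\<in>V. n v * wt v) \<longrightarrow> (\<forall>v\<in>V. m v = n v)"
  using assms
proof (induction V)
  case (insert x V)
  then obtain wt :: "'v \<Rightarrow> nat" where wt: "(\<forall>v\<in>V. m v < b \<and> n v < b) \<Longrightarrow>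
    (\<Sum>v\<in>V. m v * wt v) = (\<Sum>v\<in>V. n v * wt v) \<Longrightarrow> (\<forall>v\<in>V. m v = n v)" for m n by blast
  \<comment> \<open>Exponents are read as digits in base b, with x as the new last digit.\<close>
  let ?w = "\<lambda>v. if v = x then 1 else b * wt v"
  have sum: "(\<Sum>v\<in>insert x V. m v * ?w v) = m x + b * (\<Sum>v\<in>V. m v * wt v)" for m :: "'v \<Rightarrow> nat"
  proof -
    have "(\<Sum>v\<in>V. m v * ?w v) = (\<Sum>v\<in>V. b * (m v * wt v))"
      using insert(2) by (intro sum.cong) auto
    then show ?thesis using insert(1,2) by (simp add: sum_distrib_left)
  qed
  show ?case
  proof (intro exI[of _ ?w] allI impI)
    fix m n :: "'v \<Rightarrow> nat"
    assume b: "\<forall>v\<in>insert x V. m v < b \<and> n v < b"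
      and eq: "(\<Sum>v\<in>insert x V. m v * ?w v) = (\<Sum>v\<in>insert x V. n v * ?w v)"
    let ?M = "\<Sum>v\<in>V. m v * wt v" and ?N = "\<Sum>v\<in>V. n v * wt v"
    have eq': "m x + b * ?M = n x + b * ?N" using eq unfolding sum .
    have "m x = (m x + b * ?M) mod b" "n x = (n x + b * ?N) mod b" using b by auto
    then have "m x = n x" using eq' by metis
    moreover have "b > 0" using b by auto
    ultimately have "?M = ?N" using eq' by simp
    then have "\<forall>v\<in>V. m v = n v" using wt b by blast
    then show "\<forall>v\<in>insert x V. m v = n v" using \<open>m x = n x\<close> by simp
  qed
qed simp

lemma rhom_pCons: "rhom (\<lambda>c. [:c:])"
  by (rule rhomI) (simp_all add: one_pCons)

lemma rhom_poly: "rhom (\<lambda>p. poly p t)"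
  by (rule rhomI) simp_all

lemma poly_meval: "poly (meval (\<lambda>c. [:c:]) r f) t = eval (\<lambda>v. poly (r v) t) f"
  using rhom_meval_comp[OF rhom_pCons rhom_poly, where f = f] by (simp add: eval_def)

text \<open>Kronecker substitution: powers of a single indeterminate with suitable exponents separate the
  monomials of a given polynomial.\<close>

lemma eval_eq_0_imp_eq_0:
  assumes "\<And>\<rho>. eval \<rho> f = 0"
  shows "f = 0"
proof -
  let ?l = "Poly_Mapping.lookup" and ?k = "Poly_Mapping.keys"
  define b where "b = Suc (Max (insert 0 (\<Union>m\<in>?k f. ?l m ` ?k m)))"
  have bnd: "?l m v < b" if "m \<in> ?k f" for m v
  proof (cases "v \<in> ?k m")
    case True
    then have "?l m v \<in> insert 0 (\<Union>m\<in>?k f. ?l m ` ?k m)" using that by blast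
    then have "?l m v \<le> Max (insert 0 (\<Union>m\<in>?k f. ?l m ` ?k m))" by (intro Max_ge) auto
    then show ?thesis by (simp add: b_def)
  qed (simp add: in_keys_iff b_def)
  obtain wt :: "'a \<Rightarrow> nat" where wt: "\<And>m n. (\<forall>v\<in>vars f. m v < b \<and> n v < b) \<Longrightarrow>
    (\<Sum>v\<in>vars f. m v * wt v) = (\<Sum>v\<in>vars f. n v * wt v) \<Longrightarrow> (\<forall>v\<in>vars f. m v = n v)"
    using injective_weights[OF finite_vars[of f], of b] by blast
  define e where "e m = (\<Sum>v\<in>vars f. ?l m v * wt v)" for m
  have inj: "m = n" if "m \<in> ?k f" "n \<in> ?k f" "e m = e n" for m n
  proof (rule poly_mapping_eqI)
    fix v
    have "\<forall>v\<in>vars f. ?l m v = ?l n v" using wt[of "?l m" "?l n"] that bnd by (simp add: e_def)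
    moreover have "?l m v = 0" "?l n v = 0" if "v \<notin> vars f"
      using that \<open>m \<in> ?k f\<close> \<open>n \<in> ?k f\<close> by (auto simp: vars_def in_keys_iff)
    ultimately show "?l m v = ?l n v" by metis
  qed
  let ?p = "meval (\<lambda>c. [:c:]) (\<lambda>v. Polynomial.monom 1 (wt v)) f"
  have "?p = (\<Sum>m\<in>?k f. Polynomial.monom (?l f m) (e m))"
    unfolding meval_def
  proof (rule sum.cong)
    fix m assume "m \<in> ?k f"
    then have "mon (\<lambda>v. Polynomial.monom (1 :: rat) (wt v)) m = (\<Prod>v\<in>vars f. Polynomial.monom 1 (?l m v * wt v))"
      by (subst mon_superset[of "vars f"]) (auto simp: vars_def monom_power mult.commute)
    also have "\<dots> = Polynomial.monom 1 (e m)"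
    proof -
      have "(\<Prod>v\<in>S. Polynomial.monom (1 :: rat) (h v)) = Polynomial.monom 1 (\<Sum>v\<in>S. h v)" if "finite S" for S :: "'a set" and h
        using that by (induction S) (simp_all add: mult_monom)
      then show ?thesis by (simp add: e_def)
    qed
    finally show "[:?l f m:] * mon (\<lambda>v. Polynomial.monom 1 (wt v)) m = Polynomial.monom (?l f m) (e m)"
      by (simp add: smult_monom)
  qed simp
  moreover have "?p = 0"
    using assms by (simp add: poly_meval flip: poly_all_0_iff_0)
  ultimately have zero: "(\<Sum>m\<in>?k f. Polynomial.monom (?l f m) (e m)) = 0" by simp
  show "f = 0"
  proof (rule ccontr)
    assume "f \<noteq> 0"
    then obtain n where n: "n \<in> ?k f" by (metis all_not_in_conv keys_eq_empty)
    have "0 = (\<Sum>m\<in>?k f. if e m = e n then ?l f m else 0)"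
      using arg_cong[OF zero, of "\<lambda>p. coeff p (e n)"] by (simp add: coeff_sum)
    also have "\<dots> = (\<Sum>m\<in>?k f. if m = n then ?l f m else 0)"
      by (rule sum.cong) (use n in \<open>auto dest: inj\<close>)
    also have "\<dots> = ?l f n" using n by (simp add: sum.delta')
    finally show False using n by (simp add: in_keys_iff)
  qed
qed

lemma mpoly_eqI: "(\<And>\<rho>. eval \<rho> f = eval \<rho> g) \<Longrightarrow> f = g"
  using eval_eq_0_imp_eq_0[of "f - g"] by simp

text \<open>Replaces continuity: along a polynomial curve the values form a one-variable polynomial,
  so infinitely many zeros force all values to be zero.\<close>

lemma eval_line:
  assumes "infinite T" "\<And>t. t \<in> T \<Longrightarrow> eval (\<lambda>v. poly (r v) t) f = 0"
  shows "eval (\<lambda>v. poly (r v) t) f = 0"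
proof -
  let ?p = "meval (\<lambda>c. [:c:]) r f"
  have "T \<subseteq> {t. poly ?p t = 0}" using assms(2) by (auto simp: poly_meval)
  then have "?p = 0" using assms(1) poly_roots_finite finite_subset by blast
  then show ?thesis by (simp flip: poly_meval)
qed

text \<open>The factor is nonzero wherever the two coordinates differ. Varying the coordinate of a
  alone extends the equality to the remaining points.\<close>

lemma Var_diff_mult_cancel:
  fixes a b :: 'a
  assumes "a \<noteq> b" "(Var a - Var b) * g = (Var a - Var b) * h"
  shows "g = h"
proof (rule mpoly_eqI)
  fix \<rho> :: "'a \<Rightarrow> rat"
  let ?r = "\<lambda>v. if v = a then [:0, 1:] else [:\<rho> v:]"
  have zero: "eval (\<lambda>v. poly (?r v) t) (g - h) = 0" if "t \<noteq> \<rho> b" for t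
    using arg_cong[OF assms(2), of "eval (\<lambda>v. poly (?r v) t)"] that assms(1) by simp
  have "infinite (- {\<rho> b})" by (simp add: infinite_UNIV_char_0)
  from eval_line[OF this, of ?r] zero have "eval (\<lambda>v. poly (?r v) (\<rho> a)) (g - h) = 0"
    by blast
  moreover have "(\<lambda>v. poly (?r v) (\<rho> a)) = \<rho>" by auto
  ultimately show "eval \<rho> g = eval \<rho> h" by simp
qed

text \<open>Treats a marked family of variables (power sums, or the x_j) as a vector while all other
  variables stay frozen.\<close>

definition plug :: "('v \<Rightarrow> 'i option) \<Rightarrow> ('v \<Rightarrow> 'a) \<Rightarrow> ('i \<Rightarrow> 'a) \<Rightarrow> 'v \<Rightarrow> 'a"
  where "plug c \<rho> y v = (case c v of Some k \<Rightarrow> y k | None \<Rightarrow> \<rho> v)"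

lemma eval_plug_line:
  assumes "infinite T" "\<And>t. t \<in> T \<Longrightarrow> eval (plug c \<rho> (\<lambda>k. poly (q k) t)) g = 0"
  shows "eval (plug c \<rho> (\<lambda>k. poly (q k) t)) g = 0"
proof -
  have *: "plug c \<rho> (\<lambda>k. poly (q k) t) = (\<lambda>v. poly (plug c (\<lambda>v. [:\<rho> v:]) q v) t)" for t
    by (auto simp: plug_def split: option.splits)
  show ?thesis using eval_line[OF assms(1)] assms(2) unfolding * by blast
qed

text \<open>The set of translations preserving the solution set below contains all multiples of the vectors
  \<open>(t, t\<^sup>2, t\<^sup>3, \<dots>)\<close>. Dividing by \<open>t\<close> and letting \<open>t = 0\<close> gives the first unit vector;
  subtracting it and repeating the argument gives all unit vectors.\<close>

lemma eval_power_sums_zero: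
  fixes c :: "'v \<Rightarrow> nat option"
  assumes "\<And>ts. eval (plug c \<rho> (\<lambda>k. y k + (\<Sum>t\<leftarrow>ts. t ^ (k + 1)))) g = 0"
  shows "eval (plug c \<rho> y') g = 0"
proof -
  define Q where "Q z \<longleftrightarrow> eval (plug c \<rho> z) g = 0" for z
  \<comment> \<open>Z is the part of the zero set that survives all power sum translations; W is the
    monoid of all translations preserving Z.\<close>
  define Z where "Z = {z. \<forall>ts. Q (\<lambda>k. z k + (\<Sum>t\<leftarrow>ts. t ^ (k + 1)))}"
  define W where "W = {d. \<forall>z\<in>Z. (\<lambda>k. z k + d k) \<in> Z}"
  have line: "Q (\<lambda>k. poly (q k) t)" if "infinite T" "\<And>t. t \<in> T \<Longrightarrow> Q (\<lambda>k. poly (q k) t)" for q T t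
    using eval_plug_line[OF that(1)] that(2) unfolding Q_def by blast
  have yZ: "y \<in> Z" using assms by (simp add: Z_def Q_def)
  have Wadd: "(\<lambda>k. d k + d' k) \<in> W" if "d \<in> W" "d' \<in> W" for d d'
    using that by (force simp: W_def add.assoc[symmetric])
  have Wline: "(\<lambda>k. poly (q k) t) \<in> W" if T: "infinite T" "\<And>t. t \<in> T \<Longrightarrow> (\<lambda>k. poly (q k) t) \<in> W" for q T t
    unfolding W_def Z_def
  proof (intro CollectI ballI allI)
    fix z ts assume z: "z \<in> {z. \<forall>ts. Q (\<lambda>k. z k + (\<Sum>t\<leftarrow>ts. t ^ (k + 1)))}"
    have "Q (\<lambda>k. poly ([:z k + (\<Sum>t\<leftarrow>ts. t ^ (k + 1)):] + q k) t)"
    proof (rule line[OF T(1)])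
      fix t assume "t \<in> T"
      then have "(\<lambda>k. z k + poly (q k) t) \<in> Z" using T(2) z by (auto simp: W_def Z_def)
      then show "Q (\<lambda>k. poly ([:z k + (\<Sum>t\<leftarrow>ts. t ^ (k + 1)):] + q k) t)"
        by (simp add: Z_def add_ac)
    qed
    then show "Q (\<lambda>k. z k + poly (q k) t + (\<Sum>t\<leftarrow>ts. t ^ (k + 1)))"
      by (simp add: add_ac)
  qed
  have W1: "(\<lambda>k. l * t ^ (k + 1)) \<in> W" for l t
  proof -
    \<comment> \<open>Natural multiples come from repeating t. A vanishing statement for all natural
      multipliers then extends to every rational one.\<close>
    have nat: "(\<lambda>k. of_nat n * t ^ (k + 1)) \<in> W" for n
      unfolding W_def Z_def
    proof (intro CollectI ballI allI)
      fix z ts assume z: "z \<in> {z. \<forall>ts. Q (\<lambda>k. z k + (\<Sum>t\<leftarrow>ts. t ^ (k + 1)))}"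
      then have "Q (\<lambda>k. z k + (\<Sum>t\<leftarrow>replicate n t @ ts. t ^ (k + 1)))" by blast
      then show "Q (\<lambda>k. z k + of_nat n * t ^ (k + 1) + (\<Sum>t\<leftarrow>ts. t ^ (k + 1)))"
        by (simp add: sum_list_replicate add_ac)
    qed
    have inf: "infinite (range (of_nat :: nat \<Rightarrow> rat))"
      by (simp add: finite_image_iff inj_of_nat)
    have "(\<lambda>k. poly [:0, t ^ (k + 1):] l) \<in> W"
      by (rule Wline[OF inf]) (use nat in auto)
    then show ?thesis by simp
  qed
  have Wpow: "(\<lambda>k. if k < K then 0 else l * t ^ (k - K)) \<in> W" for K l t
  proof (induction K arbitrary: l t)
    case 0
    have "(\<lambda>k. poly (Polynomial.monom l k) t) \<in> W"
    proof (rule Wline)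
      show "infinite (- {0 :: rat})" by (simp add: infinite_UNIV_char_0)
      fix t :: rat assume "t \<in> - {0}"
      then have "(\<lambda>k. poly (Polynomial.monom l k) t) = (\<lambda>k. l / t * t ^ (k + 1))"
        by (auto simp: poly_monom)
      then show "(\<lambda>k. poly (Polynomial.monom l k) t) \<in> W" by (simp only: W1)
    qed
    then show ?case by (simp add: poly_monom)
  next
    case (Suc K)
    let ?q = "\<lambda>k. if k < Suc K then 0 else Polynomial.monom l (k - Suc K)"
    have "(\<lambda>k. poly (?q k) t) \<in> W"
    proof (rule Wline)
      show "infinite (- {0 :: rat})" by (simp add: infinite_UNIV_char_0)
      fix t :: rat assume t: "t \<in> - {0}"
      \<comment> \<open>\<open>0 ^ (k - K)\<close> is 1 at k = K and 0 beyond, so the second summand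
        removes the leading entry; the factor 1/t lowers the remaining exponents by one.\<close>
      have "(\<lambda>k. poly (?q k) t) =
        (\<lambda>k. (if k < K then 0 else l / t * t ^ (k - K)) + (if k < K then 0 else - l / t * 0 ^ (k - K)))"
      proof
        fix k
        show "poly (?q k) t =
          (if k < K then 0 else l / t * t ^ (k - K)) + (if k < K then 0 else - l / t * 0 ^ (k - K))"
        proof (cases "k \<le> K")
          case True
          then show ?thesis using t by (cases "k = K") auto
        next
          case False
          then have "k - K = Suc (k - Suc K)" by simp
          then show ?thesis using False t by (simp add: poly_monom)
        qed
      qed
      then show "(\<lambda>k. poly (?q k) t) \<in> W" using Wadd[OF Suc Suc] by simp
    qed
    moreover have "(\<lambda>k. poly (?q k) t) = (\<lambda>k. if k < Suc K then 0 else l * t ^ (k - Suc K))"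
      by (auto simp: poly_monom)
    ultimately show ?case by simp
  qed
  have Wfin: "(\<lambda>k. if k < K then d k else 0) \<in> W" for K d
  proof (induction K)
    case 0
    then show ?case by (simp add: W_def)
  next
    case (Suc K)
    have "(\<lambda>k. if k < Suc K then d k else 0) =
      (\<lambda>k. (if k < K then d k else 0) + (if k < K then 0 else d K * 0 ^ (k - K)))"
      by (auto simp: power_0_left less_Suc_eq)
    then show ?case using Wadd[OF Suc Wpow] by simp
  qed
  \<comment> \<open>Only coordinates below K occur in g, so a translation with finitely many nonzero
    entries leads from y to the effective part of y'.\<close>
  define K where "K = Suc (Max (insert 0 ((\<lambda>v. case c v of Some k \<Rightarrow> k | None \<Rightarrow> 0) ` vars g)))"
  have K: "k < K" if "v \<in> vars g" "c v = Some k" for v k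
  proof -
    have "k \<in> insert 0 ((\<lambda>v. case c v of Some k \<Rightarrow> k | None \<Rightarrow> 0) ` vars g)"
      using that by (force simp: image_iff)
    then show ?thesis unfolding K_def less_Suc_eq_le by (intro Max_ge) auto
  qed
  have "(\<lambda>k. y k + (if k < K then y' k - y k else 0)) \<in> Z"
    using Wfin[of K "\<lambda>k. y' k - y k"] yZ by (simp add: W_def)
  then have "Q (\<lambda>k. y k + (if k < K then y' k - y k else 0) + (\<Sum>t\<leftarrow>[]. t ^ (k + 1)))"
    unfolding Z_def by blast
  moreover have "eval (plug c \<rho> (\<lambda>k. y k + (if k < K then y' k - y k else 0) + (\<Sum>t\<leftarrow>[]. t ^ (k + 1)))) g
      = eval (plug c \<rho> y') g"
    by (rule eval_cong) (auto simp: plug_def K split: option.splits)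
  ultimately show ?thesis by (simp only: Q_def)
qed

text \<open>A polynomial does not involve the variables of large index; by symmetry it involves none of those
  that adjacent transpositions move to arbitrarily large index.\<close>

lemma eval_symmetric_const:
  fixes c :: "'v \<Rightarrow> int option"
  assumes sym: "\<And>x i. i \<noteq> 0 \<Longrightarrow> eval (plug c \<rho> (\<lambda>j. x (s i \<langle>$\<rangle> j))) g = eval (plug c \<rho> x) g"
  shows "eval (plug c \<rho> x) g = eval (plug c \<rho> x') g"
proof -
  define E where "E x = eval (plug c \<rho> x) g" for x
  define N where "N = Max (insert 0 ((\<lambda>v. case c v of Some k \<Rightarrow> \<bar>k\<bar> | None \<Rightarrow> 0) ` vars g))"
  have N: "\<bar>k\<bar> \<le> N" if "v \<in> vars g" "c v = Some k" for v k
  proof -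
    have "\<bar>k\<bar> \<in> insert 0 ((\<lambda>v. case c v of Some k \<Rightarrow> \<bar>k\<bar> | None \<Rightarrow> 0) ` vars g)"
      using that by (force simp: image_iff)
    then show ?thesis unfolding N_def by (intro Max_ge) auto
  qed
  have cong: "E x = E x'" if "\<And>j. \<bar>j\<bar> \<le> N \<Longrightarrow> x j = x' j" for x x'
    unfolding E_def by (rule eval_cong) (auto simp: plug_def intro: that dest: N split: option.splits)
  have swap: "E (\<lambda>j. x (s i \<langle>$\<rangle> j)) = E x" if "i \<noteq> 0" for i x
    using sym that by (simp add: E_def)
  \<comment> \<open>As s_0 is excluded, coordinates j \<ge> 1 are pushed upward and coordinates j
    \<le> 0 downward until g no longer involves them.\<close>
  have pos: "1 \<le> j \<Longrightarrow> E (x(j := t)) = E x" for j t x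
  proof (induction j arbitrary: x rule: downward_induct[of N])
    case (above j)
    then show ?case by (intro cong) auto
  next
    case (step j)
    have "E (x(j := t)) = E (\<lambda>i. (x(j := t)) (s j \<langle>$\<rangle> i))"
      using step by (intro swap[symmetric]) simp
    also have "(\<lambda>i. (x(j := t)) (s j \<langle>$\<rangle> i)) = (\<lambda>i. x (s j \<langle>$\<rangle> i))(j + 1 := t)"
      by (auto simp: apply_s fun_eq_iff)
    also have "E \<dots> = E (\<lambda>i. x (s j \<langle>$\<rangle> i))" by (rule step(2)) (use step(3) in simp)
    also have "\<dots> = E x" using step by (intro swap) simp
    finally show ?case .
  qed
  have nonpos: "j \<le> 0 \<Longrightarrow> E (x(j := t)) = E x" for j t x
  proof (induction "nat (j + N + 1)" arbitrary: j x rule: less_induct)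
    case less
    show ?case
    proof (cases "j < - N")
      case True
      then show ?thesis using less by (intro cong) auto
    next
      case False
      have "E (x(j := t)) = E (\<lambda>i. (x(j := t)) (s (j - 1) \<langle>$\<rangle> i))"
        using less by (intro swap[symmetric]) simp
      also have "(\<lambda>i. (x(j := t)) (s (j - 1) \<langle>$\<rangle> i)) = (\<lambda>i. x (s (j - 1) \<langle>$\<rangle> i))(j - 1 := t)"
        by (auto simp: apply_s fun_eq_iff)
      also have "E \<dots> = E (\<lambda>i. x (s (j - 1) \<langle>$\<rangle> i))"
        by (rule less(1)) (use less(2) False in auto)
      also have "\<dots> = E x" using less by (intro swap) simp
      finally show ?thesis .
    qed
  qed
  have upd: "E (x(j := t)) = E x" for j t x
    using pos[of j] nonpos[of j] by (cases "1 \<le> j") auto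
  have "E (\<lambda>j. if j \<in> J then x' j else x j) = E x" if "finite J" for J
    using that
  proof (induction J)
    case (insert k J)
    have "(\<lambda>j. if j \<in> insert k J then x' j else x j) = (\<lambda>j. if j \<in> J then x' j else x j)(k := x' k)"
      by (auto simp: fun_eq_iff)
    then show ?case using insert upd by simp
  qed simp
  from this[of "{- N..N}"] have "E x = E (\<lambda>j. if j \<in> {- N..N} then x' j else x j)" by simp
  also have "\<dots> = E x'" by (rule cong) auto
  finally show ?thesis by (simp add: E_def)
qed

section \<open>Double Schubert polynomials\<close>

definition dschub :: "int \<Rightarrow> int \<Rightarrow> int perm \<Rightarrow> poly_xa"
  where "dschub p M w = coef (Sch p M (\<lambda>i. Var (X i)) (\<lambda>i. Var (A i))) w"

lemma rhom_swap_x: "rhom (swap_x i)"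
  by (simp add: swap_x_def rhom_subst)

lemma rhom_dschub:
  "rhom f \<Longrightarrow> f (dschub p M w) = coef (Sch p M (\<lambda>i. f (Var (X i))) (\<lambda>i. f (Var (A i)))) w"
  unfolding dschub_def by (rule rhom_coef_Sch)

lemma dschub_swap:
  assumes "p \<le> i" "i \<le> M"
  shows "dschub p M w - swap_x i (dschub p M w) =
    (Var (X i) - Var (X (i + 1))) * (if len (w * s i) < len w then dschub p M (w * s i) else 0)"
proof -
  have "swap_x i (dschub p M w) = coef (Sch p M (\<lambda>j. Var (X (s i \<langle>$\<rangle> j))) (\<lambda>j. Var (A j))) w"
    by (simp add: rhom_dschub[OF rhom_swap_x]) (simp add: swap_x_def subst_Var)
  then have "dschub p M w - swap_x i (dschub p M w) = coef (Sch p M (\<lambda>j. Var (X j)) (\<lambda>j. Var (A j))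
      - Sch p M (\<lambda>j. Var (X (s i \<langle>$\<rangle> j))) (\<lambda>j. Var (A j))) w"
    by (simp add: dschub_def)
  also have "\<dots> = (Var (X i) - Var (X (i + 1))) * coef (Sch p M (\<lambda>j. Var (X j)) (\<lambda>j. Var (A j)) * gen i) w"
    using Sch_swap[OF assms, of "\<lambda>j. Var (X j)" "\<lambda>j. Var (A j)"] by simp
  finally show ?thesis by (simp add: coef_mult_gen dschub_def)
qed

lemma divdiff_eqI:
  assumes "f - swap_x i f = (Var (X i) - Var (X (i + 1))) * g"
  shows "divdiff i f = g"
  unfolding divdiff_def
proof (rule the_equality)
  show "h = g" if "(Var (X i) - Var (X (i + 1))) * h = f - swap_x i f" for h
    using that assms Var_diff_mult_cancel[of "X i" "X (i + 1)" h g] by simp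
qed (use assms in simp)

lemma dschub_upper: "M \<le> M' \<Longrightarrow> supported p M w \<Longrightarrow> dschub p M' w = dschub p M w"
  by (simp add: dschub_def coef_Sch_upper)

lemma double_schubert_sound:
  "double_schubert n v f \<Longrightarrow> supported 1 (int n - 1) v \<and> f = dschub 1 (int n - 1) v"
proof (induction rule: double_schubert.induct)
  case longest
  then show ?case by (simp add: supported_w0 dschub_def coef_Sch_w0)
next
  case (divided v i f)
  have i: "supported 1 (int n - 1) (s i)" using divided by simp
  have "supported 1 (int n - 1) v"
    using divided supported_mult[OF _ i, of "v * s i"] by simp
  moreover have "divdiff i f = dschub 1 (int n - 1) v"
    using divided dschub_swap[of 1 i "int n - 1" "v * s i"] by (intro divdiff_eqI) simp
  ultimately show ?case by simp
qed

lemma double_schubert_exists: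
  "supported 1 (int n - 1) v \<Longrightarrow> \<exists>f. double_schubert n v f"
proof (induction "len (w0 n) - len v" arbitrary: v rule: less_induct)
  case less
  show ?case
  proof (cases "v = w0 n")
    case True
    then show ?thesis using double_schubert.longest by blast
  next
    case False
    then obtain i where i: "1 \<le> i" "i < int n" "\<not> v \<langle>$\<rangle> (i + 1) < v \<langle>$\<rangle> i"
      using descents_w0[OF less.prems] by blast
    have len: "len (v * s i) = Suc (len v)" using len_ascent[of v i] not_descent_iff[of v i] i by simp
    have supp: "supported 1 (int n - 1) (v * s i)" using less.prems i by (intro supported_mult) auto
    then have "len (w0 n) - len (v * s i) < len (w0 n) - len v" using len_le_w0[OF supp] len by simp
    then obtain f where "double_schubert n (v * s i) f" using less.hyps supp by blast
    then show ?thesis using double_schubert.divided i len by (metis lessI)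
  qed
qed

text \<open>The values for different n agree by stability, compared at the larger upper end, so the
  definite description is meaningful.\<close>

lemma schubert_plus_eq:
  assumes "supported 1 M v" "0 \<le> M"
  shows "schubert_plus v = dschub 1 M v"
  unfolding schubert_plus_def
proof (rule the_equality)
  have M: "int (nat (M + 1)) - 1 = M" using assms(2) by simp
  obtain f where f: "double_schubert (nat (M + 1)) v f"
    using double_schubert_exists[of "nat (M + 1)" v] assms(1) unfolding M by blast
  with double_schubert_sound[OF f] show "\<exists>n. double_schubert n v (dschub 1 M v)"
    unfolding M by blast
  fix g assume "\<exists>n. double_schubert n v g"
  then obtain n where "supported 1 (int n - 1) v" "g = dschub 1 (int n - 1) v"
    using double_schubert_sound by blast
  then show "g = dschub 1 M v"
    using dschub_upper[of M "max M (int n - 1)" 1 v] dschub_upper[of "int n - 1" "max M (int n - 1)" 1 v]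
      assms(1) by simp
qed

text \<open>Shifting back turns the lower end 1 into p: the back stable limit just lowers the first
  index of the product.\<close>

lemma shift_schubert_plus:
  assumes "supported p M w" "p \<le> M + 1"
  shows "shift_poly (p - 1) (schubert_plus (shift_perm (1 - p) w)) = dschub p M w"
proof -
  have "supported 1 (M + (1 - p)) (shift_perm (1 - p) w)"
    using supported_shift[of p "1 - p" M w] assms(1) by simp
  then have "schubert_plus (shift_perm (1 - p) w) = dschub 1 (M + (1 - p)) (shift_perm (1 - p) w)"
    using assms(2) by (intro schubert_plus_eq) auto
  also have "shift_poly (p - 1) \<dots> = coef (Sch 1 (M + (1 - p)) (\<lambda>i. Var (X (i + (p - 1)))) (\<lambda>i. Var (A (i + (p - 1))))) (shift_perm (1 - p) w)"
    unfolding shift_poly_def by (simp add: rhom_dschub[OF rhom_subst] subst_Var)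
  also have "\<dots> = coef (shift_nil (1 - p) (Sch 1 (M + (1 - p)) (\<lambda>i. Var (X (i + (p - 1)))) (\<lambda>i. Var (A (i + (p - 1)))))) w"
    by simp
  also have "\<dots> = dschub p M w"
    unfolding shift_nil_Sch dschub_def by (simp add: algebra_simps)
  finally show ?thesis .
qed

section \<open>Schubert polynomials of S_nonzero\<close>

lemma S_plus_fixes: "u \<in> S_plus \<Longrightarrow> i \<le> 0 \<Longrightarrow> u \<langle>$\<rangle> i = i"
  using supportedD[of 1 _ u i] by (auto simp: S_plus_iff)

lemma S_minus_fixes:
  assumes "u \<in> S_minus" "1 \<le> i"
  shows "u \<langle>$\<rangle> i = i"
  using S_plus_fixes[of "omega_perm u" "1 - i"] assms by (simp add: S_minus_iff omega_perm_apply)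

lemma S_minus_nonpos: "u \<in> S_minus \<Longrightarrow> i \<le> 0 \<Longrightarrow> u \<langle>$\<rangle> i \<le> 0"
  using S_minus_fixes[of u "u \<langle>$\<rangle> i"] apply_inj[of u "u \<langle>$\<rangle> i" i] by linarith

lemma S_plus_minus_apply:
  assumes "u \<in> S_plus" "v \<in> S_minus"
  shows "(u * v) \<langle>$\<rangle> i = (if 1 \<le> i then u \<langle>$\<rangle> i else v \<langle>$\<rangle> i)"
  using S_minus_fixes[OF assms(2), of i] S_minus_nonpos[OF assms(2), of i]
    S_plus_fixes[OF assms(1), of "v \<langle>$\<rangle> i"] by (auto simp: apply_mult)

lemma S_plus_minus_unique:
  assumes "u \<in> S_plus" "v \<in> S_minus" "u' \<in> S_plus" "v' \<in> S_minus" "u * v = u' * v'"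
  shows "u = u' \<and> v = v'"
proof
  have eq: "(if 1 \<le> i then u \<langle>$\<rangle> i else v \<langle>$\<rangle> i) = (if 1 \<le> i then u' \<langle>$\<rangle> i else v' \<langle>$\<rangle> i)" for i
    using assms S_plus_minus_apply by metis
  show "u = u'"
  proof (rule perm_eqI)
    fix i show "u \<langle>$\<rangle> i = u' \<langle>$\<rangle> i"
      using eq[of i] S_plus_fixes assms by (cases "1 \<le> i") auto
  qed
  show "v = v'"
  proof (rule perm_eqI)
    fix i show "v \<langle>$\<rangle> i = v' \<langle>$\<rangle> i"
      using eq[of i] S_minus_fixes assms by (cases "1 \<le> i") auto
  qed
qed

lemma one_S_plus [simp]: "1 \<in> S_plus"
  using supported_1 by (auto simp: S_plus_iff)

lemma one_S_minus [simp]: "1 \<in> S_minus"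
  by (simp add: S_minus_iff)

lemma S_plus_mult_s: "u \<in> S_plus \<Longrightarrow> 1 \<le> i \<Longrightarrow> u * s i \<in> S_plus"
  by (force simp: S_plus_def generated_def intro: exI[of _ "_ @ [i]"])

lemma S_minus_mult_s: "u \<in> S_minus \<Longrightarrow> i \<le> -1 \<Longrightarrow> u * s i \<in> S_minus"
  using S_plus_mult_s[of "omega_perm u" "- i"] by (simp add: S_minus_iff omega_perm_mult omega_perm_s)

lemma S_minus_commute_s: "v \<in> S_minus \<Longrightarrow> 1 \<le> i \<Longrightarrow> v * s i = s i * v"
proof (rule perm_eqI)
  fix j assume "v \<in> S_minus" "1 \<le> i"
  then show "(v * s i) \<langle>$\<rangle> j = (s i * v) \<langle>$\<rangle> j"
    using S_minus_fixes[of v j] S_minus_fixes[of v i] S_minus_fixes[of v "i + 1"] S_minus_nonpos[of v j]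
    by (cases "1 \<le> j") (auto simp: apply_mult apply_s)
qed

lemma S_nonzero_mult_s:
  assumes "v \<in> S_nonzero" "i \<noteq> 0"
  shows "v * s i \<in> S_nonzero"
proof -
  obtain u u' where v: "u \<in> S_plus" "u' \<in> S_minus" "v = u * u'"
    using assms(1) by (auto simp: S_nonzero_def)
  show ?thesis
  proof (cases "1 \<le> i")
    case True
    then have "v * s i = (u * s i) * u'" using v S_minus_commute_s[of u' i] by (simp add: mult.assoc)
    then show ?thesis using S_plus_mult_s[OF v(1) True] v(2) unfolding S_nonzero_def by blast
  next
    case False
    then have "i \<le> -1" using assms(2) by simp
    then have "u' * s i \<in> S_minus" using v(2) by (rule S_minus_mult_s[rotated])
    then show ?thesis using v unfolding S_nonzero_def by (auto simp: mult.assoc)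
  qed
qed

lemma S_nonzero_mult_s_iff: "i \<noteq> 0 \<Longrightarrow> v * s i \<in> S_nonzero \<longleftrightarrow> v \<in> S_nonzero"
  using S_nonzero_mult_s[of v i] S_nonzero_mult_s[of "v * s i" i] by auto

lemma one_S_nonzero [simp]: "1 \<in> S_nonzero"
  by (auto simp: S_nonzero_def intro!: exI[of _ 1])

lemma schubert_eq:
  assumes "u \<in> S_plus" "v \<in> S_minus"
  shows "schubert (u * v) = schubert_plus u * omega_poly (schubert_plus (omega_perm v))"
  unfolding schubert_def
  by (rule the_equality) (use assms S_plus_minus_unique in blast)+

lemma S_plus_bound: "u \<in> S_plus \<Longrightarrow> \<exists>M\<ge>q. 0 \<le> M \<and> supported 1 M u"
proof -
  assume "u \<in> S_plus"
  then obtain M where "0 \<le> M" "supported 1 M u" by (auto simp: S_plus_iff)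
  then show ?thesis using supported_mono[of 1 M u 1 "max M q"] by (intro exI[of _ "max M q"]) auto
qed

lemma schubert_plus_swap:
  assumes "u \<in> S_plus" "1 \<le> i"
  shows "schubert_plus u - swap_x i (schubert_plus u) =
    (Var (X i) - Var (X (i + 1))) * (if len (u * s i) < len u then schubert_plus (u * s i) else 0)"
proof -
  obtain M where M: "i \<le> M" "0 \<le> M" "supported 1 M u" using S_plus_bound[OF assms(1)] by blast
  then have "supported 1 M (u * s i)" using assms(2) by (intro supported_mult) auto
  then show ?thesis using dschub_swap[OF assms(2) M(1), of u] M by (simp add: schubert_plus_eq)
qed

text \<open>The generating product for \<open>S_plus\<close> involves only x_j with j \<ge>
  1.\<close>

lemma schubert_plus_swap_neg:
  assumes "u \<in> S_plus" "i \<le> -1"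
  shows "swap_x i (schubert_plus u) = schubert_plus u"
proof -
  obtain M where M: "0 \<le> M" "supported 1 M u" using S_plus_bound[OF assms(1)] by blast
  have "Phi 1 M (\<lambda>j. Var (X (s i \<langle>$\<rangle> j)) :: poly_xa) = Phi 1 M (\<lambda>j. Var (X j))"
    using assms(2) by (intro Phi_cong) (simp add: apply_s)
  then show ?thesis
    unfolding schubert_plus_eq[OF M(2,1)] rhom_dschub[OF rhom_swap_x]
    by (simp add: swap_x_def subst_Var dschub_def Sch_def)
qed

lemma rhom_omega_poly: "rhom omega_poly"
  by (simp add: omega_poly_def rhom_subst)

lemma omega_poly_swap: "omega_poly (swap_x i f) = swap_x (- i) (omega_poly f)"
proof (rule mpoly_eqI)
  fix \<rho> :: "xa \<Rightarrow> rat"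
  have "(\<lambda>v. eval (\<lambda>v. eval \<rho> (case v of X i \<Rightarrow> - Var (X (1 - i)) | A i \<Rightarrow> - Var (A (1 - i))))
      (case v of X j \<Rightarrow> Var (X (s i \<langle>$\<rangle> j)) | A j \<Rightarrow> Var (A j))) =
    (\<lambda>v. eval (\<lambda>v. eval \<rho> (case v of X j \<Rightarrow> Var (X (s (- i) \<langle>$\<rangle> j)) | A j \<Rightarrow> Var (A j)))
      (case v of X i \<Rightarrow> - Var (X (1 - i)) | A i \<Rightarrow> - Var (A (1 - i))))"
    by (rule ext) (auto simp: apply_s split: xa.split)
  then show "eval \<rho> (omega_poly (swap_x i f)) = eval \<rho> (swap_x (- i) (omega_poly f))"
    by (simp add: omega_poly_def swap_x_def)
qed

text \<open>According to its sign, i moves only one of the two factors, and the other passes through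
  the swap as a constant. Negative i are carried to positive ones by omega.\<close>

lemma schubert_swap:
  assumes "v \<in> S_nonzero" "i \<noteq> 0"
  shows "schubert v - swap_x i (schubert v) =
    (Var (X i) - Var (X (i + 1))) * (if len (v * s i) < len v then schubert (v * s i) else 0)"
proof -
  obtain u u' where v: "u \<in> S_plus" "u' \<in> S_minus" "v = u * u'"
    using assms(1) by (auto simp: S_nonzero_def)
  let ?F = "schubert_plus u" and ?G = "omega_poly (schubert_plus (omega_perm u'))"
  note swap = rhom_mult[OF rhom_swap_x]
  have \<omega>: "omega_perm u' \<in> S_plus" using v(2) by (simp add: S_minus_iff)
  show ?thesis
  proof (cases "1 \<le> i")
    case True
    have 1: "len (v * s i) < len v \<longleftrightarrow> len (u * s i) < len u"
      using S_plus_minus_apply[OF v(1,2)] True by (simp add: v(3) flip: descent_iff_len)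
    have 2: "schubert (v * s i) = schubert_plus (u * s i) * ?G"
      using S_minus_commute_s[OF v(2) True] schubert_eq[OF S_plus_mult_s[OF v(1) True] v(2)]
      by (simp add: v(3) mult.assoc)
    have "swap_x i ?G = ?G"
      using omega_poly_swap[of "- i" "schubert_plus (omega_perm u')"] schubert_plus_swap_neg[OF \<omega>, of "- i"] True by simp
    moreover have "schubert v - swap_x i (schubert v) = ?F * ?G - swap_x i ?F * swap_x i ?G"
      by (simp only: v(3) schubert_eq[OF v(1,2)] swap)
    ultimately have "schubert v - swap_x i (schubert v) = (?F - swap_x i ?F) * ?G"
      by (simp only: left_diff_distrib)
    also have "\<dots> = (Var (X i) - Var (X (i + 1))) * ((if len (u * s i) < len u then schubert_plus (u * s i) else 0) * ?G)"
      unfolding schubert_plus_swap[OF v(1) True] by (rule mult.assoc)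
    finally show ?thesis using 1 2 by simp
  next
    case False
    then have i: "i \<le> -1" using assms(2) by simp
    have "len (v * s i) < len v \<longleftrightarrow> len (u' * s i) < len u'"
      using S_plus_minus_apply[OF v(1,2)] i by (simp add: v(3) flip: descent_iff_len)
    also have "\<dots> \<longleftrightarrow> len (omega_perm u' * s (- i)) < len (omega_perm u')"
      using len_omega[of "u' * s i"] by (simp add: omega_perm_mult omega_perm_s len_omega)
    finally have 1: "len (v * s i) < len v \<longleftrightarrow> len (omega_perm u' * s (- i)) < len (omega_perm u')" .
    have 2: "schubert (v * s i) = ?F * omega_poly (schubert_plus (omega_perm u' * s (- i)))"
      using schubert_eq[OF v(1) S_minus_mult_s[OF v(2) i]]
      by (simp add: v(3) mult.assoc omega_perm_mult omega_perm_s)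
    have "?G - swap_x i ?G = omega_poly (schubert_plus (omega_perm u') - swap_x (- i) (schubert_plus (omega_perm u')))"
      using omega_poly_swap[of "- i"] by (simp add: rhom_diff[OF rhom_omega_poly])
    also have "\<dots> = (Var (X i) - Var (X (i + 1))) *
      (if len (v * s i) < len v then omega_poly (schubert_plus (omega_perm u' * s (- i))) else 0)"
    proof -
      \<comment> \<open>Two signs cancel: omega negates both variables and reverses their
        order.\<close>
      have "omega_poly (Var (X (- i)) - Var (X (- i + 1))) = Var (X i) - Var (X (i + 1))"
        unfolding rhom_diff[OF rhom_omega_poly] by (simp add: omega_poly_def subst_Var algebra_simps)
      then show ?thesis
        using schubert_plus_swap[OF \<omega>, of "- i"] i
        by (simp add: 1 rhom_mult[OF rhom_omega_poly] rhom_0[OF rhom_omega_poly])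
    qed
    finally have "?F * (?G - swap_x i ?G) = ?F * \<dots>" by simp
    then show ?thesis using schubert_plus_swap_neg[OF v(1) i]
      by (simp add: swap v(3) schubert_eq[OF v(1,2)] right_diff_distrib 2[unfolded v(3)] mult.left_commute)
  qed
qed

text \<open>At x = a the generating element is 1. The homomorphism is kept general because it is
  used both directly and composed with \<open>omega_poly\<close>.\<close>

lemma rhom_schubert_plus_same:
  fixes f :: "poly_xa \<Rightarrow> 'b::comm_ring_1"
  assumes "rhom f" "\<And>i. f (Var (X i)) = f (Var (A i))" "u \<in> S_plus"
  shows "f (schubert_plus u) = (if u = 1 then 1 else 0)"
proof -
  obtain M where M: "0 \<le> M" "supported 1 M u" using S_plus_bound[OF assms(3)] by blast
  show ?thesis unfolding schubert_plus_eq[OF M(2,1)] rhom_dschub[OF assms(1)] assms(2)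
    by (simp add: coef_1)
qed

lemma rhom_schubert_same:
  fixes f :: "poly_xa \<Rightarrow> 'b::comm_ring_1"
  assumes "rhom f" "\<And>i. f (Var (X i)) = f (Var (A i))" "v \<in> S_nonzero"
  shows "f (schubert v) = (if v = 1 then 1 else 0)"
proof -
  obtain u u' where v: "u \<in> S_plus" "u' \<in> S_minus" "v = u * u'"
    using assms(3) by (auto simp: S_nonzero_def)
  have \<omega>: "rhom (\<lambda>x. f (omega_poly x))" by (rule rhom_comp[OF assms(1) rhom_omega_poly])
  have "f (omega_poly (schubert_plus (omega_perm u'))) = (if omega_perm u' = 1 then 1 else 0)"
    using v(2) by (intro rhom_schubert_plus_same[OF \<omega>])
      (simp_all add: S_minus_iff omega_poly_def subst_Var rhom_uminus[OF assms(1)] assms(2))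
  moreover have "omega_perm u' = 1 \<longleftrightarrow> u' = 1" using omega_omega[of u'] omega_perm_1 by metis
  moreover have "v = 1 \<longleftrightarrow> u = 1 \<and> u' = 1"
    using S_plus_minus_unique[OF v(1,2) one_S_plus one_S_minus] v(3) by auto
  ultimately show ?thesis
    using rhom_schubert_plus_same[OF assms(1,2) v(1)]
    by (simp add: v(3) schubert_eq[OF v(1,2)] rhom_mult[OF assms(1)])
qed

section \<open>Back stable limits\<close>

lemma mon_Var: "mon Var m = Poly_Mapping.single m 1"
proof (rule mpoly_eqI)
  fix \<rho> :: "'a \<Rightarrow> rat"
  have "eval \<rho> (mon Var m) = mon \<rho> m"
    unfolding mon_def rhom_prod[OF rhom_eval] by simp
  also have "\<dots> = eval \<rho> (Poly_Mapping.single m 1)"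
    using meval_single[OF rhom_id, of \<rho> m 1] by (simp add: eval_def)
  finally show "eval \<rho> (mon Var m) = eval \<rho> (Poly_Mapping.single m 1)" .
qed

text \<open>Selects the monomials in the variables of S, and so turns claims about coefficients into
  claims about substitutions.\<close>

definition zero_outside :: "'v set \<Rightarrow> 'v mpoly \<Rightarrow> 'v mpoly"
  where "zero_outside S = subst (\<lambda>v. if v \<in> S then Var v else 0)"

lemma lookup_zero_outside:
  "Poly_Mapping.lookup (zero_outside S f) m =
    (if Poly_Mapping.keys m \<subseteq> S then Poly_Mapping.lookup f m else 0)"
proof -
  let ?l = "Poly_Mapping.lookup"
  have "mon (\<lambda>v. if v \<in> S then Var v else 0) n =
      (if Poly_Mapping.keys n \<subseteq> S then Poly_Mapping.single n 1 else 0)" for n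
  proof (cases "Poly_Mapping.keys n \<subseteq> S")
    case True
    then have "mon (\<lambda>v. if v \<in> S then Var v else 0) n = mon Var n"
      unfolding mon_def by (intro prod.cong) auto
    then show ?thesis using True by (simp add: mon_Var)
  next
    case False
    then obtain v where "v \<in> Poly_Mapping.keys n" "v \<notin> S" by blast
    then have "mon (\<lambda>v. if v \<in> S then Var v else 0) n = 0"
      unfolding mon_def by (intro prod_zero) (auto simp: in_keys_iff power_0_left intro!: bexI[of _ v])
    then show ?thesis using False by simp
  qed
  then have "zero_outside S f = (\<Sum>n\<in>Poly_Mapping.keys f.
      if Poly_Mapping.keys n \<subseteq> S then Poly_Mapping.single n (?l f n) else 0)"
    unfolding zero_outside_def subst_eq_meval meval_def
    by (intro sum.cong) (simp_all add: Const_def mult_single)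
  then have "?l (zero_outside S f) m = (\<Sum>n\<in>Poly_Mapping.keys f.
      if n = m then (if Poly_Mapping.keys m \<subseteq> S then ?l f m else 0) else 0)"
    by (simp only: lookup_sum) (intro sum.cong, auto simp: lookup_single when_def)
  then show ?thesis by (simp add: sum.delta in_keys_iff)
qed

definition index :: "xa \<Rightarrow> int"
  where "index v = (case v of X i \<Rightarrow> i | A i \<Rightarrow> i)"

lemma index_simps [simp]: "index (X i) = i" "index (A i) = i"
  by (simp_all add: index_def)

lemma index_bound: "finite S \<Longrightarrow> \<exists>r\<le>q. \<forall>z\<in>S. r \<le> index z"
proof (induction S rule: finite_induct)
  case (insert z S)
  then obtain r where "r \<le> q" "\<forall>z\<in>S. r \<le> index z" by blast
  then show ?case by (intro exI[of _ "min r (index z)"]) auto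
qed auto

lemma base_index_bound: "\<exists>r\<le>q. \<forall>z. Base z \<in> vars f \<longrightarrow> r \<le> index z"
proof -
  have "finite (Base -` vars f)" by (intro finite_vimageI) (auto simp: inj_def)
  from index_bound[OF this, of q] show ?thesis by auto
qed

lemma rhom_truncate: "rhom (truncate p)"
  by (simp add: truncate_def rhom_subst)

text \<open>The terms lost between p and q are positive powers of 0. Hence each coefficient of the
  truncations is eventually constant.\<close>

lemma zero_outside_truncate:
  assumes "p \<le> q" "\<And>z. Base z \<in> vars f \<Longrightarrow> q \<le> index z"
  shows "zero_outside {z. q \<le> index z} (truncate p f) = truncate q f"
proof (rule mpoly_eqI)
  fix \<rho> :: "xa \<Rightarrow> rat"
  let ?\<rho> = "\<lambda>z. eval \<rho> (if q \<le> index z then Var z else 0)"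
  have sums: "(\<Sum>i\<in>{p..0}. ?\<rho> (X i) ^ (k + 1) - ?\<rho> (A i) ^ (k + 1)) =
      (\<Sum>i\<in>{q..0}. \<rho> (X i) ^ (k + 1) - \<rho> (A i) ^ (k + 1))" for k
    using assms(1) by (intro sum.mono_neutral_cong_right) auto
  show "eval \<rho> (zero_outside {z. q \<le> index z} (truncate p f)) = eval \<rho> (truncate q f)"
    unfolding zero_outside_def truncate_def eval_subst
    by (rule eval_cong) (use assms(2) sums in \<open>auto split: lam.split\<close>)
qed

lemma lookup_truncate:
  assumes "p \<le> q" "\<And>z. Base z \<in> vars f \<Longrightarrow> q \<le> index z" "\<And>z. z \<in> Poly_Mapping.keys m \<Longrightarrow> q \<le> index z"
  shows "Poly_Mapping.lookup (truncate p f) m = Poly_Mapping.lookup (truncate q f) m"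
proof -
  have "Poly_Mapping.keys m \<subseteq> {z. q \<le> index z}" using assms(3) by blast
  then show ?thesis
    using lookup_zero_outside[of "{z. q \<le> index z}" "truncate p f" m] zero_outside_truncate[OF assms(1,2)]
    by simp
qed

lemma denotes_exists: "\<exists>L. denotes f L"
proof -
  obtain r where r: "r \<le> 0" "\<forall>z. Base z \<in> vars f \<longrightarrow> r \<le> index z" using base_index_bound by blast
  have "\<exists>l. \<forall>\<^sub>F p in at_bot. Poly_Mapping.lookup (truncate p f) m = l" for m
  proof -
    obtain q where "q \<le> r" "\<forall>z\<in>Poly_Mapping.keys m. q \<le> index z" using index_bound[OF finite_keys] by blast
    then have "Poly_Mapping.lookup (truncate p f) m = Poly_Mapping.lookup (truncate q f) m" if "p \<le> q" for p
      using r that by (intro lookup_truncate) force+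
    then show ?thesis unfolding eventually_at_bot_linorder by blast
  qed
  then show ?thesis unfolding denotes_def has_limit_def by metis
qed

text \<open>This is the algebraic independence of the p_k over Q[x,a]. No x_i or a_i with i < q
  occurs in f by itself, so the values of x_i for p \<le> i < q are free and translate the p_k by
  arbitrary power sums.\<close>

lemma truncate_eq_0_imp_eq_0:
  assumes "\<And>p. p \<le> r \<Longrightarrow> truncate p f = 0"
  shows "f = 0"
proof (rule eval_eq_0_imp_eq_0)
  fix \<rho> :: "xa lam \<Rightarrow> rat"
  let ?c = "\<lambda>v :: xa lam. case v of P k \<Rightarrow> Some k | Base z \<Rightarrow> None"
  obtain q where q: "q \<le> min r 0" "\<forall>z. Base z \<in> vars f \<longrightarrow> q \<le> index z"
    using base_index_bound by blast
  let ?y = "\<lambda>k. \<Sum>i\<in>{q..0}. \<rho> (Base (X i)) ^ (k + 1) - \<rho> (Base (A i)) ^ (k + 1)"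
  have "eval (plug ?c \<rho> (\<lambda>k. ?y k + (\<Sum>t\<leftarrow>ts. t ^ (k + 1)))) f = 0" for ts
  proof -
    define p where "p = q - int (length ts)"
    \<comment> \<open>Below q the x_i run through \<open>ts\<close> and the a_i are 0; p leaves room
      for exactly \<open>length ts\<close> variables.\<close>
    define \<sigma> where "\<sigma> z = (if q \<le> index z then \<rho> (Base z) else
      case z of X i \<Rightarrow> if p \<le> i then ts ! nat (i - p) else 0 | A i \<Rightarrow> 0)" for z
    have "(\<Sum>i\<in>{p..0}. \<sigma> (X i) ^ (k + 1) - \<sigma> (A i) ^ (k + 1)) = ?y k + (\<Sum>t\<leftarrow>ts. t ^ (k + 1))" for k
    proof -
      have "{p..0} = {q..0} \<union> {p..<q}" using q(1) by (auto simp: p_def)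
      then have "(\<Sum>i\<in>{p..0}. \<sigma> (X i) ^ (k + 1) - \<sigma> (A i) ^ (k + 1)) =
        (\<Sum>i\<in>{q..0}. \<sigma> (X i) ^ (k + 1) - \<sigma> (A i) ^ (k + 1)) +
        (\<Sum>i\<in>{p..<q}. \<sigma> (X i) ^ (k + 1) - \<sigma> (A i) ^ (k + 1))"
        by (simp only:) (rule sum.union_disjoint, auto)
      also have "(\<Sum>i\<in>{q..0}. \<sigma> (X i) ^ (k + 1) - \<sigma> (A i) ^ (k + 1)) = ?y k"
        by (rule sum.cong) (auto simp: \<sigma>_def)
      also have "(\<Sum>i\<in>{p..<q}. \<sigma> (X i) ^ (k + 1) - \<sigma> (A i) ^ (k + 1)) = (\<Sum>i\<in>{p..<q}. (ts ! nat (i - p)) ^ (k + 1))"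
        by (rule sum.cong) (auto simp: \<sigma>_def)
      also have "\<dots> = (\<Sum>n\<in>{0..<length ts}. (ts ! n) ^ (k + 1))"
        by (rule sum.reindex_bij_witness[where i = "\<lambda>n. int n + p" and j = "\<lambda>i. nat (i - p)"])
          (auto simp: p_def)
      also have "\<dots> = (\<Sum>t\<leftarrow>ts. t ^ (k + 1))" by (simp add: sum_list_sum_nth)
      finally show ?thesis .
    qed
    then have "eval (plug ?c \<rho> (\<lambda>k. ?y k + (\<Sum>t\<leftarrow>ts. t ^ (k + 1)))) f = eval \<sigma> (truncate p f)"
      unfolding truncate_def eval_subst
      by (intro eval_cong) (use q(2) in \<open>auto simp: plug_def \<sigma>_def split: lam.split\<close>)
    also have "truncate p f = 0" using assms q(1) by (simp add: p_def)
    finally show ?thesis by simp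
  qed
  from eval_power_sums_zero[OF this, of "\<lambda>k. \<rho> (P k)"]
  have "eval (plug ?c \<rho> (\<lambda>k. \<rho> (P k))) f = 0" .
  moreover have "plug ?c \<rho> (\<lambda>k. \<rho> (P k)) = \<rho>" by (auto simp: plug_def fun_eq_iff split: lam.split)
  ultimately show "eval \<rho> f = 0" by simp
qed

text \<open>Equal limits give equal truncations: at a monomial with all indices at least q the
  coefficient of \<open>truncate q\<close> already equals the limit, and at any other monomial it is
  0.\<close>

lemma denotes_unique:
  assumes "denotes f L" "denotes g L"
  shows "f = g"
proof -
  obtain r where r: "r \<le> 0" "\<forall>z. Base z \<in> vars (f - g) \<longrightarrow> r \<le> index z" using base_index_bound by blast
  have "truncate q (f - g) = 0" if "q \<le> r" for q
  proof (rule poly_mapping_eqI)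
    fix m
    have q: "q \<le> index z" if "Base z \<in> vars (f - g)" for z using that r \<open>q \<le> r\<close> by force
    show "Poly_Mapping.lookup (truncate q (f - g)) m = Poly_Mapping.lookup 0 m"
    proof (cases "Poly_Mapping.keys m \<subseteq> {z. q \<le> index z}")
      case True
      have "\<forall>\<^sub>F p in at_bot. Poly_Mapping.lookup (truncate p (f - g)) m = 0"
        using assms unfolding denotes_def has_limit_def rhom_diff[OF rhom_truncate] lookup_minus
        by (elim allE[of _ m]) (erule (1) eventually_elim2, simp)
      then obtain N where "\<forall>p\<le>N. Poly_Mapping.lookup (truncate p (f - g)) m = 0"
        by (auto simp: eventually_at_bot_linorder)
      then have "Poly_Mapping.lookup (truncate (min N q) (f - g)) m = 0" by simp
      then show ?thesis using lookup_truncate[of "min N q" q "f - g" m] q True by auto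
    next
      case False
      then show ?thesis
        using lookup_zero_outside[of "{z. q \<le> index z}" "truncate q (f - g)" m]
          zero_outside_truncate[of q q "f - g"] q by simp
    qed
  qed
  then have "f - g = 0" by (rule truncate_eq_0_imp_eq_0)
  then show ?thesis by simp
qed

section \<open>Exponential form\<close>

text \<open>The logarithmic derivative of a row, with the Euler derivation as derivative.\<close>

definition logd :: "int \<Rightarrow> int \<Rightarrow> 'a::comm_ring_1 \<Rightarrow> 'a nilcox"
  where "logd M m t = euler (hfun M m t) * hinv M m t"

lemma scale_nil_lin: "scale_nil t (lin c j) = lin (t * c) j"
proof -
  have "scal c * (scal t * gen j) = scal (t * c) * gen j"
    by (simp add: mult.commute[of t c] mult.assoc rhom_mult[OF rhom_scal])
  then show ?thesis
    by (simp add: lin_def rhom_1[OF rhom_scale_nil] rhom_add[OF rhom_scale_nil]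
      rhom_mult[OF rhom_scale_nil] scale_nil_scal scale_nil_gen)
qed

lemma scale_nil_hfun: "scale_nil t (hfun M m 1) = hfun M m t"
  by (simp add: hfun_def rhom_prod_list[OF rhom_scale_nil] comp_def scale_nil_lin)

lemma scale_nil_hinv: "scale_nil t (hinv M m 1) = hinv M m t"
  by (simp add: hinv_def rhom_prod_list[OF rhom_scale_nil] comp_def scale_nil_lin)

lemma scale_nil_euler: "scale_nil t (euler F) = euler (scale_nil t F)"
  by (rule nilcox_eqI) (simp add: mult.left_commute)

lemma coef_hfun: "coef (hfun M m t) w = t ^ len w * coef (hfun M m 1) w"
  using coef_scale_nil[of t "hfun M m 1" w] by (simp add: scale_nil_hfun)

lemma coef_logd: "coef (logd M m t) w = t ^ len w * coef (logd M m 1) w"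
proof -
  have "logd M m t = scale_nil t (logd M m 1)"
    by (simp add: logd_def rhom_mult[OF rhom_scale_nil] scale_nil_euler scale_nil_hfun scale_nil_hinv)
  then show ?thesis by simp
qed

lemma coef_logd_1 [simp]: "coef (logd M m t) 1 = 0"
  by (simp add: logd_def coef_mult)

lemma rhom_coef_logd_1: "rhom f \<Longrightarrow> f (coef (logd M m 1) w) = coef (logd M m 1) w"
proof -
  assume f: "rhom f"
  have "nilmap f (euler F) = euler (nilmap f F)" for F
    by (rule nilcox_eqI) (simp add: rhom_mult[OF f] rhom_of_nat[OF f])
  then have "nilmap f (logd M m 1) = logd M m 1"
    by (simp add: logd_def rhom_mult[OF rhom_nilmap[OF f]] nilmap_hfun[OF f] nilmap_hinv[OF f] rhom_1[OF f])
  then show ?thesis by (metis coef_nilmap)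
qed

text \<open>Dual numbers: the linear coefficient of \<open>hfun M m [:t, t:]\<close> is the Euler derivative, so it
  inherits the commutation.\<close>

lemma euler_hfun_commute: "euler (hfun M m s) * hfun M m t = hfun M m t * euler (hfun M m s)"
  for s t :: "'a::comm_ring_1"
proof (rule nilcox_eqI)
  fix w
  let ?F = "hfun M m [:s, s:]" and ?G = "hfun M m [:t:]"
  have const: "coef (hfun M m [:r:]) u = [:coef (hfun M m r) u:]" for r :: 'a and u
    using nilmap_hfun[OF rhom_pCons, of M m r] by (metis coef_nilmap)
  \<comment> \<open>The base is s (1 + e) with e the indeterminate, so the linear coefficient of its
    n-th power carries the Euler weight n.\<close>
  have lin: "coeff ([:s, s:] ^ n) 1 = of_nat n * s ^ n" for n
  proof (induction n)
    case (Suc n)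
    have "coeff ([:s, s:] ^ n) 0 = s ^ n" by (simp add: coeff_0_power)
    then show ?case using Suc by (simp add: algebra_simps)
  qed simp
  have F: "coeff (coef ?F u) 1 = coef (euler (hfun M m s)) u" for u
  proof -
    have "coef ?F u = [:s, s:] ^ len u * [:coef (hfun M m 1) u:]"
      using coef_hfun[of M m "[:s, s:]" u] const[of 1 u] by (simp add: one_pCons)
    then have "coeff (coef ?F u) 1 = coeff ([:s, s:] ^ len u) 1 * coef (hfun M m 1) u"
      by simp
    also have "\<dots> = coef (euler (hfun M m s)) u"
      unfolding lin coef_euler by (subst coef_hfun) simp
    finally show ?thesis .
  qed
  have "coeff (coef (?F * ?G) w) 1 = coef (euler (hfun M m s) * hfun M m t) w"
    unfolding coef_mult const coeff_sum 
    by (intro sum.cong) (auto simp: F[unfolded One_nat_def] mult.commute)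
  moreover have "coeff (coef (?G * ?F) w) 1 = coef (hfun M m t * euler (hfun M m s)) w"
    unfolding coef_mult const coeff_sum 
    by (intro sum.cong) (auto simp: F[unfolded One_nat_def] mult.commute)
  ultimately show "coef (euler (hfun M m s) * hfun M m t) w = coef (hfun M m t * euler (hfun M m s)) w"
    using hfun_commute[of M m "[:s, s:]" "[:t:]"] by simp
qed

lemma commute_inverse:
  fixes a b b' :: "'a::monoid_mult"
  assumes "a * b = b * a" "b * b' = 1" "b' * b = 1"
  shows "a * b' = b' * a"
proof -
  have "b' * a = b' * (a * b) * b'" by (simp add: mult.assoc assms(2))
  also have "\<dots> = b' * b * a * b'" by (simp add: assms(1) mult.assoc)
  finally show ?thesis by (simp add: assms(3))
qed

lemma logd_commute:
  "logd M m r * hfun M m t = hfun M m t * logd M m r" "logd M m r * hinv M m t = hinv M m t * logd M m r"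
proof -
  have "hinv M m r * hfun M m t = hfun M m t * hinv M m r"
    using commute_inverse[OF hfun_commute[of M m t r] hfun_hinv[of M m r]] by simp
  then show 1: "logd M m r * hfun M m t = hfun M m t * logd M m r"
    unfolding logd_def by (metis euler_hfun_commute mult.assoc)
  show "logd M m r * hinv M m t = hinv M m t * logd M m r"
    by (rule commute_inverse[OF 1 hfun_hinv])
qed

lemma euler_hfun: "euler (hfun M m t) = logd M m t * hfun M m t"
  by (simp add: logd_def mult.assoc hfun_hinv)

text \<open>Apply the derivation to h h^(-1) = 1.\<close>

lemma euler_hinv: "euler (hinv M m t) = - (logd M m t * hinv M m t)"
proof -
  have "hinv M m t * euler (hfun M m t * hinv M m t) = 0"
    by (simp add: hfun_hinv)
  then have "hinv M m t * logd M m t + hinv M m t * hfun M m t * euler (hinv M m t) = 0"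
    by (simp add: euler_mult logd_def distrib_left mult.assoc)
  then show ?thesis
    by (simp add: hfun_hinv logd_commute eq_neg_iff_add_eq_0 add.commute)
qed

definition logd_sum :: "int \<Rightarrow> int \<Rightarrow> 'a::comm_ring_1 list \<Rightarrow> 'a nilcox"
  where "logd_sum M m xs = (\<Sum>t\<leftarrow>xs. logd M m t)"

lemma logd_sum_commute:
  "logd_sum M m xs * hfun M m t = hfun M m t * logd_sum M m xs"
  "logd_sum M m xs * hinv M m t = hinv M m t * logd_sum M m xs"
  by (induction xs) (simp_all add: logd_sum_def distrib_left distrib_right logd_commute)

lemma logd_sum_commute_prod:
  "logd_sum M m xs * prod_list (map (hinv M m) ys) = prod_list (map (hinv M m) ys) * logd_sum M m xs"
proof (induction ys)
  case (Cons t ys)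
  have "logd_sum M m xs * (hinv M m t * F) = hinv M m t * (logd_sum M m xs * F)" for F
    by (simp add: logd_sum_commute flip: mult.assoc)
  then show ?case using Cons by (simp add: mult.assoc)
qed simp

lemma euler_prod_hfun:
  "euler (prod_list (map (hfun M m) xs)) = logd_sum M m xs * prod_list (map (hfun M m) xs)"
proof (induction xs)
  case (Cons t xs)
  have "hfun M m t * (logd_sum M m xs * F) = logd_sum M m xs * (hfun M m t * F)" for F
    by (simp add: logd_sum_commute flip: mult.assoc)
  then show ?case using Cons
    by (simp add: euler_mult euler_hfun logd_sum_def[of M m "t # xs"] distrib_right mult.assoc)
      (simp add: logd_sum_def)
qed (simp add: logd_sum_def)

lemma euler_prod_hinv:
  "euler (prod_list (map (hinv M m) xs)) = - (logd_sum M m xs * prod_list (map (hinv M m) xs))"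
proof (induction xs)
  case (Cons t xs)
  have "hinv M m t * (logd_sum M m xs * F) = logd_sum M m xs * (hinv M m t * F)" for F
    by (simp add: logd_sum_commute flip: mult.assoc)
  then show ?case using Cons
    by (simp add: euler_mult euler_hinv logd_sum_def[of M m "t # xs"] distrib_right mult.assoc)
      (simp add: logd_sum_def)
qed (simp add: logd_sum_def)

text \<open>The part of length k of \<open>logd M m t\<close> is homogeneous of degree k in t, so a
  sum over rows depends on the list only through its power sums.\<close>

lemma coef_logd_sum: "coef (logd_sum M m xs) w = (\<Sum>t\<leftarrow>xs. t ^ len w) * coef (logd M m 1) w"
proof (induction xs)
  case (Cons t xs)
  then show ?case using coef_logd[of M m t w] by (simp add: logd_sum_def distrib_right)
qed (simp add: logd_sum_def)

text \<open>The exponential of \<open>\<Sum>\<^sub>k y\<^sub>k b\<^sub>k\<close>, where \<open>b\<^sub>k\<close> is \<open>1/k\<close> times the part of degree \<open>k\<close> of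
  \<^term>\<open>logd M m 1\<close>. It is computed degree by degree from its Euler derivative; \<open>y\<close> is indexed
  from \<open>0\<close>, so \<^term>\<open>y (k - 1)\<close> belongs to \<open>b\<^sub>k\<close>.\<close>

lemma factorization_less:
  assumes "z \<in> factorizations w" "snd z \<noteq> w"
  shows "len (snd z) < len w"
proof -
  obtain u v where z: "z = (u, v)" by (cases z)
  have w: "w = u * v" "len w = len u + len v" using assms(1) by (auto simp: z mem_factorizations)
  then have "len u \<noteq> 0" using assms(2) by (auto simp: z)
  with w(2) have "len v < len w" by linarith
  then show ?thesis by (simp add: z)
qed

function expo :: "int \<Rightarrow> int \<Rightarrow> (nat \<Rightarrow> 'v mpoly) \<Rightarrow> int perm \<Rightarrow> 'v mpoly" where
  "expo m M y w = (if w = 1 then 1 else Const (1 / of_nat (len w)) *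
    (\<Sum>z\<in>{z \<in> factorizations w. snd z \<noteq> w}. y (len (fst z) - 1) * coef (logd M m 1) (fst z) * expo m M y (snd z)))"
  by auto
termination
proof (relation "measure (\<lambda>(m, M, y, w). len w)")
  fix m M :: int and y :: "nat \<Rightarrow> 'v mpoly" and w z
  assume "w \<noteq> 1" "z \<in> {z \<in> factorizations w. snd z \<noteq> w}"
  then have "len (snd z) < len w" using factorization_less by blast
  then show "((m, M, y, snd z), (m, M, y, w)) \<in> measure (\<lambda>(m, M, y, w). len w)"
    by simp
qed simp

declare expo.simps [simp del]

text \<open>Dividing the Euler equation by \<open>len w\<close> expresses the coefficient at w by
  coefficients at shorter elements.\<close>

lemma expo_unique:
  assumes "coef F 1 = 1" "euler F = G * F"
    and G: "\<And>u. u \<noteq> 1 \<Longrightarrow> coef G u = y (len u - 1) * coef (logd M m 1) u" "coef G 1 = 0"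
  shows "coef F w = expo m M y w"
proof (induction "len w" arbitrary: w rule: less_induct)
  case less
  show ?case
  proof (cases "w = 1")
    case True
    then show ?thesis using assms(1) by (simp add: expo.simps)
  next
    case False
    let ?Z = "{z \<in> factorizations w. snd z \<noteq> w}"
    have one: "Const (1 / of_nat (len w)) * of_nat (len w) = 1"
      using False by (simp add: rhom_1[OF rhom_Const] flip: rhom_of_nat[OF rhom_Const] rhom_mult[OF rhom_Const])
    have "of_nat (len w) * coef F w = coef (G * F) w"
      using arg_cong[OF assms(2), of "\<lambda>F. coef F w"] by simp
    also have "\<dots> = (\<Sum>z\<in>factorizations w. coef G (fst z) * coef F (snd z))"
      by (simp add: coef_mult split_def)
    \<comment> \<open>The omitted factorization is (1, w), where G vanishes.\<close>
    also have "\<dots> = (\<Sum>z\<in>?Z. coef G (fst z) * coef F (snd z))"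
    proof (intro sum.mono_neutral_right ballI)
      fix z assume "z \<in> factorizations w - ?Z"
      then have "len (fst z) = 0" by (cases z) (auto simp: mem_factorizations)
      then show "coef G (fst z) * coef F (snd z) = 0" using G(2) by simp
    qed auto
    also have "\<dots> = (\<Sum>z\<in>?Z. y (len (fst z) - 1) * coef (logd M m 1) (fst z) * expo m M y (snd z))"
    proof (intro sum.cong refl)
      fix z assume z: "z \<in> ?Z"
      then have ne: "fst z \<noteq> 1" by (cases z) (auto simp: mem_factorizations)
      have "len (snd z) < len w" using z factorization_less by blast
      then show "coef G (fst z) * coef F (snd z) =
          y (len (fst z) - 1) * coef (logd M m 1) (fst z) * expo m M y (snd z)"
        using less G(1)[OF ne] by simp
    qed
    finally have *: "of_nat (len w) * coef F w = (\<Sum>z\<in>?Z. y (len (fst z) - 1) * coef (logd M m 1) (fst z) * expo m M y (snd z))" .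
    have "coef F w = Const (1 / of_nat (len w)) * (of_nat (len w) * coef F w)"
      by (simp only: one mult_1 flip: mult.assoc)
    also have "\<dots> = expo m M y w"
      unfolding * using False by (simp add: expo.simps[of m M y w])
    finally show ?thesis .
  qed
qed

text \<open>The coefficients of \<open>logd M m 1\<close> are fixed by every ring homomorphism, so
  the exponential is a universal expression in y.\<close>

lemma subst_expo: "subst \<sigma> (expo m M y w) = expo m M (\<lambda>n. subst \<sigma> (y n)) w"
proof (induction "len w" arbitrary: w rule: less_induct)
  case less
  have "subst \<sigma> (expo m M y (snd z)) = expo m M (\<lambda>n. subst \<sigma> (y n)) (snd z)"
    if "z \<in> factorizations w" "snd z \<noteq> w" for z
    using less factorization_less[OF that] by blast
  then show ?case
    by (simp add: expo.simps[of m M _ w] rhom_1[OF rhom_subst] rhom_mult[OF rhom_subst] rhom_sum[OF rhom_subst]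
        subst_Const rhom_coef_logd_1[OF rhom_subst])
qed

text \<open>Logarithmic derivatives of commuting rows add, and those of inverse rows enter with a
  minus sign; the result is a difference of power sums.\<close>

lemma expo_prod:
  "coef (prod_list (map (hinv M m) ys) * prod_list (map (hfun M m) xs)) w =
    expo m M (\<lambda>n. (\<Sum>t\<leftarrow>xs. t ^ (n + 1)) - (\<Sum>t\<leftarrow>ys. t ^ (n + 1))) w"
proof (rule expo_unique)
  let ?H = "prod_list (map (hinv M m) ys)" and ?K = "prod_list (map (hfun M m) xs)"
  let ?G = "logd_sum M m xs - logd_sum M m ys"
  show "euler (?H * ?K) = ?G * (?H * ?K)"
    by (simp add: euler_mult euler_prod_hfun euler_prod_hinv left_diff_distrib logd_sum_commute_prod
        flip: mult.assoc)
  show "coef ?G 1 = 0" by (simp add: coef_logd_sum)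
  show "coef ?G u = ((\<Sum>t\<leftarrow>xs. t ^ (len u - 1 + 1)) - (\<Sum>t\<leftarrow>ys. t ^ (len u - 1 + 1))) * coef (logd M m 1) u"
    if "u \<noteq> 1" for u
  proof -
    \<comment> \<open>Natural subtraction is exact since u has positive length; index n in
      \<open>expo\<close> belongs to exponent n + 1.\<close>
    have "len u - 1 + 1 = len u" using that by (cases "len u") auto
    then show ?thesis by (simp add: coef_logd_sum left_diff_distrib)
  qed
  have h: "coef (hfun M m t) 1 = 1" for t :: "'a mpoly"
  proof -
    have "coef (lin c j * F) 1 = coef F 1" for c :: "'a mpoly" and j F
    proof -
      have "1 \<noteq> s j" using len_s[of j] len_1 by (metis zero_neq_one)
      then have "coef (gen j * F) 1 = 0" by (simp add: coef_mult gen_def base_def)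
      then show ?thesis by (simp add: lin_def distrib_right mult.assoc)
    qed
    then have "coef (prod_list (map (lin t) js)) 1 = 1" for js
      by (induction js) simp_all
    then show ?thesis by (simp add: hfun_def)
  qed
  have h': "coef (hinv M m t) 1 = 1" for t :: "'a mpoly"
  proof -
    have "coef (hfun M m t * hinv M m t) 1 = 1" by (simp only: hfun_hinv coef_1_1)
    then show ?thesis by (simp add: coef_mult h)
  qed
  have "coef ?H 1 = 1" by (induction ys) (simp_all add: coef_mult h')
  moreover have "coef ?K 1 = 1" by (induction xs) (simp_all add: coef_mult h)
  ultimately show "coef (?H * ?K) 1 = 1" by (simp add: coef_mult)
qed

section \<open>The back stable element as an exponential\<close>

lemma Phi_inv_split:
  "p \<le> k \<Longrightarrow> Phi_inv p M x = Phi_inv k M x * prod_list (map (\<lambda>i. hinv M i (x i)) (rev [p..k - 1]))"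
proof (induction k rule: int_ge_induct)
  case (step k)
  have "[p..k] = [p..k - 1] @ [k]" using step(1) by (rule upto_rec2)
  then show ?case using step by (cases "k \<le> M") (simp_all add: Phi_inv_rec mult.assoc)
qed simp

text \<open>Projecting to the subgroup that contains w makes every row with i < m start at m. These
  rows commute, so by \<open>expo_prod\<close> the middle factor depends on power sums
  alone.\<close>

lemma coef_Sch_lower:
  assumes "p \<le> m" "supported m M w"
  shows "coef (Sch p M x a) w = coef (Phi_inv m M a * (prod_list (map (hinv M m) (map a (rev [p..m - 1]))) *
    prod_list (map (hfun M m) (map x [p..m - 1]))) * Phi m M x) w"
proof -
  have 1: "restrict_supp m M (Phi p M x) = prod_list (map (hfun M m) (map x [p..m - 1])) * Phi m M x"
    unfolding Phi_split[OF assms(1)] rhom_mult[OF rhom_restrict_supp] rhom_prod_list[OF rhom_restrict_supp]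
      restrict_supp_Phi_upper[OF order_refl]
    by (intro arg_cong2[where f = "(*)"] arg_cong[where f = prod_list]) (auto simp: restrict_supp_hfun)
  have 2: "restrict_supp m M (Phi_inv p M a) = Phi_inv m M a * prod_list (map (hinv M m) (map a (rev [p..m - 1])))"
    unfolding Phi_inv_split[OF assms(1)] rhom_mult[OF rhom_restrict_supp] rhom_prod_list[OF rhom_restrict_supp]
      restrict_supp_Phi_upper[OF order_refl]
    by (intro arg_cong2[where f = "(*)"] arg_cong[where f = prod_list]) (auto simp: restrict_supp_hfun)
  have "coef (Sch p M x a) w = coef (restrict_supp m M (Sch p M x a)) w"
    using assms(2) by (simp add: coef_restrict_supp)
  then show ?thesis by (simp add: Sch_def rhom_mult[OF rhom_restrict_supp] 1 2 mult.assoc)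
qed

text \<open>The formula of \<open>coef_Sch_lower\<close>, with the power sums over p \<le> i < m
  replaced by the full p_(n+1) minus its part over m \<le> i \<le> 0. The lower end p has
  disappeared.\<close>

definition back_stable_expo :: "int \<Rightarrow> int \<Rightarrow> int perm \<Rightarrow> R"
  where "back_stable_expo m M w = coef (Phi_inv m M (\<lambda>i. Var (Base (A i))) *
    of_coef (expo m M (\<lambda>n. Var (P n) - (\<Sum>i\<in>{m..0}. Var (Base (X i)) ^ (n + 1) - Var (Base (A i)) ^ (n + 1)))) *
    Phi m M (\<lambda>i. Var (Base (X i)))) w"

lemma truncate_back_stable_expo:
  assumes "supported m M w" "p \<le> m" "m \<le> 0"
  shows "truncate p (back_stable_expo m M w) = dschub p M w"
proof -
  let ?x = "\<lambda>i. Var (X i) :: poly_xa" and ?a = "\<lambda>i. Var (A i) :: poly_xa"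
  let ?y = "\<lambda>n. Var (P n) - (\<Sum>i\<in>{m..0}. Var (Base (X i)) ^ (n + 1) - Var (Base (A i)) ^ (n + 1)) :: R"
  note hom = rhom_truncate[of p]
  have "truncate p (?y n) = (\<Sum>t\<leftarrow>map ?x [p..m - 1]. t ^ (n + 1)) - (\<Sum>t\<leftarrow>map ?a (rev [p..m - 1]). t ^ (n + 1))" for n
  proof -
    have "{p..0} = {p..m - 1} \<union> {m..0}" using assms by auto
    then have "(\<Sum>i\<in>{p..0}. ?x i ^ (n + 1) - ?a i ^ (n + 1)) =
        (\<Sum>i\<in>{p..m - 1}. ?x i ^ (n + 1) - ?a i ^ (n + 1)) + (\<Sum>i\<in>{m..0}. ?x i ^ (n + 1) - ?a i ^ (n + 1))"
      by (simp add: sum.union_disjoint)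
    moreover have "truncate p (?y n) = (\<Sum>i\<in>{p..0}. ?x i ^ (n + 1) - ?a i ^ (n + 1)) -
        (\<Sum>i\<in>{m..0}. ?x i ^ (n + 1) - ?a i ^ (n + 1))"
      unfolding rhom_diff[OF hom] rhom_sum[OF hom] rhom_power[OF hom]
      by (simp add: truncate_def subst_Var)
    ultimately show ?thesis
      by (simp add: sum_subtractf comp_def rev_map[symmetric] sum_list_distinct_conv_sum_set)
  qed
  then have E: "nilmap (truncate p) (of_coef (expo m M ?y)) =
    prod_list (map (hinv M m) (map ?a (rev [p..m - 1]))) * prod_list (map (hfun M m) (map ?x [p..m - 1]))"
    by (intro nilcox_eqI) (simp only: coef_nilmap coef_of_coef expo_prod truncate_def subst_expo)
  have "truncate p (back_stable_expo m M w) = coef (nilmap (truncate p) (Phi_inv m M (\<lambda>i. Var (Base (A i))) *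
    of_coef (expo m M ?y) * Phi m M (\<lambda>i. Var (Base (X i))))) w"
    by (simp add: back_stable_expo_def)
  also have "\<dots> = coef (Phi_inv m M ?a * (prod_list (map (hinv M m) (map ?a (rev [p..m - 1]))) *
      prod_list (map (hfun M m) (map ?x [p..m - 1]))) * Phi m M ?x) w"
    unfolding rhom_mult[OF rhom_nilmap[OF hom]] nilmap_Phi[OF hom] nilmap_Phi_inv[OF hom] E
    by (simp add: truncate_def subst_Var)
  also have "\<dots> = dschub p M w"
    unfolding dschub_def by (rule coef_Sch_lower[OF assms(2,1), symmetric])
  finally show ?thesis .
qed

text \<open>For p \<le> m the truncations of the formula equal the shifted Schubert polynomials, so
  both sides have the same limits and \<open>denotes_unique\<close> finishes.\<close>

lemma back_stable_eq:
  assumes "supported m M w" "m \<le> 0" "0 \<le> M"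
  shows "back_stable w = back_stable_expo m M w"
proof -
  let ?f = "back_stable_expo m M w" and ?S = "\<lambda>p. shift_poly (p - 1) (schubert_plus (shift_perm (1 - p) w))"
  have trunc: "truncate p ?f = ?S p" if "p \<le> m" for p
    using truncate_back_stable_expo[OF assms(1) that assms(2)] that
      shift_schubert_plus[OF supported_mono[OF assms(1) that order_refl]] assms by simp
  have ev: "\<forall>\<^sub>F p in at_bot. truncate p ?f = ?S p"
    using trunc by (auto simp: eventually_at_bot_linorder)
  have iff: "has_limit ?S L \<longleftrightarrow> denotes ?f L" for L
    unfolding has_limit_def denotes_def
    by (intro iff_allI eventually_subst eventually_mono[OF ev]) simp
  show ?thesis
    unfolding back_stable_def iff
  proof (rule the_equality)
    show "\<exists>L. denotes ?f L \<and> denotes ?f L" using denotes_exists by blast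
  qed (use denotes_unique in blast)
qed

lemma truncate_back_stable:
  assumes "supported m M w" "p \<le> m" "m \<le> 0" "0 \<le> M"
  shows "truncate p (back_stable w) = dschub p M w"
  using assms by (simp add: back_stable_eq truncate_back_stable_expo)

section \<open>Uniqueness and the two expansions\<close>

definition swap_R_var :: "int \<Rightarrow> xa lam \<Rightarrow> R"
  where "swap_R_var i v = (case v of
    P k \<Rightarrow> if i = 0 then Var (P k) + Var (Base (X 1)) ^ (k + 1) - Var (Base (X 0)) ^ (k + 1) else Var (P k)
  | Base z \<Rightarrow> (case z of X j \<Rightarrow> Var (Base (X (s i \<langle>$\<rangle> j))) | A j \<Rightarrow> Var (Base (A j))))"

text \<open>The symmetric group acts on \<^typ>\<open>R\<close> by permuting the \<open>x\<close> variables, and \<^term>\<open>s 0\<close> moves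
  \<open>x\<^sub>0\<close>, hence also the power sums.\<close>

definition swap_R :: "int \<Rightarrow> R \<Rightarrow> R"
  where "swap_R i = subst (swap_R_var i)"

text \<open>The swap acts on the second tensor factor only; the outer \<open>P k\<close> belongs to
  the first and is fixed.\<close>

definition swap_Lam_R :: "int \<Rightarrow> Lam_R \<Rightarrow> Lam_R"
  where "swap_Lam_R i = subst (\<lambda>v. case v of
    P k \<Rightarrow> Var (P k) | Base v \<Rightarrow> subst (\<lambda>v. Var (Base v)) (swap_R_var i v))"

definition tensor_left :: "Lam \<Rightarrow> Lam_R"
  where "tensor_left = subst (\<lambda>v. case v of P k \<Rightarrow> Var (P k) | Base i \<Rightarrow> Var (Base (Base (A i))))"

definition tensor_right :: "R \<Rightarrow> Lam_R"
  where "tensor_right = subst (\<lambda>v. Var (Base v))"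

lemma tensor_eq: "tensor f g = tensor_left f * tensor_right g"
  by (simp add: tensor_def tensor_left_def tensor_right_def)

lemma rhom_maps:
  "rhom (swap_R i)" "rhom (swap_Lam_R i)" "rhom tensor_left" "rhom tensor_right" "rhom coaction"
  "rhom eta" "rhom Lam_to_R" "rhom poly_to_R"
  by (simp_all add: swap_R_def swap_Lam_R_def tensor_left_def tensor_right_def coaction_def eta_def
      Lam_to_R_def poly_to_R_def rhom_subst)

text \<open>For i = 0 the term at 0 leaves the range and the term at 1 enters; for i < 0 the range
  is permuted, for i > 0 it is fixed. This is the source of the correction in
  \<open>swap_R_var\<close>.\<close>

lemma sum_swap:
  assumes "p \<le> i" "p \<le> 0"
  shows "(\<Sum>j\<in>{p..0}. g (s i \<langle>$\<rangle> j)) = (\<Sum>j\<in>{p..0}. g j) + (if i = 0 then g 1 - g 0 else (0 :: 'a::ab_group_add))"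
proof -
  consider "i = 0" | "i < 0" | "0 < i" by linarith
  then show ?thesis
  proof cases
    case 1
    have split: "(\<Sum>j\<in>{p..0}. h j) = h 0 + (\<Sum>j\<in>{p..-1}. h j)" for h :: "int \<Rightarrow> 'a"
    proof -
      have "{p..0} = insert 0 {p..-1}" using assms by auto
      then show ?thesis by simp
    qed
    have "(\<Sum>j\<in>{p..-1}. g (s i \<langle>$\<rangle> j)) = (\<Sum>j\<in>{p..-1}. g j)"
      by (rule sum.cong) (auto simp: apply_s 1)
    then show ?thesis by (simp add: split 1 apply_s)
  next
    case 2
    have "(\<Sum>j\<in>{p..0}. g (s i \<langle>$\<rangle> j)) = (\<Sum>j\<in>{p..0}. g j)"
      by (rule sum.reindex_bij_witness[where i = "\<lambda>j. s i \<langle>$\<rangle> j" and j = "\<lambda>j. s i \<langle>$\<rangle> j"])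
        (use assms 2 in \<open>auto simp: apply_s\<close>)
    then show ?thesis using 2 by simp
  next
    case 3
    have "(\<Sum>j\<in>{p..0}. g (s i \<langle>$\<rangle> j)) = (\<Sum>j\<in>{p..0}. g j)"
      by (rule sum.cong) (use 3 in \<open>auto simp: apply_s\<close>)
    then show ?thesis using 3 by simp
  qed
qed

lemma truncate_swap_R:
  assumes "p \<le> i" "p \<le> 0"
  shows "truncate p (swap_R i f) = swap_x i (truncate p f)"
proof (rule mpoly_eqI)
  fix \<rho> :: "xa \<Rightarrow> rat"
  have "(\<Sum>j\<in>{p..0}. \<rho> (X (s i \<langle>$\<rangle> j)) ^ (k + 1) - \<rho> (A j) ^ (k + 1)) =
    (\<Sum>j\<in>{p..0}. \<rho> (X j) ^ (k + 1) - \<rho> (A j) ^ (k + 1)) +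
    (if i = 0 then \<rho> (X 1) ^ (k + 1) - \<rho> (X 0) ^ (k + 1) else 0)" for k
    using sum_swap[OF assms, of "\<lambda>j. \<rho> (X j) ^ (k + 1)"] by (simp add: sum_subtractf)
  then show "eval \<rho> (truncate p (swap_R i f)) = eval \<rho> (swap_x i (truncate p f))"
    unfolding truncate_def swap_R_def swap_x_def eval_subst
    by (intro eval_cong) (auto simp: swap_R_var_def split: lam.split xa.split)
qed

text \<open>The recursion lifts from the truncations, which for all small p together determine an
  element of \<open>R\<close>.\<close>

lemma back_stable_swap:
  "back_stable w - swap_R i (back_stable w) =
    (Var (Base (X i)) - Var (Base (X (i + 1)))) * (if len (w * s i) < len w then back_stable (w * s i) else 0)"
proof -
  obtain m M where mM: "m \<le> min i 0" "max i 0 \<le> M" "supported m M w" using supported_exists by blast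
  then have ws: "supported m M (w * s i)" by (intro supported_mult) auto
  let ?f = "back_stable w - swap_R i (back_stable w) -
    (Var (Base (X i)) - Var (Base (X (i + 1)))) * (if len (w * s i) < len w then back_stable (w * s i) else 0)"
  have "truncate p ?f = 0" if "p \<le> m" for p
  proof -
    note hom = rhom_truncate[of p]
    have Var: "truncate p (Var (Base z)) = Var z" for z by (simp add: truncate_def subst_Var)
    have "truncate p ?f = dschub p M w - swap_x i (dschub p M w) -
      (Var (X i) - Var (X (i + 1))) * (if len (w * s i) < len w then dschub p M (w * s i) else 0)"
      using that mM ws
      by (simp add: rhom_diff[OF hom] rhom_mult[OF hom] rhom_0[OF hom] Var truncate_swap_R truncate_back_stable)
    also have "\<dots> = 0" using dschub_swap[of p i M w] that mM by simp
    finally show ?thesis .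
  qed
  then have "?f = 0" by (rule truncate_eq_0_imp_eq_0)
  then show ?thesis by simp
qed

text \<open>The value of the whole power series at x = a, where each p_k vanishes;
  \<open>eta\<close> instead keeps the power sums.\<close>

definition specialize :: "R \<Rightarrow> Lam"
  where "specialize = subst (\<lambda>v. case v of P k \<Rightarrow> 0 | Base z \<Rightarrow> Var (Base (index z)))"

lemma specialize_back_stable: "specialize (back_stable v) = (if v = 1 then 1 else 0)"
proof -
  obtain m M where mM: "m \<le> 0" "0 \<le> M" "supported m M v" using supported_exists by blast
  let ?h = "subst (\<lambda>z. Var (Base (index z))) :: poly_xa \<Rightarrow> Lam"
  have "specialize f = ?h (truncate m f)" for f
  proof (rule mpoly_eqI)
    fix \<rho> :: "int lam \<Rightarrow> rat"
    show "eval \<rho> (specialize f) = eval \<rho> (?h (truncate m f))"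
      unfolding specialize_def truncate_def eval_subst
      by (intro eval_cong) (auto split: lam.split)
  qed
  then show ?thesis
    using mM by (simp add: truncate_back_stable rhom_dschub[OF rhom_subst] subst_Var coef_1)
qed

text \<open>At w the right-hand side involves only a shorter element, which vanishes by induction.
  Hence each coefficient is fixed by the swaps in J.\<close>

lemma eq_0_by_swaps:
  fixes G :: "'v mpoly nilcox"
  assumes "\<And>i. i \<in> J \<Longrightarrow> G - nilmap (\<sigma> i) G = scal (d i) * (G * gen i)"
    and "\<And>w. (\<And>i. i \<in> J \<Longrightarrow> \<sigma> i (coef G w) = coef G w) \<Longrightarrow> coef G w = 0"
  shows "G = 0"
proof (rule nilcox_eqI)
  fix w
  show "coef G w = coef 0 w"
  proof (induction "len w" arbitrary: w rule: less_induct)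
    case less
    have "\<sigma> i (coef G w) = coef G w" if "i \<in> J" for i
    proof -
      have "coef (G * gen i) w = 0" using less by (simp add: coef_mult_gen)
      then show ?thesis using arg_cong[OF assms(1)[OF that], of "\<lambda>F. coef F w"] by simp
    qed
    then show ?case using assms(2) by simp
  qed
qed

text \<open>The recursion acts at the right end, so a left factor fixed by the swap passes through
  it.\<close>

lemma swap_product:
  assumes "rhom f" "nilmap f F = F" "H - nilmap f H = scal d * (H * gen i)"
  shows "F * H - nilmap f (F * H) = scal d * (F * H * gen i)"
proof -
  have "F * H - nilmap f (F * H) = F * (H - nilmap f H)"
    by (simp add: rhom_mult[OF rhom_nilmap[OF assms(1)]] assms(2) right_diff_distrib)
  then show ?thesis unfolding assms(3) by (simp only: scal_left_commute mult.assoc)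
qed

lemma swap_diff:
  assumes "rhom f" "H - nilmap f H = scal d * (H * gen i)" "K - nilmap f K = scal d * (K * gen i)"
  shows "(H - K) - nilmap f (H - K) = scal d * ((H - K) * gen i)"
proof -
  have "(H - K) - nilmap f (H - K) = (H - nilmap f H) - (K - nilmap f K)"
    by (simp add: rhom_diff[OF rhom_nilmap[OF assms(1)]])
  then show ?thesis unfolding assms(2,3) by (simp only: left_diff_distrib right_diff_distrib)
qed

lemma swap_nilmap:
  assumes "rhom f" "H - nilmap g H = scal d * (H * gen i)" "\<And>x. f (g x) = g' (f x)"
  shows "nilmap f H - nilmap g' (nilmap f H) = scal (f d) * (nilmap f H * gen i)"
proof -
  have "nilmap g' (nilmap f H) = nilmap f (nilmap g H)"
    by (rule nilcox_eqI) (simp add: assms(3))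
  then show ?thesis
    using arg_cong[OF assms(2), of "nilmap f"]
    by (simp add: rhom_diff[OF rhom_nilmap[OF assms(1)]] rhom_mult[OF rhom_nilmap[OF assms(1)]]
        nilmap_scal[OF assms(1)] nilmap_gen[OF assms(1)])
qed

definition back_stable_nil :: "R nilcox"
  where "back_stable_nil = of_coef back_stable"

definition stanley_nil :: "Lam nilcox"
  where "stanley_nil = of_coef double_stanley"

text \<open>Extension by 0 respects the recursion for i \<noteq> 0, because multiplication by these
  s_i preserves \<open>S_nonzero\<close> and its complement.\<close>

definition schubert_nil :: "poly_xa nilcox"
  where "schubert_nil = of_coef (\<lambda>v. if v \<in> S_nonzero then schubert v else 0)"

lemma back_stable_nil_swap:
  "back_stable_nil - nilmap (swap_R i) back_stable_nil =
    scal (Var (Base (X i)) - Var (Base (X (i + 1)))) * (back_stable_nil * gen i)"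
  by (rule nilcox_eqI) (simp only: coef_diff coef_nilmap coef_scal_mult coef_mult_gen back_stable_nil_def
      coef_of_coef back_stable_swap)

lemma schubert_nil_swap:
  assumes "i \<noteq> 0"
  shows "schubert_nil - nilmap (swap_x i) schubert_nil =
    scal (Var (X i) - Var (X (i + 1))) * (schubert_nil * gen i)"
proof (rule nilcox_eqI)
  fix w
  show "coef (schubert_nil - nilmap (swap_x i) schubert_nil) w =
    coef (scal (Var (X i) - Var (X (i + 1))) * (schubert_nil * gen i)) w"
  proof (cases "w \<in> S_nonzero")
    case True
    then show ?thesis using schubert_swap[OF True assms] S_nonzero_mult_s_iff[OF assms, of w]
      by (simp only: coef_diff coef_nilmap coef_scal_mult coef_mult_gen schubert_nil_def coef_of_coef if_True)
  next
    case False
    then show ?thesis using S_nonzero_mult_s_iff[OF assms, of w]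
      by (simp add: coef_mult_gen schubert_nil_def rhom_0[OF rhom_swap_x])
  qed
qed

text \<open>The counit of the second tensor factor combined with x = a. After
  \<open>coaction\<close>, the counit law leaves exactly \<open>eta\<close>.\<close>

definition counit_right :: "Lam_R \<Rightarrow> Lam"
  where "counit_right = subst (\<lambda>v. case v of P k \<Rightarrow> Var (P k)
    | Base v \<Rightarrow> (case v of P k \<Rightarrow> 0 | Base z \<Rightarrow> Var (Base (index z))))"

lemma rhom_counit_right: "rhom counit_right"
  by (simp add: counit_right_def rhom_subst)

lemma counit_right_simps:
  "counit_right (coaction f) = eta f"
  "counit_right (tensor_left h) = h"
  "counit_right (tensor_right f) = specialize f"
proof -
  show "counit_right (coaction f) = eta f"
    by (rule mpoly_eqI, unfold counit_right_def coaction_def eta_def eval_subst, rule eval_cong)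
      (auto split: lam.split xa.split)
  show "counit_right (tensor_left h) = h"
    by (rule mpoly_eqI, unfold counit_right_def tensor_left_def eval_subst, rule eval_cong)
      (auto split: lam.split)
  show "counit_right (tensor_right f) = specialize f"
    by (rule mpoly_eqI, unfold counit_right_def tensor_right_def specialize_def eval_subst, rule eval_cong)
      (auto split: lam.split)
qed

lemma coaction_swap: "coaction (swap_R i f) = swap_Lam_R i (coaction f)"
  by (rule mpoly_eqI, unfold coaction_def swap_R_def swap_Lam_R_def eval_subst, rule eval_cong)
    (auto simp: swap_R_var_def split: lam.split xa.split)

lemma tensor_right_swap: "tensor_right (swap_R i f) = swap_Lam_R i (tensor_right f)"
  by (rule mpoly_eqI, unfold tensor_right_def swap_R_def swap_Lam_R_def eval_subst, rule eval_cong)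
    (auto simp: swap_R_var_def split: lam.split xa.split)

lemma tensor_left_swap: "swap_Lam_R i (tensor_left f) = tensor_left f"
  by (rule mpoly_eqI, unfold tensor_left_def swap_Lam_R_def eval_subst, rule eval_cong)
    (auto simp: swap_R_var_def split: lam.split xa.split)

lemma poly_to_R_swap: "poly_to_R (swap_x i f) = swap_R i (poly_to_R f)"
  by (rule mpoly_eqI, unfold poly_to_R_def swap_R_def swap_x_def eval_subst, rule eval_cong)
    (auto simp: swap_R_var_def split: lam.split xa.split)

lemma Lam_to_R_swap: "i \<noteq> 0 \<Longrightarrow> swap_R i (Lam_to_R f) = Lam_to_R f"
  by (rule mpoly_eqI, unfold Lam_to_R_def swap_R_def eval_subst, rule eval_cong)
    (auto simp: swap_R_var_def split: lam.split xa.split)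

lemma eta_Lam_to_R: "eta (Lam_to_R f) = f"
  by (rule mpoly_eqI, unfold Lam_to_R_def eta_def eval_subst, rule eval_cong)
    (auto split: lam.split xa.split)

text \<open>By \<open>eval_symmetric_const\<close> the x_j do not affect the value, so they may be
  replaced by the a_j; the power sums remain.\<close>

lemma fixed_by_swaps_R:
  assumes "\<And>i. i \<noteq> 0 \<Longrightarrow> swap_R i g = g"
  shows "g = Lam_to_R (eta g)"
proof (rule mpoly_eqI)
  fix \<rho> :: "xa lam \<Rightarrow> rat"
  let ?c = "\<lambda>v :: xa lam. case v of P k \<Rightarrow> None | Base z \<Rightarrow> (case z of X j \<Rightarrow> Some j | A j \<Rightarrow> None)"
  have sym: "eval (plug ?c \<rho> (\<lambda>j. x (s i \<langle>$\<rangle> j))) g = eval (plug ?c \<rho> x) g" if "i \<noteq> 0" for i x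
  proof -
    have "eval (plug ?c \<rho> x) g = eval (plug ?c \<rho> x) (swap_R i g)" using assms that by simp
    also have "\<dots> = eval (plug ?c \<rho> (\<lambda>j. x (s i \<langle>$\<rangle> j))) g"
      unfolding swap_R_def eval_subst
      by (rule eval_cong) (use that in \<open>auto simp: swap_R_var_def plug_def split: lam.split xa.split\<close>)
    finally show ?thesis by simp
  qed
  have "eval \<rho> g = eval (plug ?c \<rho> (\<lambda>j. \<rho> (Base (X j)))) g"
    by (rule eval_cong) (auto simp: plug_def split: lam.split xa.split)
  also have "\<dots> = eval (plug ?c \<rho> (\<lambda>j. \<rho> (Base (A j)))) g"
    by (rule eval_symmetric_const) (rule sym)
  also have "\<dots> = eval \<rho> (Lam_to_R (eta g))"
    unfolding Lam_to_R_def eta_def eval_subst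
    by (rule eval_cong) (auto simp: plug_def split: lam.split xa.split)
  finally show "eval \<rho> g = eval \<rho> (Lam_to_R (eta g))" .
qed

text \<open>The swaps with i \<noteq> 0 remove the x_j. Invariance under s_0 then allows power sum
  translations in the second factor, so every value equals one at x = a with these power sums 0,
  which is a value of \<open>counit_right g\<close>.\<close>

lemma fixed_by_swaps_Lam_R:
  assumes fixed: "\<And>i. swap_Lam_R i g = g" and zero: "counit_right g = 0"
  shows "g = 0"
proof (rule eval_eq_0_imp_eq_0)
  fix \<rho> :: "xa lam lam \<Rightarrow> rat"
  let ?c = "\<lambda>v :: xa lam lam. case v of P k \<Rightarrow> None | Base v \<Rightarrow>
    (case v of P k \<Rightarrow> None | Base z \<Rightarrow> (case z of X j \<Rightarrow> Some j | A j \<Rightarrow> None))"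
  let ?d = "\<lambda>v :: xa lam lam. case v of P k \<Rightarrow> None | Base v \<Rightarrow> (case v of P k \<Rightarrow> Some k | Base z \<Rightarrow> None)"
  have sym: "eval (plug ?c \<rho> (\<lambda>j. x (s i \<langle>$\<rangle> j))) g = eval (plug ?c \<rho> x) g" if "i \<noteq> 0" for i x \<rho>
  proof -
    have "eval (plug ?c \<rho> x) g = eval (plug ?c \<rho> x) (swap_Lam_R i g)" using fixed by simp
    also have "\<dots> = eval (plug ?c \<rho> (\<lambda>j. x (s i \<langle>$\<rangle> j))) g"
      unfolding swap_Lam_R_def eval_subst
      by (rule eval_cong) (use that in \<open>auto simp: swap_R_var_def plug_def split: lam.split xa.split\<close>)
    finally show ?thesis by simp
  qed
  have const: "eval (plug ?c \<rho> x) g = eval (plug ?c \<rho> x') g" for \<rho> x x'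
    by (rule eval_symmetric_const) (rule sym)
  define E where "E x y = eval (plug ?c (plug ?d \<rho> y) x) g" for x y
  have E_x: "E x y = E x' y" for x x' y unfolding E_def by (rule const)
  have step: "E x (\<lambda>k. y k + t ^ (k + 1)) = E x y" for x y t
  proof -
    \<comment> \<open>With x_1 = t and x_0 = 0, the swap s_0 adds t^(k+1) to coordinate k of the
      power sums of the second factor.\<close>
    let ?x = "\<lambda>j. if j = 1 then t else 0"
    have "E ?x y = eval (plug ?c (plug ?d \<rho> y) ?x) (swap_Lam_R 0 g)" using fixed by (simp add: E_def)
    also have "\<dots> = E (\<lambda>j. ?x (s 0 \<langle>$\<rangle> j)) (\<lambda>k. y k + t ^ (k + 1))"
      unfolding swap_Lam_R_def eval_subst E_def
      by (rule eval_cong) (auto simp: swap_R_var_def plug_def split: lam.split xa.split)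
    finally show ?thesis using E_x[of x y ?x] E_x[of x "\<lambda>k. y k + t ^ (k + 1)"] by metis
  qed
  let ?a = "\<lambda>j. \<rho> (Base (Base (A j)))" and ?x = "\<lambda>j. \<rho> (Base (Base (X j)))"
  have "E ?x (\<lambda>k. 0 + (\<Sum>t\<leftarrow>ts. t ^ (k + 1))) = E ?x (\<lambda>k. 0)" for ts
  proof (induction ts)
    case (Cons t ts)
    then show ?case using step[of ?x "\<lambda>k. \<Sum>t\<leftarrow>ts. t ^ (k + 1)" t] by (simp add: add.commute)
  qed simp
  moreover have "E ?x (\<lambda>k. 0) = 0"
  proof -
    have "E ?a (\<lambda>k. 0) = eval (\<lambda>v. case v of P k \<Rightarrow> \<rho> (P k) | Base i \<Rightarrow> ?a i) (counit_right g)"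
      unfolding counit_right_def eval_subst E_def
      by (rule eval_cong) (auto simp: plug_def index_def split: lam.split xa.split)
    then show ?thesis using zero E_x[of ?x "\<lambda>k. 0" ?a] by simp
  qed
  moreover have E_plug: "E ?x y = eval (plug ?d \<rho> y) g" for y
    unfolding E_def by (rule eval_cong) (auto simp: plug_def split: lam.split xa.split)
  ultimately have "eval (plug ?d \<rho> (\<lambda>k. 0 + (\<Sum>t\<leftarrow>ts. t ^ (k + 1)))) g = 0" for ts
    by simp
  from eval_power_sums_zero[OF this, of "\<lambda>k. \<rho> (Base (P k))"]
  have "eval (plug ?d \<rho> (\<lambda>k. \<rho> (Base (P k)))) g = 0" .
  moreover have "plug ?d \<rho> (\<lambda>k. \<rho> (Base (P k))) = \<rho>"
    by (auto simp: plug_def fun_eq_iff split: lam.split)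
  ultimately show "eval \<rho> g = 0" by simp
qed

lemma coaction_back_stable_nil:
  "nilmap coaction back_stable_nil = nilmap tensor_left stanley_nil * nilmap tensor_right back_stable_nil"
proof -
  let ?T = "nilmap tensor_left stanley_nil * nilmap tensor_right back_stable_nil"
  let ?G = "nilmap coaction back_stable_nil - ?T"
  let ?d = "\<lambda>i. Var (Base (Base (X i))) - Var (Base (Base (X (i + 1)))) :: Lam_R"
  have d: "coaction (Var (Base (X i)) - Var (Base (X (i + 1)))) = ?d i"
    "tensor_right (Var (Base (X i)) - Var (Base (X (i + 1)))) = ?d i" for i
    unfolding rhom_diff[OF rhom_maps(4)] rhom_diff[OF rhom_maps(5)]
    by (simp_all add: coaction_def tensor_right_def subst_Var)
  have 1: "nilmap coaction back_stable_nil - nilmap (swap_Lam_R i) (nilmap coaction back_stable_nil) =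
      scal (?d i) * (nilmap coaction back_stable_nil * gen i)" for i
    
    using swap_nilmap[OF rhom_maps(5) back_stable_nil_swap, of i "swap_Lam_R i"] coaction_swap
    unfolding d by blast
  have 2: "?T - nilmap (swap_Lam_R i) ?T = scal (?d i) * (?T * gen i)" for i
  proof (rule swap_product[OF rhom_maps(2)])
    show "nilmap (swap_Lam_R i) (nilmap tensor_left stanley_nil) = nilmap tensor_left stanley_nil"
      by (rule nilcox_eqI) (simp add: tensor_left_swap)
    show "nilmap tensor_right back_stable_nil - nilmap (swap_Lam_R i) (nilmap tensor_right back_stable_nil) =
      scal (?d i) * (nilmap tensor_right back_stable_nil * gen i)"
      using swap_nilmap[OF rhom_maps(4) back_stable_nil_swap, of i "swap_Lam_R i"] tensor_right_swap
      unfolding d by blast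
  qed
  have "nilmap counit_right ?T = stanley_nil"
  proof -
    have "nilmap counit_right (nilmap tensor_left stanley_nil) = stanley_nil"
      by (rule nilcox_eqI) (simp add: counit_right_simps)
    moreover have "nilmap counit_right (nilmap tensor_right back_stable_nil) = 1"
      by (rule nilcox_eqI) (simp add: counit_right_simps back_stable_nil_def specialize_back_stable coef_1)
    ultimately show ?thesis by (simp add: rhom_mult[OF rhom_nilmap[OF rhom_counit_right]])
  qed
  moreover have "nilmap counit_right (nilmap coaction back_stable_nil) = stanley_nil"
    by (rule nilcox_eqI) (simp add: counit_right_simps back_stable_nil_def stanley_nil_def double_stanley_def)
  ultimately have 3: "nilmap counit_right ?G = 0"
    by (simp add: rhom_diff[OF rhom_nilmap[OF rhom_counit_right]])
  \<comment> \<open>All swaps may be used here, s_0 included, so vanishing under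
    \<open>counit_right\<close> suffices.\<close>
  have "?G = 0"
  proof (rule eq_0_by_swaps[where J = UNIV])
    show "?G - nilmap (swap_Lam_R i) ?G = scal (?d i) * (?G * gen i)" for i
      by (rule swap_diff[OF rhom_maps(2) 1 2])
    fix w assume "\<And>i. i \<in> UNIV \<Longrightarrow> swap_Lam_R i (coef ?G w) = coef ?G w"
    moreover have "counit_right (coef ?G w) = 0"
      using arg_cong[OF 3, of "\<lambda>F. coef F w"] by simp
    ultimately show "coef ?G w = 0" by (intro fixed_by_swaps_Lam_R) auto
  qed
  then show ?thesis by simp
qed

lemma back_stable_nil_eq:
  "back_stable_nil = nilmap Lam_to_R stanley_nil * nilmap poly_to_R schubert_nil"
proof -
  let ?T = "nilmap Lam_to_R stanley_nil * nilmap poly_to_R schubert_nil"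
  let ?G = "back_stable_nil - ?T"
  let ?d = "\<lambda>i. Var (Base (X i)) - Var (Base (X (i + 1))) :: R"
  have d: "poly_to_R (Var (X i) - Var (X (i + 1))) = ?d i" for i
    unfolding rhom_diff[OF rhom_maps(8)] by (simp add: poly_to_R_def subst_Var)
  have 2: "?T - nilmap (swap_R i) ?T = scal (?d i) * (?T * gen i)" if "i \<noteq> 0" for i
  proof (rule swap_product[OF rhom_maps(1)])
    show "nilmap (swap_R i) (nilmap Lam_to_R stanley_nil) = nilmap Lam_to_R stanley_nil"
      by (rule nilcox_eqI) (simp add: Lam_to_R_swap that)
    show "nilmap poly_to_R schubert_nil - nilmap (swap_R i) (nilmap poly_to_R schubert_nil) =
      scal (?d i) * (nilmap poly_to_R schubert_nil * gen i)"
      using swap_nilmap[OF rhom_maps(8) schubert_nil_swap[OF that], of "swap_R i"] poly_to_R_swap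
      unfolding d by blast
  qed
  have "nilmap eta ?T = stanley_nil"
  proof -
    have "nilmap eta (nilmap Lam_to_R stanley_nil) = stanley_nil"
      by (rule nilcox_eqI) (simp add: eta_Lam_to_R)
    moreover have "eta (poly_to_R (schubert v)) = (if v = 1 then 1 else 0)" if "v \<in> S_nonzero" for v
      by (rule rhom_schubert_same[OF rhom_comp[OF rhom_maps(6,8)] _ that])
        (simp add: poly_to_R_def eta_def subst_Var)
    then have "nilmap eta (nilmap poly_to_R schubert_nil) = 1"
      by (intro nilcox_eqI) (auto simp: schubert_nil_def coef_1 rhom_0[OF rhom_maps(8)] rhom_0[OF rhom_maps(6)])
    ultimately show ?thesis by (simp add: rhom_mult[OF rhom_nilmap[OF rhom_maps(6)]])
  qed
  moreover have "nilmap eta back_stable_nil = stanley_nil"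
    by (rule nilcox_eqI) (simp add: back_stable_nil_def stanley_nil_def double_stanley_def)
  ultimately have 3: "nilmap eta ?G = 0"
    by (simp add: rhom_diff[OF rhom_nilmap[OF rhom_maps(6)]])
  \<comment> \<open>The recursion of the Schubert factor excludes s_0, so power sums may survive in
    a coefficient fixed by the swaps; \<open>eta\<close> sees them.\<close>
  have "?G = 0"
  proof (rule eq_0_by_swaps[where J = "- {0}"])
    show "?G - nilmap (swap_R i) ?G = scal (?d i) * (?G * gen i)" if "i \<in> - {0}" for i
      using that by (intro swap_diff[OF rhom_maps(1) back_stable_nil_swap 2]) simp
    fix w assume "\<And>i. i \<in> - {0} \<Longrightarrow> swap_R i (coef ?G w) = coef ?G w"
    then have "coef ?G w = Lam_to_R (eta (coef ?G w))" by (intro fixed_by_swaps_R) auto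
    moreover have "eta (coef ?G w) = 0"
      using arg_cong[OF 3, of "\<lambda>F. coef F w"] by simp
    ultimately show "coef ?G w = 0" by (simp add: rhom_0[OF rhom_maps(7)])
  qed
  then show ?thesis by simp
qed

theorem theorem4p14:
  fixes w :: "int perm"
  shows "coaction (back_stable w) =
      (\<Sum>(u, v)\<in>{(u, v). reduced_prod w u v}. tensor (double_stanley u) (back_stable v)) \<and>
    back_stable w =
      (\<Sum>(u, v)\<in>{(u, v). reduced_prod w u v \<and> v \<in> S_nonzero}.
        Lam_to_R (double_stanley u) * poly_to_R (schubert v))"
proof
  show "coaction (back_stable w) =
      (\<Sum>(u, v)\<in>{(u, v). reduced_prod w u v}. tensor (double_stanley u) (back_stable v))"
    using arg_cong[OF coaction_back_stable_nil, of "\<lambda>F. coef F w"]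
    by (simp add: coef_mult back_stable_nil_def stanley_nil_def tensor_eq factorizations_def)
  have "back_stable w = (\<Sum>(u, v)\<in>factorizations w.
      Lam_to_R (double_stanley u) * poly_to_R (if v \<in> S_nonzero then schubert v else 0))"
    using arg_cong[OF back_stable_nil_eq, of "\<lambda>F. coef F w"]
    by (simp add: coef_mult back_stable_nil_def stanley_nil_def schubert_nil_def)
  also have "\<dots> = (\<Sum>(u, v)\<in>{(u, v). reduced_prod w u v \<and> v \<in> S_nonzero}.
      Lam_to_R (double_stanley u) * poly_to_R (schubert v))"
    by (rule sum.mono_neutral_cong_right)
      (auto simp: mem_factorizations reduced_prod_def rhom_0[OF rhom_maps(8)] split: if_splits)
  finally show "back_stable w = (\<Sum>(u, v)\<in>{(u, v). reduced_prod w u v \<and> v \<in> S_nonzero}.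
      Lam_to_R (double_stanley u) * poly_to_R (schubert v))" .
qed

end
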